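(* Let $\varphi\in\Phi$ and let $-A$ be the generator of a bounded analytic $C_0$-semigroup $(e^{-tA})_{t\ge0}$ on a Banach space $X$. Then there exists $C>0$ such that for every $\alpha\in[0,1]$, $$\|e^{-nt\varphi(A/n)}x-e^{-tA}x\|\le\frac{C}{n\,t^{1-\alpha}}\|A^\alpha x\|,$$ $$\|e^{-n\varphi(tA/n)}x-e^{-tA}x\|\le\frac{C\,t^\alpha}{n}\|A^\alpha x\|,$$ for all $x\in\operatorname{dom}(A^\alpha)$, $n\in\mathbb N$ and $t>0$.
   Context: A function $f\in C^\infty(0,\infty)$ is completely monotone if $f\ge0$ and $(-1)^nf^{(n)}\ge0$ on $(0,\infty)$ for all $n\in\mathbb N$. A nonnegative $\varphi\in C^\infty(0,\infty)$ is a Bernstein function if $\varphi'$ is completely monotone; it extends analytically to $\mathbb C_+=\{\operatorname{Re}z>0\}$ and continuously to $\overline{\mathbb C_+}$, and is identified with this extension. $\Phi$ is the set of Bernstein functions $\varphi$ with $\varphi(0)=0$, $\varphi'(0+)=1$, $|\varphi''(0+)|<\infty$. Subordination: for a Bernstein function $\varphi$ and $t\ge0$ there is a unique positive Radon measure $\nu_t$ on $[0,\infty)$ of total mass at most $1$ with $\int_0^\infty e^{-zs}\nu_t(ds)=e^{-t\varphi(z)}$ for $z\in\mathbb C_+$. For any generator $-B$ of a bounded $C_0$-semigroup, $e^{-t\varphi(B)}:=\int_0^\infty e^{-sB}\,\nu_t(ds)$ (strong integral); this is used with $B=A/n$ and $B=tA/n$. A $C_0$-semigroup is bounded analytic if,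 for some $\theta\in(0,\pi/2]$, it has an analytic extension to $\{\lambda:|\arg\lambda|<\theta\}$ bounded on $\{\lambda:|\arg\lambda|<\theta'\}$ for every $\theta'\in(0,\theta)$; equivalently, $\sup_{t\ge0}\|e^{-tA}\|<\infty$ and $\sup_{t>0}\|tAe^{-tA}\|<\infty$. $A^\alpha$ is the usual fractional power of the (sectorial) operator $A$, with $A^0=I$. *)

theory Defs
  imports "HOL-Analysis.Analysis"
begin

section \<open>Complex Banach spaces\<close>

class complex_banach = banach +
  fixes scaleC :: "complex \<Rightarrow> 'a \<Rightarrow> 'a" (infixr "*\<^sub>C" 75)
  assumes scaleC_add_right: "c *\<^sub>C (x + y) = c *\<^sub>C x + c *\<^sub>C y"
    and scaleC_add_left: "(c + d) *\<^sub>C x = c *\<^sub>C x + d *\<^sub>C x"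
    and scaleC_scaleC: "c *\<^sub>C (d *\<^sub>C x) = (c * d) *\<^sub>C x"
    and scaleC_of_real: "of_real r *\<^sub>C x = r *\<^sub>R x"
    and norm_scaleC: "norm (c *\<^sub>C x) = cmod c * norm x"

instantiation complex :: complex_banach
begin

definition scaleC_complex :: "complex \<Rightarrow> complex \<Rightarrow> complex"
  where "scaleC_complex c x = c * x"

instance
  by standard (auto simp: scaleC_complex_def algebra_simps norm_mult scaleR_conv_of_real)

end

text \<open>Elements of the library type of bounded operators are only real-linear.\<close>

definition complex_linear :: "('a::complex_banach \<Rightarrow>\<^sub>L 'a) \<Rightarrow> bool" where
  "complex_linear T \<longleftrightarrow> (\<forall>c x. T (c *\<^sub>C x) = c *\<^sub>C T x)"


section \<open>The Bochner integral in an arbitrary Banach space\<close>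

text \<open>The library's Bochner integral is restricted to second countable (i.e. separable) spaces.
  This is the same definition without that restriction.\<close>

definition has_Bochner_integral ::
  "'b measure \<Rightarrow> ('b \<Rightarrow> 'a::real_normed_vector) \<Rightarrow> 'a \<Rightarrow> bool" where
  "has_Bochner_integral M f y \<longleftrightarrow>
     f \<in> borel_measurable M \<and>
     (\<exists>s. (\<forall>i. Bochner_Integration.simple_bochner_integrable M (s i)) \<and>
        (\<lambda>i::nat. \<integral>\<^sup>+x. norm (f x - s i x) \<partial>M) \<longlonglongrightarrow> 0 \<and>
        (\<lambda>i. Bochner_Integration.simple_bochner_integral M (s i)) \<longlonglongrightarrow> y)"

definition Bochner_integral :: "'b measure \<Rightarrow> ('b \<Rightarrow> 'a::real_normed_vector) \<Rightarrow> 'a" where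
  "Bochner_integral M f = (THE y. has_Bochner_integral M f y)"


section \<open>Semigroups and generators\<close>

text \<open>Semigroups are indexed by \<open>real\<close>; their values at negative arguments are irrelevant.\<close>

definition C0_semigroup :: "(real \<Rightarrow> 'a::complex_banach \<Rightarrow>\<^sub>L 'a) \<Rightarrow> bool" where
  "C0_semigroup T \<longleftrightarrow>
     (\<forall>t\<ge>0. complex_linear (T t)) \<and>
     T 0 = id_blinfun \<and>
     (\<forall>s\<ge>0. \<forall>t\<ge>0. T (s + t) = T s o\<^sub>L T t) \<and>
     (\<forall>x. ((\<lambda>t. T t x) \<longlongrightarrow> x) (at_right 0))"

text \<open>Unbounded operators are represented by their graphs. The negative generator of
  $(e^{-tA})_{t \ge 0}$ is $A$ itself.\<close>

definition neg_generator :: "(real \<Rightarrow> 'a::complex_banach \<Rightarrow>\<^sub>L 'a) \<Rightarrow> ('a \<times> 'a) set" where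
  "neg_generator T = {(x, y). ((\<lambda>h. (x - T h x) /\<^sub>R h) \<longlongrightarrow> y) (at_right 0)}"

text \<open>\<open>generated_semigroup B s\<close> is $e^{-sB}$; a $C_0$-semigroup is determined on $[0,\infty)$ by its
  generator, so the choice only concerns negative \<open>s\<close>.\<close>

definition generated_semigroup :: "('a::complex_banach \<times> 'a) set \<Rightarrow> real \<Rightarrow> 'a \<Rightarrow>\<^sub>L 'a" where
  "generated_semigroup B = (SOME T. C0_semigroup T \<and> neg_generator T = B)"

definition scale_op :: "real \<Rightarrow> ('a::complex_banach \<times> 'a) set \<Rightarrow> ('a \<times> 'a) set" where
  "scale_op c A = {(x, c *\<^sub>R y) | x y. (x, y) \<in> A}"

definition sector :: "real \<Rightarrow> complex set" where
  "sector \<theta> = {z. z \<noteq> 0 \<and> \<bar>Arg z\<bar> < \<theta>}"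

text \<open>Analyticity is in operator norm: the Frechet derivative exists and is complex-linear.\<close>

definition analytic_operator_function ::
  "(complex \<Rightarrow> 'a::complex_banach \<Rightarrow>\<^sub>L 'a) \<Rightarrow> complex set \<Rightarrow> bool" where
  "analytic_operator_function S U \<longleftrightarrow>
     (\<forall>z\<in>U. complex_linear (S z)) \<and>
     (\<forall>z\<in>U. \<exists>D. (S has_derivative D) (at z) \<and> (\<forall>h x. D h x = h *\<^sub>C D 1 x))"

definition bounded_analytic_semigroup :: "(real \<Rightarrow> 'a::complex_banach \<Rightarrow>\<^sub>L 'a) \<Rightarrow> bool" where
  "bounded_analytic_semigroup T \<longleftrightarrow>
     C0_semigroup T \<and>
     (\<exists>\<theta> S. 0 < \<theta> \<and> \<theta> \<le> pi / 2 \<and>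
        analytic_operator_function S (sector \<theta>) \<and>
        (\<forall>t>0. S (of_real t) = T t) \<and>
        (\<forall>\<theta>'. 0 < \<theta>' \<and> \<theta>' < \<theta> \<longrightarrow> bounded (S ` sector \<theta>')))"


section \<open>Fractional powers\<close>

definition resolvent_at :: "('a::complex_banach \<times> 'a) set \<Rightarrow> real \<Rightarrow> 'a \<Rightarrow> 'a" where
  "resolvent_at A r y = (THE x. (x, y - r *\<^sub>R x) \<in> A)"

text \<open>\<open>resolvent_at A r\<close> is $(r + A)^{-1}$. For $0 < \alpha < 1$ the power $A^\alpha$ of a densely
  defined sectorial operator is the closure of the Balakrishnan operator
  $x \mapsto \frac{\sin \pi\alpha}{\pi} \int_0^\infty r^{\alpha-1} (r + A)^{-1} A x\,dr$
  on the domain of $A$.\<close>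

definition balakrishnan :: "('a::complex_banach \<times> 'a) set \<Rightarrow> real \<Rightarrow> ('a \<times> 'a) set" where
  "balakrishnan A \<alpha> =
     {(x, (sin (pi * \<alpha>) / pi) *\<^sub>R
           Bochner_integral (restrict_space lborel {0<..})
             (\<lambda>r. (r powr (\<alpha> - 1)) *\<^sub>R resolvent_at A r y)) | x y. (x, y) \<in> A}"

definition frac_power :: "('a::complex_banach \<times> 'a) set \<Rightarrow> real \<Rightarrow> ('a \<times> 'a) set" where
  "frac_power A \<alpha> =
     (if \<alpha> = 0 then Id else if \<alpha> = 1 then A else closure (balakrishnan A \<alpha>))"


section \<open>Bernstein functions and subordination\<close>

definition smooth_on_pos :: "(real \<Rightarrow> real) \<Rightarrow> bool" where
  "smooth_on_pos f \<longleftrightarrow> (\<forall>n. \<forall>x>0. (deriv ^^ n) f differentiable (at x))"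

definition completely_monotone :: "(real \<Rightarrow> real) \<Rightarrow> bool" where
  "completely_monotone f \<longleftrightarrow>
     smooth_on_pos f \<and> (\<forall>n. \<forall>x>0. (-1) ^ n * (deriv ^^ n) f x \<ge> 0)"

definition bernstein_on_pos :: "(real \<Rightarrow> real) \<Rightarrow> bool" where
  "bernstein_on_pos f \<longleftrightarrow>
     smooth_on_pos f \<and> (\<forall>x>0. f x \<ge> 0) \<and> completely_monotone (deriv f)"

text \<open>A Bernstein function is identified with its unique extension to the closed right
  half-plane, analytic in the interior and continuous up to the boundary; its values elsewhere
  are irrelevant.\<close>

definition pos_restriction :: "(complex \<Rightarrow> complex) \<Rightarrow> real \<Rightarrow> real" where
  "pos_restriction \<phi> x = Re (\<phi> (of_real x))"

definition bernstein_function :: "(complex \<Rightarrow> complex) \<Rightarrow> bool" where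
  "bernstein_function \<phi> \<longleftrightarrow>
     (\<forall>x>0. \<phi> (complex_of_real x) \<in> \<real>) \<and>
     bernstein_on_pos (pos_restriction \<phi>) \<and>
     \<phi> holomorphic_on {z. Re z > 0} \<and>
     continuous_on {z. Re z \<ge> 0} \<phi>"

definition Bernstein_Phi :: "(complex \<Rightarrow> complex) set" where
  "Bernstein_Phi =
     {\<phi>. bernstein_function \<phi> \<and> \<phi> 0 = 0 \<and>
        (deriv (pos_restriction \<phi>) \<longlongrightarrow> 1) (at_right 0) \<and>
        (\<exists>L. ((deriv ^^ 2) (pos_restriction \<phi>) \<longlongrightarrow> L) (at_right 0))}"

text \<open>\<open>subordinator \<phi> t\<close> is the measure $\nu_t$ on $[0,\infty)$; a Borel measure of finite
  total mass there is automatically Radon.\<close>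

definition subordinator :: "(complex \<Rightarrow> complex) \<Rightarrow> real \<Rightarrow> real measure" where
  "subordinator \<phi> t =
     (THE \<nu>. sets \<nu> = sets (restrict_space borel {0..}) \<and>
        emeasure \<nu> (space \<nu>) \<le> 1 \<and>
        (\<forall>z. Re z > 0 \<longrightarrow> (\<integral>s. exp (- z * of_real s) \<partial>\<nu>) = exp (- of_real t * \<phi> z)))"

text \<open>\<open>exp_bernstein \<phi> t B\<close> is $e^{-t\varphi(B)}$.\<close>

definition exp_bernstein ::
  "(complex \<Rightarrow> complex) \<Rightarrow> real \<Rightarrow> ('a::complex_banach \<times> 'a) set \<Rightarrow> 'a \<Rightarrow> 'a" where
  "exp_bernstein \<phi> t B x = Bochner_integral (subordinator \<phi> t) (\<lambda>s. generated_semigroup B s x)"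

end

theory Submission
  imports Defs "HOL-Probability.Probability" "HOL-Complex_Analysis.Complex_Analysis"
begin

text \<open>The measure $\nu_\tau$ has mean $\tau \varphi'(0+) = \tau$ and variance
  $-\tau \varphi''(0+)$. Hence $e^{-\tau \varphi(cA)} x - e^{-c \tau A} x$ is the integral over
  \<open>s\<close> of the second-order Taylor remainder of $s \mapsto e^{-c s A} x$ at $\tau$. With
  $t = c \tau$, this remainder is at most $C t^{\alpha - 2} (c s - t)^2 \|A^\alpha x\|$, by the
  bounds $\|A e^{-tA} x\| \le C t^{\alpha - 1} \|A^\alpha x\|$ and
  $\|x - e^{-tA} x\| \le C t^\alpha \|A^\alpha x\|$ with \<open>C\<close> independent of $\alpha$. These
  follow by inverting Balakrishnan's formula with the Beta integral. Vector-valued identities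
  and estimates are reduced to scalar ones through norming functionals.\<close>

section \<open>Norming functionals\<close>

text \<open>The obstacle is a constant that stays bounded as \<alpha> approaches 0 or 1. Inverting
  Balakrishnan's formula divides by Gamma \<alpha>; the reciprocal Gamma function is bounded on
  \<open>{0..2}\<close> and absorbs the factor 1 / \<alpha> that comes from integrating u^(\<alpha>
  - 1) near zero, while an integration by parts avoids 1 / (1 - \<alpha>) at infinity. One inversion
  serves both bounds: it is done for an operator B commuting with the semigroup, and B = exp(-tA) or
  B = the integral of exp(-qA) over [0, t] sends Ax to A exp(-tA) x or to x - exp(-tA) x. The second
  bound is needed because A^2 exp(-rA) x is singular at r = 0, where Taylor's formula is useless.
  The variance is linear in \<tau>, so for t = c \<tau> the bound is a multiple of t^(\<alpha> - 2)
  c^2 \<tau> = t^\<alpha> / \<tau>; both claims are cases of this. Subordinators and generated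
  semigroups are given by description and choice operators, so Bernstein's theorem, Levy's
  uniqueness theorem and the uniqueness of semigroups come in before either can be computed
  with.\<close>

definition sublinear :: "('a::real_vector \<Rightarrow> real) \<Rightarrow> bool" where
  "sublinear q \<longleftrightarrow> (\<forall>x y. q (x + y) \<le> q x + q y) \<and> (\<forall>c\<ge>0. \<forall>x. q (c *\<^sub>R x) = c * q x)"

lemma sublinear_add: "sublinear q \<Longrightarrow> q (x + y) \<le> q x + q y"
  and sublinear_scale: "sublinear q \<Longrightarrow> 0 \<le> c \<Longrightarrow> q (c *\<^sub>R x) = c * q x"
  by (auto simp: sublinear_def)

lemma sublinear_zero: "sublinear q \<Longrightarrow> q 0 = 0"
  using sublinear_scale[of q 0 0] by simp

lemma sublinear_minus: "sublinear q \<Longrightarrow> - q (- x) \<le> q x"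
  using sublinear_add[of q x "- x"] sublinear_zero[of q] by simp

text \<open>The Hahn-Banach step in one direction. The infimum of
  \<open>q (x + t *\<^sub>R y) - t * q y\<close> over \<open>t\<close> in \<open>{0..}\<close> is
  the largest sublinear minorant of \<open>q\<close> whose value at \<open>- y\<close> is at most
  \<open>- q y\<close>; it is finite because \<open>- q (- x)\<close> is a lower bound.\<close>

lemma sublinear_lower:
  assumes "sublinear q"
  obtains q' where "sublinear q'" "\<And>x. q' x \<le> q x" "q' (- y) \<le> - q y"
proof -
  define q' where "q' x = (INF t\<in>{0..}. q (x + t *\<^sub>R y) - t * q y)" for x
  have low: "- q (- x) \<le> q (x + t *\<^sub>R y) - t * q y" if "0 \<le> t" for x t
  proof -
    have "t * q y = q ((x + t *\<^sub>R y) + - x)"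
      using sublinear_scale[OF assms that, of y] by simp
    also have "\<dots> \<le> q (x + t *\<^sub>R y) + q (- x)"
      by (rule sublinear_add[OF assms])
    finally show ?thesis by simp
  qed
  have bdd: "bdd_below ((\<lambda>t. q (x + t *\<^sub>R y) - t * q y) ` {0..})" for x
    using low by (intro bdd_belowI2[of _ "- q (- x)"]) auto
  have le: "q' x \<le> q (x + t *\<^sub>R y) - t * q y" if "0 \<le> t" for x t
    unfolding q'_def using bdd that by (intro cINF_lower) auto
  have ge: "c \<le> q' x" if "\<And>t. 0 \<le> t \<Longrightarrow> c \<le> q (x + t *\<^sub>R y) - t * q y" for c x
    unfolding q'_def using that by (intro cINF_greatest) auto
  have add: "q' (x + z) \<le> q' x + q' z" for x z
  proof -
    \<comment> \<open>The parameters of the two arguments combine into \<open>t + s\<close>. The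
      infima are then taken one after the other, first in \<open>t\<close> for fixed
      \<open>s\<close>.\<close>
    have "q' (x + z) - (q (z + s *\<^sub>R y) - s * q y) \<le> q (x + t *\<^sub>R y) - t * q y"
      if "0 \<le> t" "0 \<le> s" for s t
      using le[of "t + s" "x + z"] sublinear_add[OF assms, of "x + t *\<^sub>R y" "z + s *\<^sub>R y"] that
      by (simp add: algebra_simps)
    then have "q' (x + z) - (q (z + s *\<^sub>R y) - s * q y) \<le> q' x" if "0 \<le> s" for s
      using that by (intro ge)
    then have "q' (x + z) - q' x \<le> q' z"
      by (intro ge) (auto simp: algebra_simps)
    then show ?thesis by simp
  qed
  have scale1: "q' (c *\<^sub>R x) \<le> c * q' x" if "0 < c" for c x
  proof -
    have "q' (c *\<^sub>R x) / c \<le> q' x"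
    proof (rule ge)
      fix t :: real assume "0 \<le> t"
      have "c * q (x + t *\<^sub>R y) = q (c *\<^sub>R x + (c * t) *\<^sub>R y)"
        using sublinear_scale[OF assms, of c "x + t *\<^sub>R y"] that by (simp add: scaleR_add_right)
      then show "q' (c *\<^sub>R x) / c \<le> q (x + t *\<^sub>R y) - t * q y"
        using le[of "c * t" "c *\<^sub>R x"] that \<open>0 \<le> t\<close> by (simp add: field_simps)
    qed
    then show ?thesis using that by (simp add: field_simps)
  qed
  have zero: "q' 0 = 0"
    using le[of 0 0] ge[of 0 0] sublinear_zero[OF assms] sublinear_scale[OF assms, of _ y]
    by fastforce
  have scale: "q' (c *\<^sub>R x) = c * q' x" if "0 \<le> c" for c x
  proof (cases "c = 0")
    case False
    then have "c > 0" using that by simp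
    have "q' x \<le> (1 / c) * q' (c *\<^sub>R x)"
      using scale1[of "1 / c" "c *\<^sub>R x"] \<open>c > 0\<close> by simp
    then show ?thesis using scale1[OF \<open>c > 0\<close>, of x] \<open>c > 0\<close> by (simp add: field_simps)
  qed (use zero in simp)
  show ?thesis
  proof
    show "sublinear q'" using add scale by (simp add: sublinear_def)
    show "q' x \<le> q x" for x using le[of 0 x] by simp
    show "q' (- y) \<le> - q y" using le[of 1 "- y"] sublinear_zero[OF assms] by simp
  qed
qed

text \<open>Zorn's lemma with the order reversed. Every sublinear minorant of \<open>p\<close> lies
  above \<open>- p (- x)\<close>, so the pointwise infimum of a chain is finite and serves as its
  bound.\<close>

lemma sublinear_minimal:
  fixes p :: "'a::real_vector \<Rightarrow> real"
  assumes p: "sublinear p"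
  obtains q where "sublinear q" "q \<le> p" "\<And>q'. sublinear q' \<Longrightarrow> q' \<le> q \<Longrightarrow> q' = q"
proof -
  define S where "S = {q. sublinear q \<and> q \<le> p}"
  have po: "partial_order_on S (relation_of (\<lambda>a b. b \<le> a) S)"
    by (rule partial_order_on_relation_ofI) auto
  have "\<exists>u\<in>S. \<forall>a\<in>C. u \<le> a" if C: "C \<in> Chains (relation_of (\<lambda>a b. b \<le> a) S)" for C
  proof (cases "C = {}")
    case True
    then show ?thesis using p by (auto simp: S_def)
  next
    case False
    have CS: "C \<subseteq> S" using Chains_relation_of[OF C] .
    have tot: "a \<le> b \<or> b \<le> a" if "a \<in> C" "b \<in> C" for a b
      using C that by (auto simp: Chains_def relation_of_def)
    have low: "- p (- x) \<le> a x" if "a \<in> C" for a x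
    proof -
      have "sublinear a" "a \<le> p" using CS that by (auto simp: S_def)
      then have "- p (- x) \<le> - a (- x)" by (simp add: le_fun_def)
      also have "\<dots> \<le> a x" by (rule sublinear_minus) fact
      finally show ?thesis .
    qed
    define u where "u x = (INF a\<in>C. a x)" for x
    have bdd: "bdd_below ((\<lambda>a. a x) ` C)" for x
      using low by (intro bdd_belowI2[of _ "- p (- x)"]) auto
    have le: "u x \<le> a x" if "a \<in> C" for a x
      unfolding u_def using bdd that by (intro cINF_lower)
    have ge: "c \<le> u x" if "\<And>a. a \<in> C \<Longrightarrow> c \<le> a x" for c x
      unfolding u_def using that False by (intro cINF_greatest)
    have add: "u (x + z) \<le> u x + u z" for x z
    proof -
      \<comment> \<open>An infimum of sublinear functions need not be subadditive. In a chain, the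
        smaller of \<open>a\<close> and \<open>b\<close> can be used for both arguments.\<close>
      have *: "u (x + z) \<le> a x + b z" if ab: "a \<in> C" "b \<in> C" for a b
      proof -
        obtain d where d: "d \<in> C" "d \<le> a" "d \<le> b" using tot[OF ab] ab by auto
        have "u (x + z) \<le> d (x + z)" using d by (intro le)
        also have "\<dots> \<le> d x + d z"
          using CS d(1) by (intro sublinear_add) (auto simp: S_def)
        also have "\<dots> \<le> a x + b z" using d by (intro add_mono) (auto simp: le_fun_def)
        finally show ?thesis .
      qed
      have "u (x + z) - b z \<le> u x" if "b \<in> C" for b
        using * that by (intro ge) (auto simp: algebra_simps)
      then have "u (x + z) - u x \<le> u z" by (intro ge) (auto simp: algebra_simps)
      then show ?thesis by simp
    qed
    have scale: "u (c *\<^sub>R x) = c * u x" if "0 \<le> c" for c x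
    proof (rule antisym)
      have eq: "a (c *\<^sub>R x) = c * a x" if "a \<in> C" for a x
        using CS that \<open>0 \<le> c\<close> by (intro sublinear_scale) (auto simp: S_def)
      show "c * u x \<le> u (c *\<^sub>R x)"
        using le \<open>0 \<le> c\<close> by (intro ge) (auto simp: eq mult_left_mono)
      show "u (c *\<^sub>R x) \<le> c * u x"
      proof (cases "c = 0")
        case True
        obtain a where a: "a \<in> C" using False by auto
        show ?thesis using le[OF a, of 0] eq[OF a] True by simp
      next
        case False
        then have "u (c *\<^sub>R x) / c \<le> u x"
          using le[of _ "c *\<^sub>R x"] \<open>0 \<le> c\<close> eq by (intro ge) (simp add: field_simps)
        then show ?thesis using False \<open>0 \<le> c\<close> by (simp add: field_simps)
      qed
    qed
    obtain a where a: "a \<in> C" using False by auto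
    have "u \<le> a" using le[OF a] by (simp add: le_fun_def)
    also have "a \<le> p" using CS a by (auto simp: S_def)
    finally have "u \<in> S" using add scale by (auto simp: S_def sublinear_def)
    then show ?thesis using le by (auto simp: le_fun_def)
  qed
  from predicate_Zorn[OF po this] obtain q where q: "q \<in> S" "\<forall>a\<in>S. a \<le> q \<longrightarrow> a = q"
    by auto
  show ?thesis
  proof (rule that[of q])
    show "q' = q" if "sublinear q'" "q' \<le> q" for q'
      using q that by (auto simp: S_def)
  qed (use q in \<open>auto simp: S_def\<close>)
qed

text \<open>A minimal sublinear functional is linear, since \<open>sublinear_lower\<close> cannot lower it.\<close>

theorem norming_functional:
  fixes x :: "'a::real_normed_vector"
  obtains l :: "'a \<Rightarrow> real" where "bounded_linear l" "l x = norm x" "\<And>y. \<bar>l y\<bar> \<le> norm y"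
proof -
  have "sublinear (norm :: 'a \<Rightarrow> real)"
    by (auto simp: sublinear_def norm_triangle_ineq)
  \<comment> \<open>Lowering the norm in the direction \<open>x\<close> first forces every later
    minorant to be at most \<open>- norm x\<close> at \<open>- x\<close>. This is what makes the
    minimal functional norming.\<close>
  then obtain p where p: "sublinear p" "\<And>y. p y \<le> norm y" "p (- x) \<le> - norm x"
    by (rule sublinear_lower[where y = x]) blast
  obtain q where q: "sublinear q" "q \<le> p" and min: "\<And>q'. sublinear q' \<Longrightarrow> q' \<le> q \<Longrightarrow> q' = q"
    using sublinear_minimal[OF p(1)] by blast
  have neg: "q (- y) = - q y" for y
  proof -
    obtain q' where q': "sublinear q'" "\<And>x. q' x \<le> q x" "q' (- y) \<le> - q y"
      using sublinear_lower[OF q(1), of y] by blast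
    then have "q' = q" by (intro min) (auto simp: le_fun_def)
    then have "q (- y) \<le> - q y" using q' by simp
    then show ?thesis using sublinear_minus[OF q(1), of y] by simp
  qed
  have add: "q (y + z) = q y + q z" for y z
    using sublinear_add[OF q(1), of y z] sublinear_add[OF q(1), of "- y" "- z"]
      neg[of "y + z"] neg[of y] neg[of z] by (simp add: add.commute)
  have scale: "q (c *\<^sub>R y) = c * q y" for c y
  proof (cases "0 \<le> c")
    case False
    then have "q ((- c) *\<^sub>R y) = - c * q y" by (intro sublinear_scale[OF q(1)]) simp
    then show ?thesis using neg[of "c *\<^sub>R y"] by simp
  qed (use sublinear_scale[OF q(1)] in simp)
  have le: "q y \<le> norm y" for y using q(2) p(2)[of y] by (meson le_funD order_trans)
  have abs: "\<bar>q y\<bar> \<le> norm y" for y using le[of y] le[of "- y"] neg[of y] by simp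
  show ?thesis
  proof (rule that[of q])
    show "bounded_linear q"
      using add scale abs by (intro bounded_linear_intro[of q 1]) auto
    have "q (- x) \<le> - norm x" using q(2) p(3) by (meson le_funD order_trans)
    then show "q x = norm x" using neg[of x] le[of x] by simp
  qed (rule abs)
qed

lemma norm_le_functional:
  fixes x :: "'a::real_normed_vector"
  assumes "\<And>l. bounded_linear l \<Longrightarrow> (\<And>y. \<bar>l y\<bar> \<le> norm y) \<Longrightarrow> l x \<le> c"
  shows "norm x \<le> c"
  using norming_functional[of x] assms by metis

lemma eq_functional:
  fixes x y :: "'a::real_normed_vector"
  assumes "\<And>l :: 'a \<Rightarrow> real. bounded_linear l \<Longrightarrow> l x = l y"
  shows "x = y"
proof -
  have "norm (x - y) \<le> 0"
    by (rule norm_le_functional) (simp add: assms linear_diff bounded_linear.linear)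
  then show ?thesis by simp
qed


section \<open>The Bochner integral in a nonseparable space\<close>

text \<open>In a nonseparable space the difference of two Borel functions can fail to be Borel. Here
  \<open>s\<close> takes only finitely many values, and for each constant \<open>c\<close> the
  function \<open>norm (f x - c)\<close> is a continuous function of \<open>f x\<close>.\<close>

lemma borel_measurable_norm_diff_simple:
  fixes f :: "'b \<Rightarrow> 'a::real_normed_vector"
  assumes f[measurable]: "f \<in> borel_measurable M" and s: "simple_function M s"
  shows "(\<lambda>x. norm (f x - s x)) \<in> borel_measurable M"
proof -
  have "(\<lambda>x. norm (f x - c)) \<in> borel_measurable M" for c
  proof -
    have "(\<lambda>y. norm (y - c)) \<in> borel_measurable borel"
      by (intro borel_measurable_continuous_onI continuous_intros)
    from measurable_compose[OF f this] show ?thesis .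
  qed
  moreover have "s \<in> measurable M (count_space (s ` space M))"
    using s by (auto intro!: measurable_count_space_eq2[THEN iffD2] simp: simple_function_def)
  moreover have "countable (s ` space M)"
    using s by (simp add: simple_function_def countable_finite)
  ultimately show ?thesis
    by (rule measurable_compose_countable')
qed

lemma nn_integral_norm_diff_simple_functions:
  fixes f :: "'b \<Rightarrow> 'a::real_normed_vector"
  assumes f: "f \<in> borel_measurable M"
    and s: "Bochner_Integration.simple_bochner_integrable M s" and t: "Bochner_Integration.simple_bochner_integrable M t"
  shows "ennreal (norm (Bochner_Integration.simple_bochner_integral M s - Bochner_Integration.simple_bochner_integral M t)) \<le>
    (\<integral>\<^sup>+ x. norm (f x - s x) \<partial>M) + (\<integral>\<^sup>+ x. norm (f x - t x) \<partial>M)"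
    (is "ennreal (norm (?s - ?t)) \<le> ?S + ?T")
proof -
  have [measurable]: "(\<lambda>x. norm (f x - s x)) \<in> borel_measurable M"
    "(\<lambda>x. norm (f x - t x)) \<in> borel_measurable M"
    using s t f by (auto intro!: borel_measurable_norm_diff_simple elim: simple_bochner_integrable.cases)
  have "ennreal (norm (?s - ?t)) = norm (Bochner_Integration.simple_bochner_integral M (\<lambda>x. s x - t x))"
    using s t by (subst simple_bochner_integral_diff) auto
  also have "\<dots> \<le> Bochner_Integration.simple_bochner_integral M (\<lambda>x. norm (s x - t x))"
    using simple_bochner_integrable_compose2[of "(-)" M "s" "t"] s t
    by (auto intro!: simple_bochner_integral_norm_bound)
  also have "\<dots> = (\<integral>\<^sup>+x. norm (s x - t x) \<partial>M)"
    using simple_bochner_integrable_compose2[of "\<lambda>x y. norm (x - y)" M "s" "t"] s t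
    by (auto intro!: simple_bochner_integral_eq_nn_integral)
  also have "\<dots> \<le> (\<integral>\<^sup>+x. ennreal (norm (f x - s x)) + ennreal (norm (f x - t x)) \<partial>M)"
  proof (intro nn_integral_mono)
    fix x
    have "norm (s x - t x) \<le> norm (f x - s x) + norm (f x - t x)"
      by (metis dual_order.refl norm_diff_triangle_le norm_minus_commute)
    then show "ennreal (norm (s x - t x)) \<le> ennreal (norm (f x - s x)) + ennreal (norm (f x - t x))"
      by (simp flip: ennreal_plus add: ennreal_leI)
  qed
  also have "\<dots> = ?S + ?T"
    by (rule nn_integral_add) auto
  finally show ?thesis .
qed

text \<open>Composing the simple approximants with \<open>l\<close> multiplies their error by at
  most \<open>K\<close>. This is the bridge from the nonseparable integral to ordinary real
  integrals, over which all later computations run.\<close>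

lemma has_Bochner_integral_functional:
  fixes f :: "'b \<Rightarrow> 'a::real_normed_vector" and l :: "'a \<Rightarrow> real"
  assumes "has_Bochner_integral M f y" "bounded_linear l"
  shows "has_bochner_integral M (\<lambda>x. l (f x)) (l y)"
proof -
  interpret l: bounded_linear l by fact
  obtain s where f[measurable]: "f \<in> borel_measurable M"
    and s: "\<And>i. Bochner_Integration.simple_bochner_integrable M (s i)"
    and lim: "(\<lambda>i::nat. \<integral>\<^sup>+x. norm (f x - s i x) \<partial>M) \<longlonglongrightarrow> 0"
    and int: "(\<lambda>i. Bochner_Integration.simple_bochner_integral M (s i)) \<longlonglongrightarrow> y"
    using assms(1) by (auto simp: has_Bochner_integral_def)
  have [measurable]: "l \<in> borel_measurable borel"
    by (intro borel_measurable_continuous_onI l.continuous_on continuous_on_id)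
  have m[measurable]: "(\<lambda>x. norm (f x - s i x)) \<in> borel_measurable M" for i
    using s f by (auto intro!: borel_measurable_norm_diff_simple elim: simple_bochner_integrable.cases)
  obtain K where K: "K > 0" "\<And>x i. norm (l (f x) - l (s i x)) \<le> norm (f x - s i x) * K"
    using l.pos_bounded by (auto simp: l.diff[symmetric])
  show ?thesis
  proof (rule has_bochner_integral.intros[where s = "\<lambda>i x. l (s i x)"])
    show "(\<lambda>x. l (f x)) \<in> borel_measurable M" by measurable
    show "Bochner_Integration.simple_bochner_integrable M (\<lambda>x. l (s i x))" for i
      using s[of i] by (auto intro: simple_bochner_integrable_compose2 l.zero)
    show "(\<lambda>i. Bochner_Integration.simple_bochner_integral M (\<lambda>x. l (s i x))) \<longlonglongrightarrow> l y"
      using int s by (auto intro!: l.tendsto simp: simple_bochner_integral_linear l.linear_axioms)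
    show "(\<lambda>i. \<integral>\<^sup>+ x. norm (l (f x) - l (s i x)) \<partial>M) \<longlonglongrightarrow> 0"
    proof (rule tendsto_sandwich[where f = "\<lambda>_. 0"])
      show "eventually (\<lambda>i. (\<integral>\<^sup>+ x. norm (l (f x) - l (s i x)) \<partial>M) \<le>
          K * (\<integral>\<^sup>+ x. norm (f x - s i x) \<partial>M)) sequentially"
      proof (intro always_eventually allI)
        fix i
        have "(\<integral>\<^sup>+ x. norm (l (f x) - l (s i x)) \<partial>M) \<le> (\<integral>\<^sup>+ x. ennreal K * norm (f x - s i x) \<partial>M)"
          using K by (intro nn_integral_mono) (auto simp: ac_simps ennreal_mult[symmetric])
        also have "\<dots> = K * (\<integral>\<^sup>+ x. norm (f x - s i x) \<partial>M)"
          using K by (intro nn_integral_cmult) auto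
        finally show "(\<integral>\<^sup>+ x. norm (l (f x) - l (s i x)) \<partial>M) \<le>
          K * (\<integral>\<^sup>+ x. norm (f x - s i x) \<partial>M)" .
      qed
      show "(\<lambda>i. K * (\<integral>\<^sup>+ x. norm (f x - s i x) \<partial>M)) \<longlonglongrightarrow> 0"
        using ennreal_tendsto_cmult[OF _ lim] by simp
    qed auto
  qed
qed

text \<open>The description is unambiguous: every functional of a value is an ordinary real
  integral, and functionals separate points.\<close>

lemma Bochner_integral_eq:
  fixes f :: "'b \<Rightarrow> 'a::real_normed_vector"
  assumes "has_Bochner_integral M f y"
  shows "Bochner_integral M f = y"
  unfolding Bochner_integral_def
proof (rule the_equality)
  fix z assume z: "has_Bochner_integral M f z"
  show "z = y"
  proof (rule eq_functional)
    fix l :: "'a \<Rightarrow> real" assume "bounded_linear l"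
    then show "l z = l y"
      using has_bochner_integral_eq has_Bochner_integral_functional assms z by metis
  qed
qed fact

lemma has_Bochner_integral_cong:
  assumes "\<And>x. x \<in> space M \<Longrightarrow> f x = g x"
  shows "has_Bochner_integral M f y \<longleftrightarrow> has_Bochner_integral M g y"
  unfolding has_Bochner_integral_def
  using assms by (simp cong: measurable_cong_simp nn_integral_cong_simp)

text \<open>Approximants with error \<open>1 / Suc i\<close> have integrals that form a Cauchy
  sequence, and completeness supplies the value.\<close>

lemma has_Bochner_integral_approx:
  fixes f :: "'b \<Rightarrow> 'a::banach"
  assumes f: "f \<in> borel_measurable M"
    and approx: "\<And>e. e > 0 \<Longrightarrow> \<exists>s. Bochner_Integration.simple_bochner_integrable M s \<and> (\<integral>\<^sup>+x. norm (f x - s x) \<partial>M) \<le> ennreal e"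
  shows "\<exists>y. has_Bochner_integral M f y"
proof -
  have "\<exists>s. Bochner_Integration.simple_bochner_integrable M s \<and> (\<integral>\<^sup>+x. norm (f x - s x) \<partial>M) \<le> ennreal (1 / Suc i)" for i
    by (rule approx) simp
  then obtain s where s: "\<And>i. Bochner_Integration.simple_bochner_integrable M (s i)"
    and le: "\<And>i. (\<integral>\<^sup>+x. norm (f x - s i x) \<partial>M) \<le> ennreal (1 / Suc i)"
    by metis
  have lim: "(\<lambda>i. \<integral>\<^sup>+x. norm (f x - s i x) \<partial>M) \<longlonglongrightarrow> 0"
  proof (rule tendsto_sandwich[where f = "\<lambda>_. 0"])
    show "(\<lambda>i. ennreal (1 / Suc i)) \<longlonglongrightarrow> 0"
      using tendsto_ennrealI[OF LIMSEQ_Suc[OF lim_1_over_n]] by simp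
    show "eventually (\<lambda>i. (\<integral>\<^sup>+x. norm (f x - s i x) \<partial>M) \<le> ennreal (1 / Suc i)) sequentially"
      using le by (intro always_eventually allI)
  qed auto
  define I where "I i = Bochner_Integration.simple_bochner_integral M (s i)" for i
  have dist: "dist (I i) (I j) \<le> 1 / Suc i + 1 / Suc j" for i j
  proof -
    have "ennreal (dist (I i) (I j)) \<le> (\<integral>\<^sup>+x. norm (f x - s i x) \<partial>M) + (\<integral>\<^sup>+x. norm (f x - s j x) \<partial>M)"
      unfolding dist_norm I_def by (rule nn_integral_norm_diff_simple_functions[OF f s s])
    also have "\<dots> \<le> ennreal (1 / Suc i) + ennreal (1 / Suc j)"
      by (intro add_mono le)
    also have "\<dots> = ennreal (1 / Suc i + 1 / Suc j)"
      by (rule ennreal_plus[symmetric]) auto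
    finally show ?thesis by (subst (asm) ennreal_le_iff) auto
  qed
  have "Cauchy I"
  proof (rule metric_CauchyI)
    fix e :: real assume "e > 0"
    then obtain N where N: "1 / Suc N < e / 2"
      using nat_approx_posE[of "e / 2"] by auto
    have m: "1 / Suc m < e / 2" if "m \<ge> N" for m
    proof -
      have "1 / Suc m \<le> 1 / Suc N" using that by (intro divide_left_mono) auto
      then show ?thesis using N by simp
    qed
    have "dist (I m) (I n) < e" if "m \<ge> N" "n \<ge> N" for m n
      using dist[of m n] m[OF that(1)] m[OF that(2)] by linarith
    then show "\<exists>N. \<forall>m\<ge>N. \<forall>n\<ge>N. dist (I m) (I n) < e"
      by blast
  qed
  then obtain y where "I \<longlonglongrightarrow> y"
    by (auto simp: Cauchy_convergent_iff convergent_def)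
  then have "(\<lambda>i. Bochner_Integration.simple_bochner_integral M (s i)) \<longlonglongrightarrow> y"
    by (simp add: I_def[abs_def])
  then show ?thesis using f s lim by (auto simp: has_Bochner_integral_def)
qed

text \<open>Uniform continuity on a compact interval takes the place of separability: it yields
  approximants with finitely many values.\<close>

lemma step_function_approx:
  fixes f :: "real \<Rightarrow> 'a::real_normed_vector"
  assumes cont: "continuous_on {a..b} f" and "e > 0"
    and sets: "sets M = sets (restrict_space borel S)"
    and fin: "emeasure M {a..b} < \<infinity>" and ab: "{a..b} \<in> sets M"
  obtains s where "Bochner_Integration.simple_bochner_integrable M s"
    "\<And>x. x \<in> {a..b} \<Longrightarrow> norm (f x - s x) \<le> e" "\<And>x. x \<notin> {a..b} \<Longrightarrow> s x = 0"
proof -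
  have "uniformly_continuous_on {a..b} f"
    using cont compact_uniformly_continuous by blast
  then obtain d where d: "d > 0"
    "\<And>x x'. x \<in> {a..b} \<Longrightarrow> x' \<in> {a..b} \<Longrightarrow> dist x' x < d \<Longrightarrow> dist (f x') (f x) < e"
    using \<open>e > 0\<close> unfolding uniformly_continuous_on_def by metis
  \<comment> \<open>\<open>g\<close> numbers the cell of length \<open>d\<close> that contains
    \<open>x\<close>, with -1 marking the outside, and \<open>v\<close> reads \<open>f\<close> at
    the left end of the cell. Measurability then only has to be checked for the integer-valued
    \<open>g\<close>.\<close>
  define g :: "real \<Rightarrow> int" where "g x = (if x \<in> {a..b} then \<lfloor>(x - a) / d\<rfloor> else - 1)" for x
  define v where "v k = (if k = - 1 then 0 else f (a + d * real_of_int k))" for k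
  have sp: "space M = S" using sets_eq_imp_space_eq[OF sets] by (simp add: space_restrict_space)
  have g_ge: "g x \<ge> 0" if "x \<in> {a..b}" for x
    using that d by (auto simp: g_def)
  have g_le: "g x \<le> \<lfloor>(b - a) / d\<rfloor>" if "x \<in> {a..b}" for x
    using that d by (auto simp: g_def intro!: floor_mono divide_right_mono)
  have "range g \<subseteq> {- 1} \<union> {0..\<lfloor>(b - a) / d\<rfloor>}"
    using g_ge g_le by (auto simp: g_def)
  then have "finite (g ` space M)" by (meson finite_subset finite_Un finite_atLeastAtMost_int
        finite.emptyI finite.insertI image_mono subset_UNIV order_trans)
  moreover have "g -` {k} \<inter> space M \<in> sets M" for k
  proof -
    have [measurable]: "g \<in> measurable borel (count_space UNIV)" unfolding g_def by measurable
    have "g -` {k} \<inter> S \<in> sets (restrict_space borel S)"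
      using measurable_sets[of g borel "count_space UNIV" "{k}"]
      by (auto simp: sets_restrict_space)
    then show ?thesis by (simp add: sets sp)
  qed
  ultimately have sg: "simple_function M g" by (simp add: simple_function_def)
  show ?thesis
  proof (rule that[of "\<lambda>x. v (g x)"])
    show out: "v (g x) = 0" if "x \<notin> {a..b}" for x using that unfolding g_def v_def if_not_P[OF that] by simp
    show "Bochner_Integration.simple_bochner_integrable M (\<lambda>x. v (g x))"
    proof
      show "simple_function M (\<lambda>x. v (g x))" using sg by (rule simple_function_compose1)
      have sub: "{y \<in> space M. v (g y) \<noteq> 0} \<subseteq> {a..b}"
      proof
        fix y assume "y \<in> {y \<in> space M. v (g y) \<noteq> 0}"
        then show "y \<in> {a..b}" using out[of y] by blast
      qed
      have "emeasure M {y \<in> space M. v (g y) \<noteq> 0} \<le> emeasure M {a..b}"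
        using ab sub by (intro emeasure_mono)
      then show "emeasure M {y \<in> space M. v (g y) \<noteq> 0} \<noteq> \<infinity>" using fin by auto
    qed
    show "norm (f x - v (g x)) \<le> e" if x: "x \<in> {a..b}" for x
    proof -
      have 1: "g x = \<lfloor>(x - a) / d\<rfloor>" using x by (simp add: g_def)
      have "real_of_int (g x) \<le> (x - a) / d" "(x - a) / d < real_of_int (g x) + 1"
        unfolding 1 by linarith+
      then have 2: "d * g x \<le> x - a" "x - a < d * g x + d"
        using d(1) by (auto simp: field_simps)
      have 3: "0 \<le> d * g x" using g_ge[OF x] d(1) by simp
      have "a + d * g x \<in> {a..b}" using 2 3 x by auto
      moreover have "dist (a + d * g x) x < d" using 2 by (simp add: dist_real_def)
      ultimately have "dist (f (a + d * g x)) (f x) < e" using d(2) x by blast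
      then show ?thesis using g_ge[OF x] by (auto simp: v_def dist_norm norm_minus_commute)
    qed
  qed
qed

text \<open>The tail outside \<open>{a n..b n}\<close> is small by dominated convergence, and inside
  it \<open>f\<close> is uniformly close to a step function. Writing \<open>S\<close> as an
  increasing union of intervals lets the lemma serve both \<open>{0..}\<close> and
  \<open>{0<..}\<close>.\<close>

lemma has_Bochner_integral_exists:
  fixes f :: "real \<Rightarrow> 'a::banach" and a b :: "nat \<Rightarrow> real"
  assumes sets: "sets M = sets (restrict_space borel S)"
    and S: "S = (\<Union>n. {a n..b n})" and inc: "incseq (\<lambda>n. {a n..b n})"
    and fin: "\<And>n. emeasure M {a n..b n} < \<infinity>"
    and cont: "continuous_on S f" and int: "(\<integral>\<^sup>+x. norm (f x) \<partial>M) < \<infinity>"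
  shows "\<exists>y. has_Bochner_integral M f y"
proof (rule has_Bochner_integral_approx)
  have sp: "space M = S" using sets_eq_imp_space_eq[OF sets] by (simp add: space_restrict_space)
  have "f \<in> borel_measurable (restrict_space borel S)"
    by (rule borel_measurable_continuous_on_restrict[OF cont])
  then show f[measurable]: "f \<in> borel_measurable M" using measurable_cong_sets[OF sets refl] by blast
  have S': "{a n..b n} \<subseteq> S" for n unfolding S by blast
  have ab[measurable]: "{a n..b n} \<in> sets M" for n
    unfolding sets sets_restrict_space using S'[of n] by (auto intro!: image_eqI[of _ _ "{a n..b n}"])
  fix e :: real assume "e > 0"
  define w where "w n x = norm (f x) * indicator (- {a n..b n}) x" for n x
  have wm[measurable]: "(\<lambda>x. ennreal (w n x)) \<in> borel_measurable M" for n
  proof -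
    have "(\<lambda>x. ennreal (norm (f x) * indicator (space M - {a n..b n}) x)) \<in> borel_measurable M"
      by measurable
    then show ?thesis by (rule measurable_cong[THEN iffD1, rotated]) (auto simp: w_def indicator_def)
  qed
  have "(\<lambda>n. \<integral>\<^sup>+x. w n x \<partial>M) \<longlonglongrightarrow> (\<integral>\<^sup>+x. 0 \<partial>M)"
  proof (rule nn_integral_dominated_convergence[where w = "\<lambda>x. norm (f x)"])
    show "AE x in M. (\<lambda>n. ennreal (w n x)) \<longlonglongrightarrow> 0"
    proof (rule AE_I2)
      fix x assume "x \<in> space M"
      then obtain N where "x \<in> {a N..b N}" using sp S by auto
      then have "x \<in> {a n..b n}" if "n \<ge> N" for n using incseqD[OF inc that] by blast
      then have "w n x = 0" if "n \<ge> N" for n using that by (simp add: w_def)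
      then have "eventually (\<lambda>n. ennreal (w n x) = 0) sequentially"
        unfolding eventually_sequentially by (auto intro!: exI[of _ N])
      then show "(\<lambda>n. ennreal (w n x)) \<longlonglongrightarrow> 0" by (rule tendsto_eventually)
    qed
    show "AE x in M. ennreal (w j x) \<le> ennreal (norm (f x))" for j
      by (intro AE_I2 ennreal_leI) (simp add: w_def indicator_def)
  qed (use int in auto)
  then have "eventually (\<lambda>n. (\<integral>\<^sup>+x. w n x \<partial>M) < ennreal (e / 2)) sequentially"
    using \<open>e > 0\<close> by (intro order_tendstoD) auto
  then obtain n where n: "(\<integral>\<^sup>+x. w n x \<partial>M) < ennreal (e / 2)"
    by (auto simp: eventually_sequentially)
  define m where "m = measure M {a n..b n}"
  have m: "emeasure M {a n..b n} = ennreal m" "m \<ge> 0"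
    using fin[of n] by (auto simp: m_def emeasure_eq_ennreal_measure)
  \<comment> \<open>The denominator contains \<open>m + 1\<close> because the interval may have
    measure zero.\<close>
  have pos: "0 < e / (2 * (m + 1))" using \<open>e > 0\<close> m(2) by simp
  obtain s where s: "Bochner_Integration.simple_bochner_integrable M s"
    and s_in: "\<And>x. x \<in> {a n..b n} \<Longrightarrow> norm (f x - s x) \<le> e / (2 * (m + 1))"
    and s_out: "\<And>x. x \<notin> {a n..b n} \<Longrightarrow> s x = 0"
    by (rule step_function_approx[OF continuous_on_subset[OF cont S'[of n]] pos sets fin[of n] ab[of n]])
      blast
  have "(\<integral>\<^sup>+x. norm (f x - s x) \<partial>M)
      \<le> (\<integral>\<^sup>+x. ennreal (w n x) + ennreal (e / (2 * (m + 1))) * indicator {a n..b n} x \<partial>M)"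
  proof (rule nn_integral_mono)
    fix x
    show "ennreal (norm (f x - s x)) \<le> ennreal (w n x) + ennreal (e / (2 * (m + 1))) * indicator {a n..b n} x"
      by (cases "x \<in> {a n..b n}") (use s_in s_out in \<open>auto simp: w_def intro!: ennreal_leI\<close>)
  qed
  also have "\<dots> = (\<integral>\<^sup>+x. w n x \<partial>M) + ennreal (e / (2 * (m + 1))) * ennreal m"
    by (subst nn_integral_add) (auto simp: nn_integral_cmult_indicator m(1))
  also have "\<dots> \<le> ennreal (e / 2) + ennreal (e / 2)"
  proof (rule add_mono)
    have "e / (2 * (m + 1)) * m \<le> e / 2" using \<open>e > 0\<close> m(2) by (simp add: field_simps)
    then show "ennreal (e / (2 * (m + 1))) * ennreal m \<le> ennreal (e / 2)"
      using \<open>e > 0\<close> m(2) by (simp flip: ennreal_mult add: ennreal_leI)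
  qed (use n in auto)
  also have "\<dots> = ennreal e" using \<open>e > 0\<close> by (simp flip: ennreal_plus)
  finally show "\<exists>s. Bochner_Integration.simple_bochner_integrable M s \<and> (\<integral>\<^sup>+x. norm (f x - s x) \<partial>M) \<le> ennreal e"
    using s by blast
qed

section \<open>Strongly continuous semigroups\<close>

text \<open>Some \<open>w\<close> of norm \<open>r\<close> has \<open>norm (F w)\<close> above
  \<open>c\<close>. Since \<open>2 *\<^sub>R F w = F (x + w) - F (x - w)\<close>, at least one of
  the points \<open>x + w\<close> and \<open>x - w\<close> keeps this size, whatever
  \<open>x\<close> is.\<close>

lemma blinfun_large_near:
  fixes F :: "'a::real_normed_vector \<Rightarrow>\<^sub>L 'b::real_normed_vector"
  assumes "0 < r" "0 \<le> c" "c < r * norm F"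
  obtains y where "norm (y - x) \<le> r" "c < norm (F y)"
proof -
  have "\<not> (\<forall>v. norm (F v) \<le> (c / r) * norm v)"
  proof
    assume "\<forall>v. norm (F v) \<le> (c / r) * norm v"
    then have "norm F \<le> c / r" using assms by (intro norm_blinfun_bound) auto
    then show False using assms by (simp add: field_simps)
  qed
  then obtain v where v: "norm (F v) > (c / r) * norm v" by (meson not_le)
  then have v0: "norm v > 0" by auto
  define w where "w = (r / norm v) *\<^sub>R v"
  have w: "norm w = r" "c < norm (F w)"
    using v v0 assms by (auto simp: w_def blinfun.scaleR_right field_simps)
  have "2 *\<^sub>R F w = F (x + w) - F (x - w)"
    by (simp add: blinfun.add_right blinfun.diff_right scaleR_2)
  then have "2 * norm (F w) \<le> norm (F (x + w)) + norm (F (x - w))"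
    by (metis norm_scaleR abs_numeral norm_triangle_ineq4)
  then consider "c < norm (F (x + w))" | "c < norm (F (x - w))" using w by linarith
  then show ?thesis
  proof cases
    case 1 then show ?thesis using that[of "x + w"] w by simp
  next
    case 2 then show ?thesis using that[of "x - w"] w by simp
  qed
qed

text \<open>Sokal's proof of the uniform boundedness principle: the points \<open>y k\<close> move by at most
  \<open>1 / 3 ^ k\<close>, and \<open>G k\<close> is still large at their limit.\<close>

theorem uniform_boundedness:
  fixes F :: "nat \<Rightarrow> 'a::banach \<Rightarrow>\<^sub>L 'b::real_normed_vector"
  assumes "\<And>x. Bseq (\<lambda>n. F n x)"
  shows "Bseq F"
proof (rule ccontr)
  assume "\<not> Bseq F"
  then have "\<exists>n. norm (F n) > 4 ^ k" for k :: nat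
    by (auto simp: Bseq_def not_le)
  then obtain s where s: "\<And>k. norm (F (s k)) > 4 ^ k" by metis
  define G where "G k = F (s k)" for k
  have G: "norm (G k) > 4 ^ k" for k using s by (simp add: G_def)
  have ex: "\<exists>y. norm (y - x) \<le> 1 / 3 ^ k \<and> (2 / 3) * (1 / 3 ^ k) * norm (G k) < norm (G k y)" for k :: nat and x
  proof -
    have "0 < norm (G k)" using G[of k] by (meson less_trans zero_less_numeral zero_less_power)
    then show ?thesis
      using blinfun_large_near[of "1 / 3 ^ k" "(2 / 3) * (1 / 3 ^ k) * norm (G k)" "G k" x]
      by (auto simp: field_simps)
  qed
  define g where "g k x = (SOME y. norm (y - x) \<le> 1 / 3 ^ k \<and>
    (2 / 3) * (1 / 3 ^ k) * norm (G k) < norm (G k y))" for k x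
  have g: "norm (g k x - x) \<le> 1 / 3 ^ k" "(2 / 3) * (1 / 3 ^ k) * norm (G k) < norm (G k (g k x))" for k x
    using someI_ex[OF ex[of x k]] by (simp_all add: g_def)
  define y where "y = rec_nat 0 g"
  have y: "y (Suc k) = g k (y k)" for k by (simp add: y_def)
  have diff: "norm (y n - y m) \<le> (3 / 2) * (1 / 3 ^ m - 1 / 3 ^ n)" if "m \<le> n" for m n
    using that
  proof (induction rule: dec_induct)
    case (step n)
    have "norm (y (Suc n) - y m) \<le> norm (y (Suc n) - y n) + norm (y n - y m)"
      by (metis norm_triangle_ineq diff_add_cancel add_diff_eq)
    also have "\<dots> \<le> 1 / 3 ^ n + (3 / 2) * (1 / 3 ^ m - 1 / 3 ^ n)"
      using step g(1) y by (intro add_mono) auto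
    finally show ?case by (simp add: field_simps)
  qed simp
  have diff': "norm (y n - y m) \<le> (3 / 2) / 3 ^ m" if "m \<le> n" for m n
  proof -
    have "(3 / 2) * (1 / 3 ^ m - 1 / 3 ^ n) \<le> (3 / 2) / (3 ^ m :: real)" by (simp add: field_simps)
    then show ?thesis using diff[OF that] by linarith
  qed
  have "Cauchy y"
  proof (rule CauchyI')
    fix e :: real assume "e > 0"
    have "(\<lambda>m. (3 / 2) * (1 / 3) ^ m) \<longlonglongrightarrow> (3 / 2) * (0 :: real)"
      by (intro tendsto_mult tendsto_const LIMSEQ_power_zero) auto
    then have "eventually (\<lambda>m. (3 / 2) * (1 / 3) ^ m < e) sequentially"
      using \<open>e > 0\<close> by (intro order_tendstoD) auto
    then obtain M where M: "\<And>m. m \<ge> M \<Longrightarrow> (3 / 2) * (1 / 3) ^ m < e"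
      by (auto simp: eventually_sequentially)
    have "norm (y m - y n) < e" if "m \<ge> M" "n > m" for m n
      using diff'[of m n] M[of m] that by (simp add: norm_minus_commute power_divide)
    then show "\<exists>M. \<forall>m\<ge>M. \<forall>n>m. dist (y m) (y n) < e" unfolding dist_norm by blast
  qed
  then obtain x where x: "y \<longlonglongrightarrow> x" by (auto simp: Cauchy_convergent_iff convergent_def)
  have near: "norm (x - y m) \<le> (3 / 2) / 3 ^ m" for m
  proof (rule tendsto_upperbound)
    show "(\<lambda>n. norm (y n - y m)) \<longlonglongrightarrow> norm (x - y m)" by (intro tendsto_intros x)
    show "eventually (\<lambda>n. norm (y n - y m) \<le> (3 / 2) / 3 ^ m) sequentially"
      using eventually_ge_at_top[of m] by eventually_elim (rule diff')
  qed simp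
  \<comment> \<open>At \<open>y (Suc k)\<close> the value exceeds 2/3 of
    \<open>norm (G k) / 3 ^ k\<close>. Passing to the limit \<open>x\<close> moves the argument by
    at most \<open>(3 / 2) / 3 ^ Suc k\<close>, which costs 1/2 of that quantity. The remaining 1/6
    still grows, because \<open>norm (G k)\<close> exceeds \<open>4 ^ k\<close>.\<close>
  have big: "(1 / 6) * (4 / 3) ^ k \<le> norm (G k x)" for k
  proof -
    have "norm (G k (x - y (Suc k))) \<le> norm (G k) * ((3 / 2) / 3 ^ Suc k)"
      using norm_blinfun[of "G k" "x - y (Suc k)"] near[of "Suc k"]
      by (meson mult_left_mono norm_ge_zero order_trans)
    moreover have "norm (G k (y (Suc k))) \<le> norm (G k x) + norm (G k (x - y (Suc k)))"
      by (simp add: blinfun.diff_right) (metis norm_minus_commute norm_triangle_sub add.commute)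
    moreover have "(2 / 3) * (1 / 3 ^ k) * norm (G k) < norm (G k (y (Suc k)))"
      using g(2) by (simp add: y)
    moreover have "norm (G k) * ((3 / 2) / 3 ^ Suc k) = (1 / 2) * ((1 / 3 ^ k) * norm (G k))" by simp
    ultimately have "(1 / 6) * ((1 / 3 ^ k) * norm (G k)) \<le> norm (G k x)"
      unfolding mult.assoc[of "2 / 3" "1 / 3 ^ k" "norm (G k)"] by linarith
    then have "(1 / 6) * (1 / 3 ^ k) * norm (G k) \<le> norm (G k x)" by (simp only: mult.assoc)
    moreover have "(1 / 6) * (1 / 3 ^ k) * 4 ^ k \<le> (1 / 6) * (1 / 3 ^ k) * norm (G k)"
      using G[of k] by (intro mult_left_mono) auto
    ultimately show ?thesis by (simp add: power_divide)
  qed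
  obtain K where K: "\<And>n. norm (F n x) \<le> K" using assms[of x] by (auto simp: Bseq_def)
  obtain k :: nat where "6 * K < (4 / 3) ^ k" using real_arch_pow[of "4 / 3" "6 * K"] by auto
  then show False using big[of k] K[of "s k"] by (simp add: G_def)
qed

section \<open>Local boundedness and strong continuity of orbits\<close>

lemma C0_semigroup_add: "C0_semigroup S \<Longrightarrow> 0 \<le> s \<Longrightarrow> 0 \<le> t \<Longrightarrow> S (s + t) x = S s (S t x)"
  by (simp add: C0_semigroup_def)

lemma C0_semigroup_zero: "C0_semigroup S \<Longrightarrow> S 0 x = x"
  by (simp add: C0_semigroup_def)

lemma C0_semigroup_commute:
  "C0_semigroup S \<Longrightarrow> 0 \<le> s \<Longrightarrow> 0 \<le> t \<Longrightarrow> S s (S t x) = S t (S s x)"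
  using C0_semigroup_add[of S s t x] C0_semigroup_add[of S t s x] by (simp add: add.commute)

lemma C0_semigroup_tendsto_zero:
  assumes S: "C0_semigroup S"
  shows "((\<lambda>t. S t x) \<longlongrightarrow> x) (at 0 within {0..})"
proof -
  have "((\<lambda>t. S t x) \<longlongrightarrow> x) (at 0 within {0<..})"
    using S by (simp add: C0_semigroup_def)
  then show ?thesis
    by (rule Lim_transform_within_set) (auto simp: eventually_at intro!: exI[of _ 1])
qed

text \<open>Otherwise there are times \<open>h n\<close> below \<open>1 / Suc n\<close> with
  unbounded operator norms. But \<open>S (h n)\<close> converges strongly to the identity, so this
  contradicts uniform boundedness.\<close>

lemma C0_semigroup_locally_bounded:
  fixes S :: "real \<Rightarrow> 'a::complex_banach \<Rightarrow>\<^sub>L 'a"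
  assumes S: "C0_semigroup S"
  obtains d K where "d > 0" "K \<ge> 1" "\<And>h. 0 \<le> h \<Longrightarrow> h \<le> d \<Longrightarrow> norm (S h) \<le> K"
proof -
  have "\<exists>n::nat. \<forall>h. 0 \<le> h \<longrightarrow> h \<le> 1 / Suc n \<longrightarrow> norm (S h) \<le> n"
  proof (rule ccontr)
    assume "\<not> ?thesis"
    then obtain h where h: "\<And>n::nat. 0 \<le> h n" "\<And>n. h n \<le> 1 / Suc n" "\<And>n. norm (S (h n)) > n"
      by (metis not_le)
    have lim: "h \<longlonglongrightarrow> 0"
      by (rule tendsto_sandwich[OF always_eventually always_eventually tendsto_const LIMSEQ_Suc[OF lim_1_over_n]])
        (use h in auto)
    have "(\<lambda>n. S (h n) x) \<longlonglongrightarrow> x" for x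
    proof (rule LIMSEQ_I)
      fix e :: real assume "e > 0"
      obtain d where d: "d > 0" "\<And>t. 0 \<le> t \<Longrightarrow> t < d \<Longrightarrow> t \<noteq> 0 \<Longrightarrow> dist (S t x) x < e"
        using C0_semigroup_tendsto_zero[OF S, of x] \<open>e > 0\<close>
        by (auto simp: tendsto_iff eventually_at dist_real_def)
      obtain N where N: "\<And>n. n \<ge> N \<Longrightarrow> h n < d"
        using order_tendstoD(2)[OF lim d(1)] by (auto simp: eventually_sequentially)
      have "norm (S (h n) x - x) < e" if "n \<ge> N" for n
        using d(2)[of "h n"] N[OF that] h(1) C0_semigroup_zero[OF S] \<open>e > 0\<close>
        by (cases "h n = 0") (auto simp: dist_norm)
      then show "\<exists>N. \<forall>n\<ge>N. norm (S (h n) x - x) < e" by blast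
    qed
    then have "Bseq (\<lambda>n. S (h n) x)" for x
      by (meson convergentI convergent_imp_Bseq)
    from uniform_boundedness[of "\<lambda>n. S (h n)", OF this]
    obtain K where "\<And>n. norm (S (h n)) \<le> K" by (auto simp: Bseq_def)
    moreover obtain n :: nat where "K < n" using reals_Archimedean2 by blast
    ultimately show False using h(3)[of n] by (meson less_trans not_le)
  qed
  then obtain n :: nat where n: "\<forall>h. 0 \<le> h \<longrightarrow> h \<le> 1 / Suc n \<longrightarrow> norm (S h) \<le> n" by blast
  show ?thesis
    by (rule that[of "1 / Suc n" "max 1 n"]) (use n in \<open>auto simp: le_max_iff_disj\<close>)
qed

lemma C0_semigroup_bounded_on:
  fixes S :: "real \<Rightarrow> 'a::complex_banach \<Rightarrow>\<^sub>L 'a"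
  assumes S: "C0_semigroup S"
  obtains K where "K \<ge> 1" "\<And>r. 0 \<le> r \<Longrightarrow> r \<le> s \<Longrightarrow> norm (S r) \<le> K"
proof -
  obtain d K where dK: "d > 0" "K \<ge> 1" "\<And>h. 0 \<le> h \<Longrightarrow> h \<le> d \<Longrightarrow> norm (S h) \<le> K"
    using C0_semigroup_locally_bounded[OF S] by blast
  have *: "norm (S r) \<le> K ^ Suc n" if "0 \<le> r" "r \<le> Suc n * d" for r n
    using that
  proof (induction n arbitrary: r)
    case (Suc n)
    show ?case
    proof (cases "r \<le> Suc n * d")
      case True
      have "norm (S r) \<le> K ^ Suc n" by (rule Suc.IH) (use Suc True in auto)
      also have "\<dots> \<le> K ^ Suc (Suc n)" using dK(2) by (intro power_increasing) auto
      finally show ?thesis .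
    next
      case False
      then have r: "0 \<le> r - d" "r - d \<le> Suc n * d"
      proof -
        define m where "m = real n * d"
        have m: "0 \<le> m" "Suc n * d = d + m" "Suc (Suc n) * d = 2 * d + m"
          using dK(1) by (simp_all add: m_def algebra_simps)
        show "0 \<le> r - d" "r - d \<le> Suc n * d"
          using False Suc.prems unfolding m(2,3) using m(1) by auto
      qed
      have "S r = S d o\<^sub>L S (r - d)"
        using S r dK(1) unfolding C0_semigroup_def by (metis less_le add.commute diff_add_cancel)
      then have "norm (S r) \<le> norm (S d) * norm (S (r - d))" by (simp add: norm_blinfun_compose)
      also have "\<dots> \<le> K * K ^ Suc n"
        using dK Suc.IH[OF r] by (intro mult_mono) auto
      finally show ?thesis by simp
    qed
  qed (use dK in simp)
  obtain n :: nat where "s / d < n" using reals_Archimedean2 by blast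
  then have n: "s \<le> Suc n * d" using dK(1) by (simp add: field_simps)
  show ?thesis
    by (rule that[of "K ^ Suc n"]) (use dK n * in \<open>auto intro: one_le_power order_trans\<close>)
qed

text \<open>A uniform norm bound allows the argument to move while the operators converge strongly.
  The product rule for \<open>T (t - r) (S r x)\<close> depends on this.\<close>

lemma strong_tendsto_apply:
  fixes B :: "'c \<Rightarrow> 'a::real_normed_vector \<Rightarrow>\<^sub>L 'b::real_normed_vector"
  assumes bd: "eventually (\<lambda>h. norm (B h) \<le> K) F"
    and lim: "((\<lambda>h. B h z) \<longlongrightarrow> w) F" and y: "(y \<longlongrightarrow> z) F"
  shows "((\<lambda>h. B h (y h)) \<longlongrightarrow> w) F"
proof -
  have "((\<lambda>h. B h (y h - z)) \<longlongrightarrow> 0) F"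
  proof (rule Lim_null_comparison)
    show "((\<lambda>h. K * norm (y h - z)) \<longlongrightarrow> 0) F"
      by (rule tendsto_mult_right_zero) (use y in \<open>simp add: tendsto_norm_zero LIM_zero\<close>)
    show "eventually (\<lambda>h. norm (B h (y h - z)) \<le> K * norm (y h - z)) F"
      using bd
    proof eventually_elim
      case (elim h)
      show ?case using norm_blinfun[of "B h" "y h - z"] elim
        by (meson mult_right_mono norm_ge_zero order_trans)
    qed
  qed
  from tendsto_add[OF this lim] show ?thesis by (simp add: blinfun.diff_right)
qed

text \<open>Factoring out the operator at the smaller time reduces continuity at \<open>s\<close>,
  from the left as well as from the right, to continuity at zero.\<close>

lemma C0_semigroup_diff_le:
  fixes S :: "real \<Rightarrow> 'a::complex_banach \<Rightarrow>\<^sub>L 'a"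
  assumes S: "C0_semigroup S" and K: "\<And>r. 0 \<le> r \<Longrightarrow> r \<le> u \<Longrightarrow> norm (S r) \<le> K"
    and "0 \<le> s" "s \<le> u" "0 \<le> t" "t \<le> u"
  shows "norm (S t x - S s x) \<le> K * norm (S \<bar>t - s\<bar> x - x)"
proof -
  have *: "norm (S b x - S a x) \<le> K * norm (S (b - a) x - x)" if "0 \<le> a" "a \<le> b" "b \<le> u" for a b
  proof -
    have "S b x - S a x = S a (S (b - a) x - x)"
      using C0_semigroup_add[OF S, of a "b - a" x] that by (simp add: blinfun.diff_right)
    also have "norm \<dots> \<le> norm (S a) * norm (S (b - a) x - x)" by (rule norm_blinfun)
    also have "\<dots> \<le> K * norm (S (b - a) x - x)" using K that by (intro mult_right_mono) auto
    finally show ?thesis .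
  qed
  show ?thesis
  proof (cases "s \<le> t")
    case True then show ?thesis using *[of s t] assms by simp
  next
    case False then show ?thesis using *[of t s] assms by (simp add: norm_minus_commute)
  qed
qed

lemma C0_semigroup_continuous:
  fixes S :: "real \<Rightarrow> 'a::complex_banach \<Rightarrow>\<^sub>L 'a"
  assumes S: "C0_semigroup S"
  shows "continuous_on {0..} (\<lambda>t. S t x)"
  unfolding continuous_on_def
proof
  fix s :: real assume "s \<in> {0..}"
  obtain K where K: "K \<ge> 1" "\<And>r. 0 \<le> r \<Longrightarrow> r \<le> s + 1 \<Longrightarrow> norm (S r) \<le> K"
    using C0_semigroup_bounded_on[OF S] by blast
  show "((\<lambda>t. S t x) \<longlongrightarrow> S s x) (at s within {0..})"
    unfolding tendsto_iff
  proof (intro allI impI)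
    fix e :: real assume "e > 0"
    then have "e / K > 0" using K by simp
    then obtain d where d: "d > 0" "\<And>t. 0 \<le> t \<Longrightarrow> t < d \<Longrightarrow> t \<noteq> 0 \<Longrightarrow> dist (S t x) x < e / K"
      using C0_semigroup_tendsto_zero[OF S, of x]
      by (auto simp: tendsto_iff eventually_at dist_real_def)
    have "dist (S t x) (S s x) < e" if "t \<ge> 0" "t \<noteq> s" "dist t s < min d 1" for t
    proof -
      have "dist (S t x) (S s x) \<le> K * norm (S \<bar>t - s\<bar> x - x)"
        unfolding dist_norm
        by (rule C0_semigroup_diff_le[OF S K(2)]) (use that \<open>s \<in> {0..}\<close> in \<open>auto simp: dist_real_def\<close>)
      also have "\<dots> < K * (e / K)"
        using d(2)[of "\<bar>t - s\<bar>"] that K(1)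
        by (intro mult_strict_left_mono) (auto simp: dist_norm)
      finally show ?thesis using K(1) by simp
    qed
    then show "eventually (\<lambda>t. dist (S t x) (S s x) < e) (at s within {0..})"
      using d(1) by (auto simp: eventually_at intro!: exI[of _ "min d 1"])
  qed
qed

section \<open>The generator: derivatives of orbits and uniqueness of the semigroup\<close>

lemma neg_generator_unique:
  "(x, y) \<in> neg_generator S \<Longrightarrow> (x, z) \<in> neg_generator S \<Longrightarrow> y = z"
  by (auto simp: neg_generator_def intro: tendsto_unique[rotated])

lemma neg_generator_commute:
  assumes "(x, y) \<in> neg_generator S"
    and B: "bounded_linear B" "\<And>h. 0 \<le> h \<Longrightarrow> B (S h x) = S h (B x)"
  shows "(B x, B y) \<in> neg_generator S"
proof -
  interpret B: bounded_linear B by fact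
  have "((\<lambda>h. B ((x - S h x) /\<^sub>R h)) \<longlongrightarrow> B y) (at_right 0)"
    using assms by (intro B.tendsto) (simp add: neg_generator_def)
  then have "((\<lambda>h. (B x - S h (B x)) /\<^sub>R h) \<longlongrightarrow> B y) (at_right 0)"
    by (rule Lim_transform_eventually)
      (auto simp: B.scaleR B.diff B(2) eventually_at intro!: exI[of _ 1])
  then show ?thesis by (simp add: neg_generator_def)
qed

lemma neg_generator_semigroup:
  assumes "C0_semigroup S" "(x, y) \<in> neg_generator S" "0 \<le> s"
  shows "(S s x, S s y) \<in> neg_generator S"
  using assms
  by (intro neg_generator_commute[of x y S "blinfun_apply (S s)"])
    (auto simp: blinfun.bounded_linear_right C0_semigroup_commute)

lemma has_vector_derivative_iff_quotient:
  "(f has_vector_derivative D) (at x within A) \<longleftrightarrow> ((\<lambda>r. (f r - f x) /\<^sub>R (r - x)) \<longlongrightarrow> D) (at x within A)"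
proof -
  have "norm (f r - f x - (r - x) *\<^sub>R D) / norm (r - x) = norm ((f r - f x) /\<^sub>R (r - x) - D)" if "r \<noteq> x" for r
  proof -
    have "(f r - f x) /\<^sub>R (r - x) - D = (f r - f x - (r - x) *\<^sub>R D) /\<^sub>R (r - x)"
      using that by (simp add: scaleR_diff_right)
    then show ?thesis by (simp add: divide_inverse_commute)
  qed
  then have "((\<lambda>r. norm (f r - f x - (r - x) *\<^sub>R D) / norm (r - x)) \<longlongrightarrow> 0) (at x within A) \<longleftrightarrow>
      ((\<lambda>r. norm ((f r - f x) /\<^sub>R (r - x) - D)) \<longlongrightarrow> 0) (at x within A)"
    by (intro Lim_cong_within) auto
  then show ?thesis
    by (simp add: has_vector_derivative_def has_derivative_iff_norm bounded_linear_scaleR_left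
        tendsto_norm_zero_iff LIM_zero_iff)
qed

text \<open>The generator supplies only a right derivative at zero. An increment over
  \<open>[a, b]\<close> is \<open>S a\<close> applied to an increment that starts at zero; for the
  left derivative the base point \<open>a\<close> moves, and strong continuity of the orbit of
  \<open>y\<close> compensates for this.\<close>

lemma C0_semigroup_has_derivative:
  fixes S :: "real \<Rightarrow> 'a::complex_banach \<Rightarrow>\<^sub>L 'a"
  assumes S: "C0_semigroup S" and xy: "(x, y) \<in> neg_generator S" and s: "0 \<le> s"
  shows "((\<lambda>t. S t x) has_vector_derivative - S s y) (at s within {0..})"
  unfolding has_vector_derivative_def has_derivative_within_alt2
proof (intro conjI allI impI)
  show "bounded_linear (\<lambda>t. t *\<^sub>R - S s y)" by (rule bounded_linear_scaleR_left)
  fix e :: real assume "e > 0"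
  obtain K where K: "K \<ge> 1" "\<And>r. 0 \<le> r \<Longrightarrow> r \<le> s + 1 \<Longrightarrow> norm (S r) \<le> K"
    using C0_semigroup_bounded_on[OF S] by blast
  have "((\<lambda>h. (x - S h x) /\<^sub>R h) \<longlongrightarrow> y) (at_right 0)"
    using xy by (simp add: neg_generator_def)
  moreover have "e / (2 * K) > 0" using \<open>e > 0\<close> K by simp
  ultimately obtain d1 where d1: "d1 > 0"
    "\<And>h. 0 < h \<Longrightarrow> h < d1 \<Longrightarrow> dist ((x - S h x) /\<^sub>R h) y < e / (2 * K)"
    unfolding tendsto_iff eventually_at by (fastforce simp: dist_real_def)
  have "((\<lambda>t. S t y) \<longlongrightarrow> S s y) (at s within {0..})"
    using C0_semigroup_continuous[OF S, of y] s by (auto simp: continuous_on_def)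
  moreover have "e / 2 > 0" using \<open>e > 0\<close> by simp
  ultimately obtain d2 where d2: "d2 > 0"
    "\<And>t. 0 \<le> t \<Longrightarrow> t \<noteq> s \<Longrightarrow> dist t s < d2 \<Longrightarrow> dist (S t y) (S s y) < e / 2"
    unfolding tendsto_iff eventually_at by (metis atLeast_iff)
  \<comment> \<open>Used with \<open>a = s\<close> for right increments and with
    \<open>b = s\<close> for left ones. The vector \<open>w\<close> is the error of the difference
    quotient at zero, damped by \<open>K\<close>; the term \<open>S s y - S a y\<close> is the price
    of the base point \<open>a\<close>. Each contributes at most \<open>e / 2\<close>.\<close>
  have main: "norm (S b x - S a x - (b - a) *\<^sub>R - S s y) \<le> e * (b - a)"
    if ab: "0 \<le> a" "a < b" "b - a < d1" "dist a s < d2" "a \<le> s" for a b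
  proof -
    define w where "w = y - (x - S (b - a) x) /\<^sub>R (b - a)"
    have "S b x = S a (S (b - a) x)" using C0_semigroup_add[OF S, of a "b - a" x] ab by simp
    moreover have "S (b - a) x = x - (b - a) *\<^sub>R y + (b - a) *\<^sub>R w"
      using ab by (simp add: w_def scaleR_diff_right)
    ultimately have "S b x - S a x - (b - a) *\<^sub>R - S s y = (b - a) *\<^sub>R (S a w + (S s y - S a y))"
      by (simp add: blinfun.diff_right blinfun.add_right blinfun.scaleR_right algebra_simps)
    then have "norm (S b x - S a x - (b - a) *\<^sub>R - S s y) = (b - a) * norm (S a w + (S s y - S a y))"
      using ab by simp
    also have "\<dots> \<le> (b - a) * e"
    proof (rule mult_left_mono)
      have "norm (S a w) \<le> norm (S a) * norm w" by (rule norm_blinfun)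
      also have "\<dots> \<le> K * (e / (2 * K))"
        using K(2)[of a] K(1) ab d1(2)[of "b - a"]
        by (intro mult_mono) (auto simp: w_def dist_norm norm_minus_commute)
      also have "\<dots> = e / 2" using K(1) by simp
      finally have "norm (S a w) \<le> e / 2" .
      moreover have "norm (S s y - S a y) \<le> e / 2"
        using d2(2)[of a] ab \<open>e > 0\<close> by (cases "a = s") (auto simp: dist_norm norm_minus_commute)
      ultimately show "norm (S a w + (S s y - S a y)) \<le> e"
        using norm_triangle_ineq[of "S a w" "S s y - S a y"] by linarith
    qed (use ab in simp)
    finally show ?thesis by (simp add: mult.commute)
  qed
  have le: "norm (S t x - S s x - (t - s) *\<^sub>R - S s y) \<le> e * norm (t - s)"
    if t: "0 \<le> t" "t \<noteq> s" "dist t s < min d1 d2" for t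
  proof (cases "s < t")
    case True
    then show ?thesis using main[of s t] t s d2(1) by (auto simp: dist_real_def)
  next
    case False
    then have "norm (S s x - S t x - (s - t) *\<^sub>R - S s y) \<le> e * (s - t)"
      using main[of t s] t s by (auto simp: dist_real_def)
    moreover have "S t x - S s x - (t - s) *\<^sub>R - S s y = - (S s x - S t x - (s - t) *\<^sub>R - S s y)"
      by (simp add: algebra_simps)
    ultimately show ?thesis using False by (simp only: norm_minus_cancel) simp
  qed
  then show "eventually (\<lambda>t. norm (S t x - S s x - (t - s) *\<^sub>R - S s y) \<le> e * norm (t - s)) (at s within {0..})"
    using d1(1) d2(1) le by (cases "s = 0") (auto simp: eventually_at intro!: exI[of _ "min d1 d2"])
qed

text \<open>For \<open>x\<close> in the common domain, \<open>T (t - s) (S s x)\<close> does not depend on \<open>s\<close>.\<close>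

theorem C0_semigroup_unique:
  fixes S T :: "real \<Rightarrow> 'a::complex_banach \<Rightarrow>\<^sub>L 'a"
  assumes S: "C0_semigroup S" and T: "C0_semigroup T"
    and gen: "neg_generator S = neg_generator T"
    and dense: "closure (Domain (neg_generator T)) = UNIV" and t: "0 \<le> t"
  shows "S t = T t"
proof -
  obtain K where K: "K \<ge> 1" "\<And>r. 0 \<le> r \<Longrightarrow> r \<le> t \<Longrightarrow> norm (T r) \<le> K"
    using C0_semigroup_bounded_on[OF T] by blast
  have eq: "S t x = T t x" if xy: "(x, y) \<in> neg_generator T" for x y
  proof -
    define u where "u s = T (t - s) (S s x)" for s
    have "(u has_vector_derivative 0) (at s within {0..t})" if s: "0 \<le> s" "s \<le> t" for s
    proof -
      let ?F = "at s within {0..t}"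
      have m: "(S s x, S s y) \<in> neg_generator T"
        using neg_generator_semigroup[OF S _ s(1)] xy gen by simp
      have dS: "((\<lambda>r. (S r x - S s x) /\<^sub>R (r - s)) \<longlongrightarrow> - S s y) ?F"
        using C0_semigroup_has_derivative[OF S _ s(1), of x y] xy gen
        by (auto simp: has_vector_derivative_iff_quotient intro: tendsto_within_subset)
      have dT: "((\<lambda>r. T (t - r) (S s x)) has_vector_derivative T (t - s) (S s y)) ?F"
      proof -
        have "((\<lambda>v. T v (S s x)) has_vector_derivative - T (t - s) (S s y)) (at (t - s) within {0..})"
          by (rule C0_semigroup_has_derivative[OF T m]) (use s in simp)
        then have 1: "((\<lambda>v. T v (S s x)) has_vector_derivative - T (t - s) (S s y)) (at (t - s) within (\<lambda>r. t - r) ` {0..t})"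
          by (rule has_vector_derivative_within_subset) auto
        have 2: "((\<lambda>r. t - r) has_vector_derivative - 1) ?F" by (auto intro!: derivative_eq_intros)
        show ?thesis using vector_diff_chain_within[OF 2 1] by (simp add: o_def)
      qed
      \<comment> \<open>The difference quotient of \<open>u\<close> is this expression plus the
        quotient from \<open>dT\<close>, in which the inner vector is frozen at
        \<open>S s x\<close>. The two limits cancel.\<close>
      have "((\<lambda>r. T (t - r) ((S r x - S s x) /\<^sub>R (r - s))) \<longlongrightarrow> T (t - s) (- S s y)) ?F"
      proof (rule strong_tendsto_apply[OF _ _ dS])
        show "eventually (\<lambda>r. norm (T (t - r)) \<le> K) ?F"
          using K(2) by (auto simp: eventually_at intro!: exI[of _ 1])
        have "continuous_on {0..t} (\<lambda>r. T (t - r) (- S s y))"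
          by (rule continuous_on_compose2[OF C0_semigroup_continuous[OF T]])
            (auto intro!: continuous_intros)
        then show "((\<lambda>r. T (t - r) (- S s y)) \<longlongrightarrow> T (t - s) (- S s y)) ?F"
          using s by (auto simp: continuous_on_def)
      qed
      from tendsto_add[OF this dT[unfolded has_vector_derivative_iff_quotient]]
      have "((\<lambda>r. (u r - u s) /\<^sub>R (r - s)) \<longlongrightarrow> 0) ?F"
        by (simp add: u_def blinfun.diff_right blinfun.scaleR_right blinfun.minus_right
            flip: scaleR_add_right)
      then show ?thesis by (simp add: has_vector_derivative_iff_quotient)
    qed
    then obtain c where "\<And>s. s \<in> {0..t} \<Longrightarrow> u s = c"
      by (metis has_vector_derivative_zero_constant convex_real_interval(5) atLeastAtMost_iff)
    then have "u t = u 0" using t by auto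
    then show ?thesis using C0_semigroup_zero[OF T] C0_semigroup_zero[OF S] by (simp add: u_def)
  qed
  have "closed {x. S t x = T t x}"
    by (intro closed_Collect_eq) (auto intro!: continuous_intros)
  then have "closure (Domain (neg_generator T)) \<subseteq> {x. S t x = T t x}"
    by (intro closure_minimal) (use eq in auto)
  then show ?thesis using dense by (intro blinfun_eqI) auto
qed

section \<open>Rescaling of time\<close>

lemma C0_semigroup_scale:
  assumes T: "C0_semigroup T" and c: "0 < c"
  shows "C0_semigroup (\<lambda>s. T (c * s))" "neg_generator (\<lambda>s. T (c * s)) = scale_op c (neg_generator T)"
proof -
  have lim: "filterlim (\<lambda>h. c * h) (at_right 0) (at_right 0)" if "c > 0" for c :: real
    unfolding filterlim_at
  proof
    have "((\<lambda>h. c * h) \<longlongrightarrow> c * 0) (at_right 0)" by (intro tendsto_intros)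
    then show "((\<lambda>h. c * h) \<longlongrightarrow> 0) (at_right 0)" by simp
  qed (use that in \<open>auto simp: eventually_at intro!: exI[of _ 1]\<close>)
  have "((\<lambda>t. T (c * t) x) \<longlongrightarrow> x) (at_right 0)" for x
    by (rule filterlim_compose[OF _ lim[OF c]]) (use T in \<open>simp add: C0_semigroup_def\<close>)
  then show "C0_semigroup (\<lambda>s. T (c * s))"
    using T c unfolding C0_semigroup_def by (simp add: distrib_left)
  \<comment> \<open>Stated for an arbitrary \<open>S\<close> and factor, so that it also applies
    backwards with the factor \<open>1 / c\<close>.\<close>
  have *: "(x, c' *\<^sub>R y) \<in> neg_generator (\<lambda>s. S (c' * s))"
    if "(x, y) \<in> neg_generator S" "0 < c'" for x y :: 'a and S and c' :: real
  proof -
    have "((\<lambda>h. (x - S h x) /\<^sub>R h) \<longlongrightarrow> y) (at_right 0)"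
      using that by (simp add: neg_generator_def)
    from filterlim_compose[OF this lim[OF that(2)]]
    have "((\<lambda>h. c' *\<^sub>R ((x - S (c' * h) x) /\<^sub>R (c' * h))) \<longlongrightarrow> c' *\<^sub>R y) (at_right 0)"
      by (intro tendsto_intros)
    then show ?thesis using that(2) by (simp add: neg_generator_def flip: mult.assoc)
  qed
  show "neg_generator (\<lambda>s. T (c * s)) = scale_op c (neg_generator T)" (is "?L = ?R")
  proof (intro set_eqI iffI; clarify)
    fix x y assume "(x, y) \<in> ?L"
    from *[OF this, of "1 / c"] c have "(x, (1 / c) *\<^sub>R y) \<in> neg_generator T" by simp
    moreover have "y = c *\<^sub>R ((1 / c) *\<^sub>R y)" using c by simp
    ultimately show "(x, y) \<in> ?R" unfolding scale_op_def by blast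
  next
    fix x y assume "(x, y) \<in> ?R"
    then show "(x, y) \<in> ?L" using * c by (auto simp: scale_op_def)
  qed
qed

text \<open>\<open>T (c * s)\<close> shows that the choice in \<open>generated_semigroup\<close> has
  a candidate, and uniqueness identifies the chosen semigroup with it on nonnegative times.\<close>

lemma generated_semigroup_scale:
  fixes T :: "real \<Rightarrow> 'a::complex_banach \<Rightarrow>\<^sub>L 'a"
  assumes T: "C0_semigroup T" and dense: "closure (Domain (neg_generator T)) = UNIV"
    and c: "0 < c" and s: "0 \<le> s"
  shows "generated_semigroup (scale_op c (neg_generator T)) s = T (c * s)"
proof -
  let ?B = "scale_op c (neg_generator T)"
  have "C0_semigroup (generated_semigroup ?B) \<and> neg_generator (generated_semigroup ?B) = ?B"
    unfolding generated_semigroup_def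
    by (rule someI[of _ "\<lambda>s. T (c * s)"]) (use C0_semigroup_scale[OF T c] in auto)
  moreover have "Domain ?B = Domain (neg_generator T)" by (auto simp: scale_op_def Domain_iff)
  ultimately show ?thesis
    using C0_semigroup_unique[of "generated_semigroup ?B" "\<lambda>s. T (c * s)" s]
      C0_semigroup_scale[OF T c] dense s by simp
qed

section \<open>Bounded analytic semigroups\<close>

text \<open>\<open>G t\<close> is the operator $A e^{-tA}$.\<close>

locale analytic_semigroup =
  fixes T G :: "real \<Rightarrow> 'a::complex_banach \<Rightarrow>\<^sub>L 'a" and M :: real
  assumes C0: "C0_semigroup T" and M: "1 \<le> M"
    and norm_T: "0 \<le> t \<Longrightarrow> norm (T t) \<le> M"
    and deriv_T: "0 < t \<Longrightarrow> (T has_vector_derivative - G t) (at t)"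
    and norm_G: "0 < t \<Longrightarrow> norm (G t) \<le> M / t"

lemma scaleC_scaleR: "c *\<^sub>C (r *\<^sub>R x) = r *\<^sub>R (c *\<^sub>C (x::'a::complex_banach))"
  by (simp add: scaleC_of_real[symmetric] scaleC_scaleC mult.commute)

text \<open>The standard complex-linear functional with real part \<open>l\<close>. It turns an
  analytic operator function into a scalar holomorphic one, to which Cauchy's estimate
  applies.\<close>

definition complexify :: "('a::complex_banach \<Rightarrow> real) \<Rightarrow> 'a \<Rightarrow> complex" where
  "complexify l x = Complex (l x) (- l (\<i> *\<^sub>C x))"

lemma complexify:
  fixes l :: "'a::complex_banach \<Rightarrow> real"
  assumes l: "bounded_linear l" and le: "\<And>y. \<bar>l y\<bar> \<le> norm y"
  shows "bounded_linear (complexify l)" "complexify l (c *\<^sub>C x) = c * complexify l x"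
    "cmod (complexify l x) \<le> 2 * norm x"
proof -
  interpret l: bounded_linear l by fact
  \<comment> \<open>The sharp constant is one; adding the bounds for real and imaginary part gives
    two, which is enough.\<close>
  show le2: "cmod (complexify l x) \<le> 2 * norm x" for x
    using cmod_le[of "complexify l x"] le[of x] le[of "\<i> *\<^sub>C x"]
    by (simp add: complexify_def norm_scaleC)
  show "bounded_linear (complexify l)"
    by (rule bounded_linear_intro[of _ 2])
      (use le2 in \<open>auto simp: complexify_def l.add l.scaleR scaleC_add_right scaleC_scaleR complex_eq_iff mult.commute\<close>)
  have c: "c *\<^sub>C x = Re c *\<^sub>R x + Im c *\<^sub>R (\<i> *\<^sub>C x)" for c and x :: 'a
  proof -
    have "c *\<^sub>C x = (of_real (Re c) + of_real (Im c) * \<i>) *\<^sub>C x"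
      by (metis complex_eq mult.commute)
    then show ?thesis by (simp only: scaleC_add_left scaleC_scaleC[symmetric] scaleC_of_real)
  qed
  have "l (c *\<^sub>C x) = Re c * l x + Im c * l (\<i> *\<^sub>C x)"
    by (subst c) (simp add: l.add l.scaleR)
  moreover have "l (\<i> *\<^sub>C c *\<^sub>C x) = - Im c * l x + Re c * l (\<i> *\<^sub>C x)"
    by (subst scaleC_scaleC, subst c) (simp add: l.diff l.add l.scaleR)
  ultimately show "complexify l (c *\<^sub>C x) = c * complexify l x"
    by (simp add: complexify_def complex_eq_iff)
qed

lemma cball_1_subset_sector:
  assumes "0 < \<theta>"
  obtains r where "0 < r" "cball 1 r \<subseteq> sector \<theta>"
proof -
  have "isCont (\<lambda>z. \<bar>Arg z\<bar>) 1"
    by (intro continuous_intros continuous_at_Arg) (auto simp: complex_nonpos_Reals_iff)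
  then have "((\<lambda>z. \<bar>Arg z\<bar>) \<longlongrightarrow> \<bar>Arg 1\<bar>) (nhds 1)"
    unfolding isCont_def by (rule tendsto_at_iff_tendsto_nhds[THEN iffD1])
  then have "eventually (\<lambda>z. \<bar>Arg z\<bar> < \<theta>) (nhds 1)"
    using assms by (intro order_tendstoD(2)) auto
  moreover have "eventually (\<lambda>z::complex. z \<noteq> 0) (nhds 1)"
    by (rule t1_space_nhds) simp
  ultimately have "eventually (\<lambda>z. z \<in> sector \<theta>) (nhds 1)"
    by eventually_elim (simp add: sector_def)
  then obtain r where "0 < r" "\<And>z. dist z 1 < r \<Longrightarrow> z \<in> sector \<theta>"
    by (auto simp: eventually_nhds_metric)
  then show ?thesis by (intro that[of "r / 2"]) (auto simp: dist_commute)
qed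

text \<open>Sectors are invariant under positive dilations, so the disc about 1 scales to a disc
  about \<open>t\<close> of radius proportional to \<open>t\<close>. This proportion produces the
  decay \<open>1 / t\<close> in Cauchy's estimate.\<close>

lemma cball_subset_sector:
  assumes "cball 1 r \<subseteq> sector \<theta>" "0 < t"
  shows "cball (complex_of_real t) (r * t) \<subseteq> sector \<theta>"
proof
  fix z :: complex assume "z \<in> cball (of_real t) (r * t)"
  then have "cmod (of_real t - z) \<le> r * t" by (simp add: dist_norm)
  moreover have "of_real t - z = of_real t * (1 - z / of_real t)" using assms by (simp add: field_simps)
  ultimately have "t * cmod (1 - z / of_real t) \<le> t * r"
    using assms(2) by (simp add: norm_mult mult.commute)
  then have "z / of_real t \<in> cball 1 r" using assms(2) by (simp add: dist_norm)
  then have "z / of_real t \<in> sector \<theta>" using assms(1) by blast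
  then show "z \<in> sector \<theta>" using assms(2) by (auto simp: sector_def)
qed

text \<open>Cauchy's estimate, applied to the analytic functions \<open>z \<mapsto> l (S z x)\<close>, gives
  $\|A e^{-tA}\| = O(1/t)$.\<close>

theorem bounded_analytic_semigroup_imp_analytic_semigroup:
  fixes T :: "real \<Rightarrow> 'a::complex_banach \<Rightarrow>\<^sub>L 'a"
  assumes "bounded_analytic_semigroup T"
  obtains G M where "analytic_semigroup T G M"
proof -
  obtain \<theta> and S :: "complex \<Rightarrow> 'a \<Rightarrow>\<^sub>L 'a" where C0: "C0_semigroup T" and \<theta>: "0 < \<theta>" "\<theta> \<le> pi / 2"
    and S: "analytic_operator_function S (sector \<theta>)" and ST: "\<And>t. t > 0 \<Longrightarrow> S (of_real t) = T t"
    and bd: "\<And>\<theta>'. 0 < \<theta>' \<Longrightarrow> \<theta>' < \<theta> \<Longrightarrow> bounded (S ` sector \<theta>')"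
    using assms unfolding bounded_analytic_semigroup_def by blast
  \<comment> \<open>The angle is halved because \<open>S\<close> is only known to be bounded on
    strictly smaller sectors.\<close>
  have "bounded (S ` sector (\<theta> / 2))" using bd[of "\<theta> / 2"] \<theta> by simp
  then obtain K where K: "\<And>z. z \<in> sector (\<theta> / 2) \<Longrightarrow> norm (S z) \<le> K"
    unfolding bounded_iff by blast
  obtain r where r: "0 < r" "cball 1 r \<subseteq> sector (\<theta> / 2)"
    using cball_1_subset_sector[of "\<theta> / 2"] \<theta> by auto
  have sub: "sector (\<theta> / 2) \<subseteq> sector \<theta>" using \<theta> by (auto simp: sector_def)
  have real: "complex_of_real t \<in> sector (\<theta> / 2)" if "t > 0" for t
    using that \<theta> by (auto simp: sector_def)
  have "\<exists>D. (S has_derivative D) (at z) \<and> (\<forall>h x. D h x = h *\<^sub>C D 1 x)" if "z \<in> sector \<theta>" for z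
    using S that by (auto simp: analytic_operator_function_def)
  then obtain D where D: "\<And>z. z \<in> sector \<theta> \<Longrightarrow> (S has_derivative D z) (at z)"
    "\<And>z h x. z \<in> sector \<theta> \<Longrightarrow> D z h x = h *\<^sub>C D z 1 x"
    by metis
  define G where "G t = - D (of_real t) 1" for t :: real
  \<comment> \<open>One constant for three bounds: 1 at time zero, \<open>K\<close> at positive
    times, and \<open>2 * K / r\<close> from Cauchy's estimate, the 2 being the norm bound of
    \<open>complexify\<close>.\<close>
  define M where "M = max 1 (max K (2 * K / r))"
  have "analytic_semigroup T G M"
  proof
    show "C0_semigroup T" by (rule C0)
    show "1 \<le> M" by (simp add: M_def)
    show "norm (T t) \<le> M" if "0 \<le> t" for t
    proof (cases "t = 0")
      case True
      then have "norm (T t) \<le> 1" using C0 by (auto simp: C0_semigroup_def intro: norm_blinfun_id_le)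
      then show ?thesis by (simp add: M_def)
    next
      case False
      then have "norm (T t) \<le> K" using that K[OF real[of t]] ST[of t] by simp
      then show ?thesis by (simp add: M_def)
    qed
    fix t :: real assume t: "0 < t"
    have mem: "complex_of_real t \<in> sector \<theta>" using real[OF t] sub by blast
    show "(T has_vector_derivative - G t) (at t)"
    proof -
      have "(of_real has_derivative (\<lambda>h. of_real h :: complex)) (at t)"
        by (rule bounded_linear.has_derivative[OF bounded_linear_of_real has_derivative_ident])
      from has_derivative_compose[OF this D(1)[OF mem]]
      have "((\<lambda>r. S (of_real r)) has_derivative (\<lambda>h. D (of_real t) (of_real h))) (at t)" .
      moreover have "D (of_real t) (of_real h) = h *\<^sub>R - G t" for h
        by (rule blinfun_eqI) (subst D(2)[OF mem], simp add: G_def scaleC_of_real blinfun.scaleR_left)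
      ultimately have "((\<lambda>r. S (of_real r)) has_vector_derivative - G t) (at t)"
        by (simp add: has_vector_derivative_def)
      then show ?thesis
        by (rule has_vector_derivative_transform_within_open[of _ _ _ "{0<..}"]) (use t ST in auto)
    qed
    have "norm (G t) \<le> (2 * K / r) / t"
    proof (rule norm_blinfun_bound)
      have K0: "0 \<le> K" using K[OF real[OF t]] norm_ge_zero order_trans by blast
      then show "0 \<le> (2 * K / r) / t" using r t by simp
      fix x
      have "norm (D (of_real t) 1 x) \<le> 2 * K * norm x / (r * t)"
      proof (rule norm_le_functional)
        fix l :: "'a \<Rightarrow> real" assume l: "bounded_linear l" "\<And>y. \<bar>l y\<bar> \<le> norm y"
        define f where "f z = complexify l (S z x)" for z
        note cl = complexify[OF l]
        interpret cl: bounded_linear "complexify l" by (rule cl)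
        have df: "(f has_field_derivative complexify l (D z 1 x)) (at z)" if "z \<in> sector \<theta>" for z
        proof -
          have "((\<lambda>z. S z x) has_derivative (\<lambda>h. D z h x)) (at z)"
            using bounded_linear.has_derivative[OF blinfun.bounded_linear_left D(1)[OF that]] .
          from cl.has_derivative[OF this]
          have "(f has_derivative (\<lambda>h. complexify l (D z h x))) (at z)" by (simp add: f_def[abs_def])
          moreover have "(\<lambda>h. complexify l (D z h x)) = (*) (complexify l (D z 1 x))"
            by (rule ext, subst D(2)[OF that]) (simp add: cl(2) mult.commute)
          ultimately show ?thesis by (simp add: has_field_derivative_def)
        qed
        have cb: "cball (of_real t) (r * t) \<subseteq> sector (\<theta> / 2)"
          by (rule cball_subset_sector[OF r(2) t])
        have an: "f field_differentiable (at z within cball (of_real t) (r * t))"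
          if "z \<in> cball (of_real t) (r * t)" for z
          using df[of z] cb sub that by (meson field_differentiable_at_within field_differentiable_def subsetD)
        then have hol: "f holomorphic_on cball (of_real t) (r * t)"
          by (auto simp: holomorphic_on_def)
        have "norm ((deriv ^^ 1) f (of_real t)) \<le> fact 1 * (2 * (K * norm x)) / (r * t) ^ 1"
        proof (rule Cauchy_inequality)
          show "f holomorphic_on ball (of_real t) (r * t)"
            using hol ball_subset_cball by (rule holomorphic_on_subset)
          show "continuous_on (cball (of_real t) (r * t)) f" using hol by (rule holomorphic_on_imp_continuous_on)
          show "0 < r * t" using r t by simp
          fix z :: complex assume "norm (of_real t - z) = r * t"
          then have z: "z \<in> sector (\<theta> / 2)" using cb by (auto simp: dist_norm)
          have "cmod (f z) \<le> 2 * norm (S z x)" unfolding f_def by (rule cl)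
          also have "norm (S z x) \<le> norm (S z) * norm x" by (rule norm_blinfun)
          also have "\<dots> \<le> K * norm x" using K[OF z] by (intro mult_right_mono) auto
          finally show "cmod (f z) \<le> 2 * (K * norm x)" by simp
        qed
        moreover have "deriv f (of_real t) = complexify l (D (of_real t) 1 x)"
          using df[OF mem] by (rule DERIV_imp_deriv)
        ultimately have "cmod (complexify l (D (of_real t) 1 x)) \<le> 2 * (K * norm x) / (r * t)" by simp
        moreover have "l (D (of_real t) 1 x) \<le> cmod (complexify l (D (of_real t) 1 x))"
          using complex_Re_le_cmod[of "complexify l (D (of_real t) 1 x)"] by (simp add: complexify_def)
        ultimately show "l (D (of_real t) 1 x) \<le> 2 * K * norm x / (r * t)" by simp
      qed
      then show "norm (G t x) \<le> 2 * K / r / t * norm x"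
        by (simp add: G_def blinfun.minus_left field_simps)
    qed
    also have "\<dots> \<le> M / t" using t by (intro divide_right_mono) (auto simp: M_def)
    finally show "norm (G t) \<le> M / t" .
  qed
  then show ?thesis by (rule that)
qed

context analytic_semigroup
begin

abbreviation A where "A \<equiv> neg_generator T"

lemma T_add: "0 \<le> s \<Longrightarrow> 0 \<le> t \<Longrightarrow> T (s + t) x = T s (T t x)"
  using C0 by (rule C0_semigroup_add)

lemma T_zero: "T 0 x = x"
  using C0 by (rule C0_semigroup_zero)

lemma T_continuous: "continuous_on {0..} (\<lambda>t. T t x)"
  using C0 by (rule C0_semigroup_continuous)

lemma norm_T_le: "0 \<le> t \<Longrightarrow> norm (T t x) \<le> M * norm x"
  using norm_blinfun[of "T t" x] norm_T[of t] by (meson mult_right_mono norm_ge_zero order_trans)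

lemma norm_G_le: "0 < t \<Longrightarrow> norm (G t x) \<le> M / t * norm x"
  using norm_blinfun[of "G t" x] norm_G[of t] by (meson mult_right_mono norm_ge_zero order_trans)

lemma deriv_Tx: "0 < t \<Longrightarrow> ((\<lambda>t. T t x) has_vector_derivative - G t x) (at t)"
  using bounded_linear.has_vector_derivative[OF blinfun.bounded_linear_left deriv_T, of t x]
  by (simp add: blinfun.minus_left)

text \<open>The right difference quotient of the orbit at time \<open>t\<close> is the quotient that
  defines the generator at \<open>T t x\<close>. Hence orbits enter the domain immediately.\<close>

lemma G_generator:
  assumes t: "0 < t"
  shows "(T t x, G t x) \<in> A"
proof -
  have "((\<lambda>r. (T r x - T t x) /\<^sub>R (r - t)) \<longlongrightarrow> - G t x) (at t)"
    using deriv_Tx[OF t] by (simp add: has_vector_derivative_iff_quotient)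
  then have "((\<lambda>r. (T r x - T t x) /\<^sub>R (r - t)) \<longlongrightarrow> - G t x) (at_right t)"
    by (rule tendsto_mono[OF at_le, rotated]) simp
  then have "((\<lambda>h. (T (h + t) x - T t x) /\<^sub>R h) \<longlongrightarrow> - G t x) (at_right 0)"
    by (subst (asm) filterlim_at_right_to_0) simp
  from tendsto_minus[OF this]
  have "((\<lambda>h. - ((T (h + t) x - T t x) /\<^sub>R h)) \<longlongrightarrow> G t x) (at_right 0)"
    by simp
  then have "((\<lambda>h. (T t x - T h (T t x)) /\<^sub>R h) \<longlongrightarrow> G t x) (at_right 0)"
  proof (rule Lim_transform_eventually)
    show "eventually (\<lambda>h. - ((T (h + t) x - T t x) /\<^sub>R h) = (T t x - T h (T t x)) /\<^sub>R h) (at_right 0)"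
      using t by (auto simp: eventually_at T_add intro!: exI[of _ 1] simp flip: scaleR_minus_right)
  qed
  then show ?thesis by (simp add: neg_generator_def)
qed

lemma G_eq:
  assumes "(x, z) \<in> A" "0 < t"
  shows "G t x = T t z"
  using neg_generator_unique[OF G_generator[OF assms(2), of x]]
    neg_generator_semigroup[OF C0 assms(1), of t] assms(2) by simp

lemma G_add:
  assumes "0 \<le> s" "0 < t"
  shows "G (s + t) x = T s (G t x)" "G (s + t) x = G t (T s x)"
proof -
  have "(T (s + t) x, G (s + t) x) \<in> A" using assms by (intro G_generator) simp
  moreover have "(T (s + t) x, T s (G t x)) \<in> A"
    using neg_generator_semigroup[OF C0 G_generator[OF assms(2), of x] assms(1)] assms
    by (simp add: T_add)
  moreover have "(T (s + t) x, G t (T s x)) \<in> A"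
    using G_generator[OF assms(2), of "T s x"] T_add[of t s x] assms by (simp add: add.commute)
  ultimately show "G (s + t) x = T s (G t x)" "G (s + t) x = G t (T s x)"
    by (auto intro: neg_generator_unique)
qed

text \<open>The derivative is A^2 exp(-tA) x, written as two half-time factors so that
  \<open>norm_G\<close> applies twice. Since \<open>G r x = T (r - t / 2) (G (t / 2) x)\<close> near
  \<open>t\<close>, only the derivative of \<open>T\<close> is needed.\<close>

lemma deriv_Gx:
  assumes t: "0 < t"
  shows "((\<lambda>r. G r x) has_vector_derivative - G (t / 2) (G (t / 2) x)) (at t)"
proof -
  have 1: "((\<lambda>r. r - t / 2) has_vector_derivative 1) (at t)" by (auto intro!: derivative_eq_intros)
  have "((\<lambda>v. T v (G (t / 2) x)) has_vector_derivative - G (t / 2) (G (t / 2) x)) (at (t - t / 2))"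
    using deriv_Tx[of "t / 2" "G (t / 2) x"] t by simp
  from vector_diff_chain_at[OF 1 this]
  have "((\<lambda>r. T (r - t / 2) (G (t / 2) x)) has_vector_derivative - G (t / 2) (G (t / 2) x)) (at t)"
    by (simp add: o_def)
  then show ?thesis
  proof (rule has_vector_derivative_transform_within_open[of _ _ _ "{t / 2<..}"])
    fix r assume "r \<in> {t / 2<..}"
    then show "T (r - t / 2) (G (t / 2) x) = G r x"
      using G_add(1)[of "r - t / 2" "t / 2" x] t by simp
  qed (use t in auto)
qed

lemma G_continuous: "continuous_on {0<..} (\<lambda>t. G t x)"
  by (intro continuous_at_imp_continuous_on ballI)
    (use deriv_Gx in \<open>auto intro: has_vector_derivative_continuous\<close>)

text \<open>By smoothing, \<open>T t x\<close> lies in the domain for every \<open>t > 0\<close>,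
  and it tends to \<open>x\<close>.\<close>

lemma dense: "closure (Domain A) = UNIV"
proof -
  have "x \<in> closure (Domain A)" for x
  proof (rule Lim_in_closed_set)
    show "((\<lambda>t. T t x) \<longlongrightarrow> x) (at_right 0)" using C0 by (simp add: C0_semigroup_def)
    have "T t x \<in> closure (Domain A)" if "t > 0" for t
      using G_generator[OF that, of x] closure_subset[of "Domain A"] by auto
    then show "eventually (\<lambda>t. T t x \<in> closure (Domain A)) (at_right 0)"
      by (auto simp: eventually_at intro!: exI[of _ 1])
  qed auto
  then show ?thesis by blast
qed

end

section \<open>Integrals over the half-line\<close>

abbreviation half_line :: "real measure" where
  "half_line \<equiv> restrict_space lborel {0<..}"

lemma sets_half_line: "sets half_line = sets (restrict_space borel {0<..})"
  by (simp add: sets_restrict_space)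

lemma space_half_line [simp]: "space half_line = {0<..}"
  by (simp add: space_restrict_space)

lemma half_line_UN: "{0<..} = (\<Union>n. {1 / real (Suc n)..real (Suc n)})" (is "_ = ?R")
proof (intro set_eqI iffI)
  fix x :: real assume "x \<in> {0<..}"
  then have "0 < min x (1 / x)" by simp
  then obtain n where n: "1 / real (Suc n) < min x (1 / x)" using nat_approx_posE by metis
  then have "1 / real (Suc n) < 1 / x" by simp
  then have "x \<le> real (Suc n)" using \<open>x \<in> {0<..}\<close> by (simp add: field_simps)
  then show "x \<in> ?R" using n by (auto intro!: exI[of _ n])
next
  fix x :: real assume "x \<in> ?R"
  then obtain n where "1 / real (Suc n) \<le> x" by auto
  then show "x \<in> {0<..}" by (smt (verit) greaterThan_iff of_nat_0_less_iff zero_less_Suc zero_less_divide_1_iff)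
qed

lemma borel_measurable_half_line:
  "continuous_on {0<..} f \<Longrightarrow> f \<in> borel_measurable half_line"
  using borel_measurable_continuous_on_restrict[of "{0<..}" f] measurable_cong_sets[OF sets_half_line refl] by blast

lemma has_Bochner_integral_half_line_exists:
  fixes f :: "real \<Rightarrow> 'a::banach"
  assumes "continuous_on {0<..} f" "(\<integral>\<^sup>+x. norm (f x) \<partial>half_line) < \<infinity>"
  shows "\<exists>y. has_Bochner_integral half_line f y"
proof (rule has_Bochner_integral_exists[OF sets_half_line half_line_UN _ _ assms])
  show "incseq (\<lambda>n. {1 / real (Suc n)..real (Suc n)})"
  proof (intro monoI)
    fix m n :: nat assume "m \<le> n"
    then have "1 / real (Suc n) \<le> 1 / real (Suc m)" "real (Suc m) \<le> real (Suc n)"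
      by (auto intro: divide_left_mono)
    then show "{1 / real (Suc m)..real (Suc m)} \<subseteq> {1 / real (Suc n)..real (Suc n)}"
      unfolding atLeastatMost_subset_iff by blast
  qed
  fix n
  have "emeasure half_line {1 / real (Suc n)..real (Suc n)} = emeasure lborel {1 / real (Suc n)..real (Suc n)}"
  proof (rule emeasure_restrict_space)
    have "0 < 1 / real (Suc n)" by simp
    then show "{1 / real (Suc n)..real (Suc n)} \<subseteq> {0<..}"
      by (intro subsetI) (simp only: atLeastAtMost_iff greaterThan_iff less_le_trans)
  qed simp
  also have "\<dots> < \<infinity>" by (rule emeasure_lborel_cbox_finite[of "1 / real (Suc n)" "real (Suc n)", unfolded cbox_interval])
  finally show "emeasure half_line {1 / real (Suc n)..real (Suc n)} < \<infinity>" .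
qed

lemma nn_integral_half_line:
  assumes nonneg: "\<And>x. 0 < x \<Longrightarrow> 0 \<le> f x" and I: "(f has_integral I) {0..}"
  shows "(\<integral>\<^sup>+x. ennreal (f x) \<partial>half_line) = ennreal I"
proof -
  have "(f has_integral I) {0<..}"
  proof (rule has_integral_spike_set_eq[THEN iffD1, OF _ _ I])
    show "negligible {x \<in> {0..} - {0<..}. f x \<noteq> 0}"
      by (rule negligible_subset[of "{0::real}"]) auto
    have "{x \<in> {0<..} - {0..}. f x \<noteq> 0} = {}" by auto
    then show "negligible {x \<in> {0<..} - {0..}. f x \<noteq> 0}" by (simp only: negligible_empty)
  qed
  then have "(\<integral>\<^sup>+x. ennreal (f x) * indicator {0<..} x \<partial>lborel) = ennreal I"
    by (intro nn_integral_has_integral_lebesgue') (use nonneg in auto)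
  then show ?thesis by (simp add: nn_integral_restrict_space)
qed

lemma nn_integral_exp_half_line:
  assumes "0 < r"
  shows "(\<integral>\<^sup>+v. ennreal (exp (- r * v)) \<partial>half_line) = ennreal (1 / r)"
  using nn_integral_half_line[OF _ has_integral_exp_minus_to_infinity[OF assms, of 0]] by simp

text \<open>The majorant behind the integrability of the power-weighted functions below. It is
  integrable at zero because \<open>0 < \<alpha>\<close> and at infinity because
  \<open>\<alpha> < 1\<close>.\<close>

lemma has_integral_powr_min:
  fixes c C D \<alpha> :: real
  assumes "0 < \<alpha>" "\<alpha> < 1" "0 < c"
  shows "((\<lambda>u. if u \<le> c then C * u powr (\<alpha> - 1) else D * u powr (\<alpha> - 2)) has_integral
    C * (c powr \<alpha> / \<alpha>) + D * (c powr (\<alpha> - 1) / (1 - \<alpha>))) {0..}"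
proof -
  have 1: "((\<lambda>u. C * u powr (\<alpha> - 1)) has_integral C * (c powr \<alpha> / \<alpha>)) {0..c}"
    using has_integral_mult_right[OF has_integral_powr_from_0[of "\<alpha> - 1" c], of C] assms by simp
  have 2: "((\<lambda>u. D * u powr (\<alpha> - 2)) has_integral D * (c powr (\<alpha> - 1) / (1 - \<alpha>))) {c..}"
  proof -
    have "- (c powr (\<alpha> - 2 + 1)) / (\<alpha> - 2 + 1) = c powr (\<alpha> - 1) / (1 - \<alpha>)"
      using assms by (simp add: field_simps)
    then show ?thesis
      using has_integral_mult_right[OF has_integral_powr_to_inf[of "\<alpha> - 2" c], of D] assms by simp
  qed
  let ?f = "\<lambda>u. if u \<le> c then C * u powr (\<alpha> - 1) else D * u powr (\<alpha> - 2)"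
  have "(?f has_integral C * (c powr \<alpha> / \<alpha>)) {0..c}"
    by (rule has_integral_eq[OF _ 1]) auto
  moreover have "(?f has_integral D * (c powr (\<alpha> - 1) / (1 - \<alpha>))) {c..}"
    by (rule has_integral_spike[OF _ _ 2, of "{c}"]) auto
  ultimately have "(?f has_integral C * (c powr \<alpha> / \<alpha>) + D * (c powr (\<alpha> - 1) / (1 - \<alpha>))) ({0..c} \<union> {c..})"
  proof (rule has_integral_Un)
    show "negligible ({0..c} \<inter> {c..})" by (rule negligible_subset[of "{c}"]) auto
  qed
  moreover have "{0..c} \<union> {c..} = {0..}" using assms by auto
  ultimately show ?thesis by simp
qed

lemma nn_integral_powr_min:
  assumes "0 < \<alpha>" "\<alpha> < 1" "0 < c" "0 \<le> C" "0 \<le> D"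
  shows "(\<integral>\<^sup>+u. ennreal (if u \<le> c then C * u powr (\<alpha> - 1) else D * u powr (\<alpha> - 2)) \<partial>half_line) =
    ennreal (C * (c powr \<alpha> / \<alpha>) + D * (c powr (\<alpha> - 1) / (1 - \<alpha>)))"
  by (rule nn_integral_half_line[OF _ has_integral_powr_min[OF assms(1-3)]]) (use assms in auto)

section \<open>The resolvent\<close>

lemma neg_generator_diff:
  assumes "(x, y) \<in> neg_generator T" "(x', y') \<in> neg_generator T"
  shows "(x - x', y - y') \<in> neg_generator T"
  using tendsto_diff[OF assms[unfolded neg_generator_def, simplified]]
  by (simp add: neg_generator_def blinfun.diff_right algebra_simps)

lemma neg_generator_scaleR:
  assumes "(x, y) \<in> neg_generator T"
  shows "(c *\<^sub>R x, c *\<^sub>R y) \<in> neg_generator T"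
  using tendsto_scaleR[OF tendsto_const[of c] assms[unfolded neg_generator_def, simplified]]
  by (simp add: neg_generator_def blinfun.scaleR_right algebra_simps)

context analytic_semigroup
begin

lemma exp_T_integrable:
  assumes r: "0 < r"
  shows "(\<integral>\<^sup>+v. norm (exp (- r * v) *\<^sub>R T v z) \<partial>half_line) \<le> ennreal (M * norm z / r)"
proof -
  have "(\<integral>\<^sup>+v. norm (exp (- r * v) *\<^sub>R T v z) \<partial>half_line)
      \<le> (\<integral>\<^sup>+v. ennreal (M * norm z) * ennreal (exp (- r * v)) \<partial>half_line)"
    using norm_T_le[of _ z] M
    by (intro nn_integral_mono)
      (auto simp: ennreal_mult[symmetric] mult.commute intro!: ennreal_leI mult_left_mono)
  also have "\<dots> = ennreal (M * norm z) * ennreal (1 / r)"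
    by (subst nn_integral_cmult)
      (auto simp: nn_integral_exp_half_line[OF r, simplified] intro!: borel_measurable_half_line continuous_intros)
  also have "\<dots> = ennreal (M * norm z / r)" using r M by (simp add: ennreal_mult[symmetric])
  finally show ?thesis .
qed

lemma T_continuous_pos: "continuous_on {0<..} (\<lambda>t. T t x)"
  by (rule continuous_on_subset[OF T_continuous]) auto

lemma exp_T_has_Bochner_integral:
  assumes r: "0 < r"
  obtains x where "has_Bochner_integral half_line (\<lambda>v. exp (- r * v) *\<^sub>R T v z) x"
proof -
  have "(\<integral>\<^sup>+v. norm (exp (- r * v) *\<^sub>R T v z) \<partial>half_line) < \<infinity>"
    by (rule le_less_trans[OF exp_T_integrable[OF r]]) simp
  then have "\<exists>x. has_Bochner_integral half_line (\<lambda>v. exp (- r * v) *\<^sub>R T v z) x"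
    by (intro has_Bochner_integral_half_line_exists continuous_intros T_continuous_pos)
  then show ?thesis using that by blast
qed

text \<open>By the semigroup law, \<open>T h x\<close> is \<open>exp (r * h)\<close> times the part
  of the Laplace integral over times beyond \<open>h\<close>, that is, \<open>x\<close> minus the
  part over \<open>{0..h}\<close>.\<close>

lemma exp_T_shift:
  assumes r: "0 < r" and h: "0 < h"
    and x: "has_Bochner_integral half_line (\<lambda>v. exp (- r * v) *\<^sub>R T v z) x"
  shows "x - T h x = (1 - exp (r * h)) *\<^sub>R x + exp (r * h) *\<^sub>R integral {0..h} (\<lambda>v. exp (- r * v) *\<^sub>R T v z)"
proof (rule eq_functional)
  fix l :: "'a \<Rightarrow> real" assume l: "bounded_linear l"
  interpret l: bounded_linear l by fact
  define f where "f v = exp (- r * v) * l (T v z)" for v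
  have cont: "continuous_on {0..} f"
    unfolding f_def by (intro continuous_intros l.continuous_on T_continuous)
  have ix: "has_bochner_integral lborel (\<lambda>v. indicator {0<..} v *\<^sub>R f v) (l x)"
    using has_Bochner_integral_functional[OF x l]
    by (simp add: has_bochner_integral_restrict_space f_def l.scaleR)
  have "bounded_linear (\<lambda>x. l (T h x))"
    by (rule bounded_linear_compose[OF l blinfun.bounded_linear_right])
  from has_Bochner_integral_functional[OF x this]
  have "has_bochner_integral lborel (\<lambda>v. indicator {0<..} v *\<^sub>R (exp (- r * v) * l (T h (T v z)))) (l (T h x))"
    by (simp add: has_bochner_integral_restrict_space l.scaleR blinfun.scaleR_right)
  moreover have "indicator {0<..} v *\<^sub>R (exp (- r * v) * l (T h (T v z))) =
      exp (r * h) * (indicator {h<..} (h + 1 * v) *\<^sub>R f (h + 1 * v))" for v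
  proof (cases "0 < v")
    case True
    have "exp (r * h) * exp (- r * (h + v)) = exp (- r * v)"
      unfolding exp_add[symmetric] by (simp add: algebra_simps)
    then show ?thesis
      using True h T_add[of h v z] by (simp add: f_def flip: mult.assoc)
  qed simp
  ultimately have iT: "has_bochner_integral lborel (\<lambda>v. exp (r * h) * (indicator {h<..} (h + 1 * v) *\<^sub>R f (h + 1 * v))) (l (T h x))"
    by (simp only:)
  have ish: "has_bochner_integral lborel (\<lambda>v. indicator {h<..} v *\<^sub>R f v) (exp (- (r * h)) * l (T h x))"
  proof (subst lborel_has_bochner_integral_real_affine_iff[of 1 _ _ h])
    have "has_bochner_integral lborel (\<lambda>v. exp (- (r * h)) * (exp (r * h) * (indicator {h<..} (h + 1 * v) *\<^sub>R f (h + 1 * v))))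
      (exp (- (r * h)) * l (T h x))"
      by (rule has_bochner_integral_mult_right) (rule iT)
    moreover have "exp (- (r * h)) * (exp (r * h) * u) = u" for u :: real
      unfolding mult.assoc[symmetric] exp_add[symmetric] by simp
    ultimately show "has_bochner_integral lborel (\<lambda>v. indicator {h<..} (h + 1 * v) *\<^sub>R f (h + 1 * v))
      (exp (- (r * h)) * l (T h x) /\<^sub>R \<bar>1\<bar>)"
      by simp
  qed simp
  have "has_bochner_integral lborel (\<lambda>v. indicator {0<..} v *\<^sub>R f v - indicator {h<..} v *\<^sub>R f v)
      (l x - exp (- (r * h)) * l (T h x))"
    by (rule has_bochner_integral_diff[OF ix ish])
  moreover have "indicator {0<..} v *\<^sub>R f v - indicator {h<..} v *\<^sub>R f v = indicator {0<..h} v *\<^sub>R f v" for v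
    using h by (auto simp: indicator_def)
  ultimately have hb: "has_bochner_integral lborel (\<lambda>v. indicator {0<..h} v *\<^sub>R f v) (l x - exp (- (r * h)) * l (T h x))"
    by simp
  then have "(LINT v:{0<..h}|lborel. f v) = l x - exp (- (r * h)) * l (T h x)"
    unfolding set_lebesgue_integral_def by (rule has_bochner_integral_integral_eq)
  moreover have "set_integrable lborel {0<..h} f"
    using hb unfolding set_integrable_def by (rule integrable.intros)
  ultimately have "integral {0<..h} f = l x - exp (- (r * h)) * l (T h x)"
    using set_borel_integral_eq_integral(2) by metis
  moreover have "integral {0<..h} f = integral {0..h} f"
  proof (rule integral_spike_set)
    show "negligible {x \<in> {0..h} - {0<..h}. f x \<noteq> 0}"
      by (rule negligible_subset[of "{0::real}"]) auto
    have "{x \<in> {0<..h} - {0..h}. f x \<noteq> 0} = {}" by auto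
    then show "negligible {x \<in> {0<..h} - {0..h}. f x \<noteq> 0}" by (simp only: negligible_empty)
  qed
  moreover have "integral {0..h} f = l (integral {0..h} (\<lambda>v. exp (- r * v) *\<^sub>R T v z))"
  proof -
    have "(\<lambda>v. exp (- r * v) *\<^sub>R T v z) integrable_on {0..h}"
      by (intro integrable_continuous_real continuous_intros continuous_on_subset[OF T_continuous]) auto
    from integral_linear[OF this l] show ?thesis by (simp add: f_def[abs_def] o_def l.scaleR)
  qed
  ultimately have "l (integral {0..h} (\<lambda>v. exp (- r * v) *\<^sub>R T v z)) = l x - exp (- (r * h)) * l (T h x)"
    by simp
  then have "exp (r * h) * l (integral {0..h} (\<lambda>v. exp (- r * v) *\<^sub>R T v z))
      = exp (r * h) * l x - exp (r * h) * exp (- (r * h)) * l (T h x)"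
    by (simp only: right_diff_distrib mult.assoc)
  also have "exp (r * h) * exp (- (r * h)) = 1" unfolding exp_add[symmetric] by simp
  finally show "l (x - T h x) = l ((1 - exp (r * h)) *\<^sub>R x + exp (r * h) *\<^sub>R integral {0..h} (\<lambda>v. exp (- r * v) *\<^sub>R T v z))"
    by (simp add: l.add l.diff l.scaleR left_diff_distrib)
qed

text \<open>Divide the shift formula by \<open>h\<close>: the coefficient of \<open>x\<close> tends
  to \<open>- r\<close>, and the mean of the integrand over \<open>{0..h}\<close> tends to
  \<open>z\<close>. So the Laplace transform of the orbit solves the resolvent equation.\<close>

lemma exp_T_generator:
  assumes r: "0 < r" and x: "has_Bochner_integral half_line (\<lambda>v. exp (- r * v) *\<^sub>R T v z) x"
  shows "(x, z - r *\<^sub>R x) \<in> A"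
proof -
  let ?P = "\<lambda>h. integral {0..h} (\<lambda>v. exp (- r * v) *\<^sub>R T v z)"
  have "continuous_on {0..1} (\<lambda>v. exp (- r * v) *\<^sub>R T v z)"
    by (intro continuous_intros continuous_on_subset[OF T_continuous]) auto
  from integral_has_vector_derivative[OF this, of 0]
  have "((\<lambda>h. ?P h /\<^sub>R h) \<longlongrightarrow> z) (at 0 within {0..1})"
    by (simp add: has_vector_derivative_iff_quotient T_zero)
  then have P: "((\<lambda>h. ?P h /\<^sub>R h) \<longlongrightarrow> z) (at_right 0)"
    by (simp add: at_within_Icc_at_right)
  have "((\<lambda>h. exp (r * h)) has_vector_derivative r) (at 0)"
    by (auto intro!: derivative_eq_intros simp flip: has_real_derivative_iff_has_vector_derivative)
  then have "((\<lambda>h. (exp (r * h) - 1) /\<^sub>R h) \<longlongrightarrow> r) (at 0)"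
    by (simp add: has_vector_derivative_iff_quotient)
  then have "((\<lambda>h. (exp (r * h) - 1) /\<^sub>R h) \<longlongrightarrow> r) (at_right 0)"
    by (rule tendsto_mono[OF at_le, rotated]) simp
  then have "((\<lambda>h. - (((exp (r * h) - 1) /\<^sub>R h) *\<^sub>R x) + exp (r * h) *\<^sub>R (?P h /\<^sub>R h)) \<longlongrightarrow>
      - (r *\<^sub>R x) + exp (r * 0) *\<^sub>R z) (at_right 0)"
    by (intro tendsto_intros P)
  then have "((\<lambda>h. (x - T h x) /\<^sub>R h) \<longlongrightarrow> - (r *\<^sub>R x) + exp (r * 0) *\<^sub>R z) (at_right 0)"
  proof (rule Lim_transform_eventually)
    have "- (((exp (r * h) - 1) /\<^sub>R h) *\<^sub>R x) + exp (r * h) *\<^sub>R (?P h /\<^sub>R h) = (x - T h x) /\<^sub>R h"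
      if "h > 0" for h
      unfolding exp_T_shift[OF r that x]
      by (simp add: algebra_simps)
    then show "eventually (\<lambda>h. - (((exp (r * h) - 1) /\<^sub>R h) *\<^sub>R x) + exp (r * h) *\<^sub>R (?P h /\<^sub>R h) = (x - T h x) /\<^sub>R h) (at_right 0)"
      by (auto simp: eventually_at intro!: exI[of _ 1])
  qed
  then show ?thesis by (simp add: neg_generator_def)
qed

text \<open>Injectivity of r + A. Along such an \<open>x\<close> the vector
  \<open>exp (- r * t) *\<^sub>R T t x\<close> is constant in \<open>t\<close>, while boundedness of
  the semigroup forces it to zero.\<close>

lemma generator_eigenvector:
  assumes r: "0 < r" and x: "(x, - (r *\<^sub>R x)) \<in> A"
  shows "x = 0"
proof -
  have "((\<lambda>t. exp (- r * t) *\<^sub>R T t x) has_vector_derivative 0) (at t within {0..})" if "t \<in> {0..}" for t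
  proof -
    have "((\<lambda>t. T t x) has_vector_derivative - T t (- (r *\<^sub>R x))) (at t within {0..})"
      by (rule C0_semigroup_has_derivative[OF C0 x]) (use that in simp)
    moreover have "((\<lambda>t. exp (- r * t)) has_field_derivative exp (- r * t) * (- r)) (at t within {0..})"
      by (auto intro!: derivative_eq_intros)
    ultimately have "((\<lambda>t. exp (- r * t) *\<^sub>R T t x) has_vector_derivative
        exp (- r * t) *\<^sub>R - T t (- (r *\<^sub>R x)) + (exp (- r * t) * (- r)) *\<^sub>R T t x) (at t within {0..})"
      by (rule has_vector_derivative_scaleR[rotated])
    then show ?thesis by (simp add: blinfun.minus_right blinfun.scaleR_right)
  qed
  then obtain c where c: "\<And>t. t \<in> {0..} \<Longrightarrow> exp (- r * t) *\<^sub>R T t x = c"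
    by (rule has_vector_derivative_zero_constant[of "{0..}" "\<lambda>t. exp (- r * t) *\<^sub>R T t x", rotated]) auto
  have "c = x" using c[of 0] by (simp add: T_zero)
  have "norm x \<le> exp (- r * t) * (M * norm x)" if "t \<ge> 0" for t
  proof -
    have "norm x = exp (- r * t) * norm (T t x)"
      using arg_cong[OF c[of t], of norm] \<open>c = x\<close> that by simp
    also have "\<dots> \<le> exp (- r * t) * (M * norm x)" using norm_T_le[OF that] by (intro mult_left_mono) auto
    finally show ?thesis .
  qed
  then have ev: "eventually (\<lambda>t. norm x \<le> exp (- r * t) * (M * norm x)) at_top"
    by (intro eventually_mono[OF eventually_ge_at_top[of 0]])
  have "((\<lambda>t. exp (- r * t) * (M * norm x)) \<longlongrightarrow> 0 * (M * norm x)) at_top"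
  proof (intro tendsto_mult tendsto_const)
    have "filterlim (\<lambda>t. r * t) at_top at_top"
      by (rule filterlim_tendsto_pos_mult_at_top[OF tendsto_const r filterlim_ident])
    then have "filterlim (\<lambda>t. - r * t) at_bot at_top" by (simp add: filterlim_uminus_at_bot)
    then show "((\<lambda>t. exp (- r * t)) \<longlongrightarrow> 0) at_top" by (rule filterlim_compose[OF exp_at_bot])
  qed
  from tendsto_lowerbound[OF this ev] show ?thesis by simp
qed

lemma resolvent_at_unique:
  assumes r: "0 < r" and x: "(x, z - r *\<^sub>R x) \<in> A"
  shows "resolvent_at A r z = x"
  unfolding resolvent_at_def
proof (rule the_equality)
  fix x' assume "(x', z - r *\<^sub>R x') \<in> A"
  from neg_generator_diff[OF this x] have "(x' - x, - (r *\<^sub>R (x' - x))) \<in> A"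
    by (simp add: algebra_simps)
  from generator_eigenvector[OF r this] show "x' = x" by simp
qed (rule x)

lemma resolvent_at_has_Bochner_integral:
  assumes r: "0 < r"
  shows "has_Bochner_integral half_line (\<lambda>v. exp (- r * v) *\<^sub>R T v z) (resolvent_at A r z)"
proof -
  obtain x where x: "has_Bochner_integral half_line (\<lambda>v. exp (- r * v) *\<^sub>R T v z) x"
    using exp_T_has_Bochner_integral[OF r] by blast
  then show ?thesis using resolvent_at_unique[OF r exp_T_generator[OF r x]] by simp
qed

lemma resolvent_at_mem: "0 < r \<Longrightarrow> (resolvent_at A r z, z - r *\<^sub>R resolvent_at A r z) \<in> A"
  using exp_T_generator resolvent_at_has_Bochner_integral by blast

lemma norm_resolvent_at:
  assumes r: "0 < r"
  shows "norm (resolvent_at A r z) \<le> M * norm z / r"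
proof (rule norm_le_functional)
  fix l :: "'a \<Rightarrow> real" assume l: "bounded_linear l" "\<And>y. \<bar>l y\<bar> \<le> norm y"
  let ?f = "\<lambda>v. l (exp (- r * v) *\<^sub>R T v z)"
  have hb: "has_bochner_integral half_line ?f (l (resolvent_at A r z))"
    by (rule has_Bochner_integral_functional[OF resolvent_at_has_Bochner_integral[OF r] l(1)])
  have "ennreal (norm (l (resolvent_at A r z))) \<le> (\<integral>\<^sup>+v. norm (?f v) \<partial>half_line)"
    using has_bochner_integral_implies_finite_norm integral_norm_bound_ennreal hb
    by (metis has_bochner_integral_iff)
  also have "\<dots> \<le> (\<integral>\<^sup>+v. norm (exp (- r * v) *\<^sub>R T v z) \<partial>half_line)"
    using l(2) by (intro nn_integral_mono ennreal_leI) (simp only: real_norm_def)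
  also have "\<dots> \<le> ennreal (M * norm z / r)" by (rule exp_T_integrable[OF r])
  finally have "norm (l (resolvent_at A r z)) \<le> M * norm z / r"
    using r M by (subst (asm) ennreal_le_iff) auto
  then show "l (resolvent_at A r z) \<le> M * norm z / r" by simp
qed

text \<open>The resolvent identity: the difference is the resolvent at \<open>q\<close> applied to
  \<open>(q - r)\<close> times the resolvent at \<open>r\<close>. It provides the continuity in
  \<open>r\<close> under which the Balakrishnan integral exists.\<close>

lemma resolvent_at_diff:
  assumes "0 < r" "0 < q"
  shows "norm (resolvent_at A r z - resolvent_at A q z) \<le> (M / q) * (\<bar>q - r\<bar> * (M * norm z / r))"
proof -
  let ?x = "resolvent_at A r z" and ?y = "resolvent_at A q z"
  have "(?x - ?y, (z - r *\<^sub>R ?x) - (z - q *\<^sub>R ?y)) \<in> A"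
    by (intro neg_generator_diff resolvent_at_mem assms)
  moreover have "(z - r *\<^sub>R ?x) - (z - q *\<^sub>R ?y) = (q - r) *\<^sub>R ?x - q *\<^sub>R (?x - ?y)"
    by (simp add: algebra_simps)
  ultimately have "?x - ?y = resolvent_at A q ((q - r) *\<^sub>R ?x)"
    using resolvent_at_unique[OF assms(2), of "?x - ?y" "(q - r) *\<^sub>R ?x"] by simp
  also have "norm \<dots> \<le> M * norm ((q - r) *\<^sub>R ?x) / q" by (rule norm_resolvent_at[OF assms(2)])
  also have "\<dots> = (M / q) * (\<bar>q - r\<bar> * norm ?x)" by simp
  also have "\<dots> \<le> (M / q) * (\<bar>q - r\<bar> * (M * norm z / r))"
    using norm_resolvent_at[OF assms(1), of z] M assms by (intro mult_left_mono) auto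
  finally show ?thesis .
qed

lemma resolvent_at_continuous: "continuous_on {0<..} (\<lambda>r. resolvent_at A r z)"
  unfolding continuous_on_def
proof
  fix q :: real assume q: "q \<in> {0<..}"
  have "((\<lambda>r. resolvent_at A r z - resolvent_at A q z) \<longlongrightarrow> 0) (at q within {0<..})"
  proof (rule Lim_null_comparison)
    show "eventually (\<lambda>r. norm (resolvent_at A r z - resolvent_at A q z) \<le> (M / q) * (\<bar>q - r\<bar> * (M * norm z / r))) (at q within {0<..})"
      using resolvent_at_diff q by (auto simp: eventually_at intro!: exI[of _ 1])
    have "((\<lambda>r. (M / q) * (\<bar>q - r\<bar> * (M * norm z / r))) \<longlongrightarrow> (M / q) * (\<bar>q - q\<bar> * (M * norm z / q))) (at q within {0<..})"
      using q by (intro tendsto_intros) auto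
    then show "((\<lambda>r. (M / q) * (\<bar>q - r\<bar> * (M * norm z / r))) \<longlongrightarrow> 0) (at q within {0<..})" by simp
  qed
  then show "((\<lambda>r. resolvent_at A r z) \<longlongrightarrow> resolvent_at A q z) (at q within {0<..})"
    by (simp add: LIM_zero_iff)
qed

text \<open>On the range of A the resolvent does not blow up as \<open>r\<close> tends to zero,
  because (r + A)^(-1) A x = x - r (r + A)^(-1) x.\<close>

lemma norm_resolvent_at_range:
  assumes r: "0 < r" and xz: "(x, z) \<in> A"
  shows "norm (resolvent_at A r z) \<le> (1 + M) * norm x"
proof -
  let ?y = "resolvent_at A r x"
  have "(x - r *\<^sub>R ?y, z - r *\<^sub>R (x - r *\<^sub>R ?y)) \<in> A"
    by (rule neg_generator_diff[OF xz neg_generator_scaleR[OF resolvent_at_mem[OF r]]])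
  then have "resolvent_at A r z = x - r *\<^sub>R ?y" by (rule resolvent_at_unique[OF r])
  then have "norm (resolvent_at A r z) \<le> norm x + r * norm ?y"
    using norm_triangle_ineq4[of x "r *\<^sub>R ?y"] r by simp
  also have "r * norm ?y \<le> r * (M * norm x / r)"
    using norm_resolvent_at[OF r, of x] r by (intro mult_left_mono) auto
  also have "\<dots> = M * norm x" using r by simp
  finally show ?thesis by (simp add: algebra_simps)
qed

text \<open>Near zero the bound for vectors in the range of A leaves the integrable weight
  r^(\<alpha> - 1); beyond 1 the resolvent decays like 1 / r and leaves r^(\<alpha> - 2).\<close>

lemma balakrishnan_integral:
  assumes \<alpha>: "0 < \<alpha>" "\<alpha> < 1" and xz: "(x, z) \<in> A"
  obtains w where "has_Bochner_integral half_line (\<lambda>r. r powr (\<alpha> - 1) *\<^sub>R resolvent_at A r z) w"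
proof -
  let ?g = "\<lambda>r. if r \<le> 1 then (1 + M) * norm x * r powr (\<alpha> - 1) else M * norm z * r powr (\<alpha> - 2)"
  have "(\<integral>\<^sup>+r. norm (r powr (\<alpha> - 1) *\<^sub>R resolvent_at A r z) \<partial>half_line) \<le> (\<integral>\<^sup>+r. ennreal (?g r) \<partial>half_line)"
  proof (intro nn_integral_mono ennreal_leI)
    fix r assume "r \<in> space half_line"
    then have r: "0 < r" by simp
    show "norm (r powr (\<alpha> - 1) *\<^sub>R resolvent_at A r z) \<le> ?g r"
    proof (cases "r \<le> 1")
      case True
      then show ?thesis
        using mult_left_mono[OF norm_resolvent_at_range[OF r xz], of "r powr (\<alpha> - 1)"] by (simp add: mult_ac)
    next
      case False
      have "r powr (\<alpha> - 1) * (M * norm z / r) = M * norm z * r powr (\<alpha> - 2)"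
      proof -
        have "r powr (\<alpha> - 1) = r * r powr (\<alpha> - 2)" using r powr_mult_base[of r "\<alpha> - 2"] by simp
        then show ?thesis using r by simp
      qed
      then show ?thesis
        using False mult_left_mono[OF norm_resolvent_at[OF r, of z], of "r powr (\<alpha> - 1)"] by (simp del: times_divide_eq_right)
    qed
  qed
  also have "\<dots> < \<infinity>"
    using nn_integral_powr_min[of \<alpha> 1 "(1 + M) * norm x" "M * norm z"] \<alpha> M by simp
  finally have "\<exists>w. has_Bochner_integral half_line (\<lambda>r. r powr (\<alpha> - 1) *\<^sub>R resolvent_at A r z) w"
    by (intro has_Bochner_integral_half_line_exists continuous_intros resolvent_at_continuous) auto
  then show ?thesis using that by blast
qed

end

section \<open>Gamma and Beta integrals\<close>

lemma sigma_finite_half_line: "sigma_finite_measure half_line"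
  by (rule sigma_finite_measure_restrict_space[OF sigma_finite_lborel]) simp

lemma pair_sigma_finite_half_line: "pair_sigma_finite half_line half_line"
  by (simp add: pair_sigma_finite_def sigma_finite_half_line)

lemma nn_integral_half_line_indicator:
  "(\<integral>\<^sup>+x. f x \<partial>half_line) = (\<integral>\<^sup>+x. f x * indicator {0<..} x \<partial>lborel)"
  by (simp add: nn_integral_restrict_space)

lemma measurable_half_line_ident: "(\<lambda>x. x) \<in> borel_measurable half_line"
  by (rule measurable_restrict_space1) simp

lemma nn_integral_Gamma_exp:
  fixes \<alpha> v :: real
  assumes \<alpha>: "0 < \<alpha>" and v: "0 < v"
  shows "(\<integral>\<^sup>+r. ennreal (r powr (\<alpha> - 1) * exp (- r * v)) \<partial>half_line) = ennreal (Gamma \<alpha> * v powr (- \<alpha>))"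
proof -
  define f where "f t = ennreal (t powr (\<alpha> - 1) / exp t) * indicator {0<..} t" for t :: real
  have [measurable]: "f \<in> borel_measurable borel" unfolding f_def by measurable
  have "ennreal (Gamma \<alpha>) = (\<integral>\<^sup>+t. f t \<partial>lborel)"
    unfolding f_def using nn_integral_half_line[OF _ Gamma_integral_real[OF \<alpha>]]
    by (simp add: nn_integral_half_line_indicator)
  also have "\<dots> = ennreal v * (\<integral>\<^sup>+r. f (0 + v * r) \<partial>lborel)"
    using nn_integral_real_affine[of f v 0] v by simp
  also have "(\<lambda>r. f (0 + v * r)) = (\<lambda>r. ennreal (v powr (\<alpha> - 1)) * (ennreal (r powr (\<alpha> - 1) * exp (- r * v)) * indicator {0<..} r))"
    using v by (auto simp: f_def fun_eq_iff indicator_def zero_less_mult_iff powr_mult exp_minus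
        ennreal_mult[symmetric] field_simps)
  also have "(\<integral>\<^sup>+r. ennreal (v powr (\<alpha> - 1)) * (ennreal (r powr (\<alpha> - 1) * exp (- r * v)) * indicator {0<..} r) \<partial>lborel) =
      ennreal (v powr (\<alpha> - 1)) * (\<integral>\<^sup>+r. ennreal (r powr (\<alpha> - 1) * exp (- r * v)) \<partial>half_line)"
    by (subst nn_integral_cmult) (auto simp: nn_integral_half_line_indicator)
  finally have "ennreal (Gamma \<alpha>) = ennreal (v powr \<alpha>) * (\<integral>\<^sup>+r. ennreal (r powr (\<alpha> - 1) * exp (- r * v)) \<partial>half_line)"
    using v powr_mult_base[of v "\<alpha> - 1"] by (simp add: mult.assoc[symmetric] ennreal_mult[symmetric])
  then have "ennreal (v powr (- \<alpha>)) * ennreal (Gamma \<alpha>) =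
      ennreal (v powr (- \<alpha>)) * ennreal (v powr \<alpha>) * (\<integral>\<^sup>+r. ennreal (r powr (\<alpha> - 1) * exp (- r * v)) \<partial>half_line)"
    by (simp add: mult.assoc)
  also have "ennreal (v powr (- \<alpha>)) * ennreal (v powr \<alpha>) = 1"
    using v by (simp add: ennreal_mult[symmetric] powr_add[symmetric])
  finally show ?thesis using \<alpha> by (simp add: ennreal_mult[symmetric] mult.commute Gamma_real_nonneg)
qed

text \<open>The substitution \<open>u = w * s\<close> reduces to the Beta integral. The powers of
  \<open>w\<close> cancel, since the exponents \<alpha> - 1 and -\<alpha> add up to -1; this
  independence of \<open>w\<close> is what makes the two fractional kernels inverse to each
  other.\<close>

lemma nn_integral_Beta:
  fixes \<alpha> w :: real
  assumes \<alpha>: "0 < \<alpha>" "\<alpha> < 1" and w: "0 < w"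
  shows "(\<integral>\<^sup>+u. ennreal (u powr (\<alpha> - 1) * (w - u) powr (- \<alpha>)) * indicator {0<..<w} u \<partial>lborel) =
    ennreal (Gamma \<alpha> * Gamma (1 - \<alpha>))"
proof -
  define f where "f u = ennreal (u powr (\<alpha> - 1) * (w - u) powr (- \<alpha>)) * indicator {0<..<w} u" for u :: real
  have [measurable]: "f \<in> borel_measurable borel" unfolding f_def by measurable
  have "(\<integral>\<^sup>+u. f u \<partial>lborel) = ennreal w * (\<integral>\<^sup>+s. f (0 + w * s) \<partial>lborel)"
    using nn_integral_real_affine[of f w 0] w by simp
  also have "\<dots> = (\<integral>\<^sup>+s. ennreal w * f (0 + w * s) \<partial>lborel)"
    by (rule nn_integral_cmult[symmetric]) measurable
  also have "(\<lambda>s. ennreal w * f (0 + w * s)) =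
      (\<lambda>s. ennreal (s powr (\<alpha> - 1) * (1 - s) powr (1 - \<alpha> - 1)) * indicator {0<..<1} s)"
  proof
    fix s
    show "ennreal w * f (0 + w * s) = ennreal (s powr (\<alpha> - 1) * (1 - s) powr (1 - \<alpha> - 1)) * indicator {0<..<1} s"
    proof (cases "s \<in> {0<..<1}")
      case True
      then have "w - w * s = w * (1 - s)" by (simp add: algebra_simps)
      then have "w * ((w * s) powr (\<alpha> - 1) * (w - w * s) powr (- \<alpha>)) =
          (w * (w powr (\<alpha> - 1) * w powr (- \<alpha>))) * (s powr (\<alpha> - 1) * (1 - s) powr (- \<alpha>))"
        using True w by (simp add: powr_mult)
      also have "w * (w powr (\<alpha> - 1) * w powr (- \<alpha>)) = 1"
        unfolding powr_add[symmetric] using w powr_neg_one[of w] by simp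
      finally show ?thesis using True w by (simp add: f_def ennreal_mult[symmetric])
    next
      case False
      then have "w * s \<notin> {0<..<w}" using w by (simp add: zero_less_mult_iff)
      then have "f (w * s) = 0" by (simp add: f_def)
      then show ?thesis using False by simp
    qed
  qed
  also have "(\<integral>\<^sup>+s. ennreal (s powr (\<alpha> - 1) * (1 - s) powr (1 - \<alpha> - 1)) * indicator {0<..<1} s \<partial>lborel) = ennreal (Beta \<alpha> (1 - \<alpha>))"
  proof (rule nn_integral_has_integral_lebesgue')
    have "((\<lambda>t. t powr (\<alpha> - 1) * (1 - t) powr (1 - \<alpha> - 1)) has_integral Beta \<alpha> (1 - \<alpha>)) {0..1}"
      using \<alpha> by (intro has_integral_Beta_real) auto
    then show "((\<lambda>t. t powr (\<alpha> - 1) * (1 - t) powr (1 - \<alpha> - 1)) has_integral Beta \<alpha> (1 - \<alpha>)) {0<..<1}"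
      by (simp add: has_integral_Icc_iff_Ioo)
  qed auto
  finally show ?thesis by (simp add: f_def Beta_def)
qed

text \<open>Fubini and the substitution $w = u + v$ turn the double integral into the Beta integral.\<close>

lemma nn_integral_Beta_convolution:
  fixes K :: "real \<Rightarrow> ennreal"
  assumes \<alpha>: "0 < \<alpha>" "\<alpha> < 1" and K[measurable]: "K \<in> borel_measurable borel"
  shows "(\<integral>\<^sup>+u. (\<integral>\<^sup>+v. ennreal (u powr (\<alpha> - 1) * v powr (- \<alpha>)) * K (u + v) \<partial>half_line) \<partial>half_line) =
    ennreal (Gamma \<alpha> * Gamma (1 - \<alpha>)) * (\<integral>\<^sup>+w. K w \<partial>half_line)"
proof -
  define H where "H u w = ennreal (u powr (\<alpha> - 1) * (w - u) powr (- \<alpha>)) * K w * indicator {0<..<w} u" for u w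
  have [measurable]: "case_prod H \<in> borel_measurable (borel \<Otimes>\<^sub>M borel)"
    unfolding H_def indicator_def greaterThanLessThan_iff by measurable
  have "(\<integral>\<^sup>+v. ennreal (u powr (\<alpha> - 1) * v powr (- \<alpha>)) * K (u + v) \<partial>half_line) * indicator {0<..} u = (\<integral>\<^sup>+w. H u w \<partial>lborel)" for u
  proof (cases "0 < u")
    case True
    have "(\<integral>\<^sup>+w. H u w \<partial>lborel) = (\<integral>\<^sup>+v. H u (u + 1 * v) \<partial>lborel)"
      using nn_integral_real_affine[of "H u" 1 u] by simp
    also have "\<dots> = (\<integral>\<^sup>+v. ennreal (u powr (\<alpha> - 1) * v powr (- \<alpha>)) * K (u + v) * indicator {0<..} v \<partial>lborel)"
      using True by (intro nn_integral_cong) (simp add: H_def indicator_def)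
    finally show ?thesis using True by (simp add: nn_integral_half_line_indicator)
  qed (simp add: H_def)
  then have "(\<integral>\<^sup>+u. (\<integral>\<^sup>+v. ennreal (u powr (\<alpha> - 1) * v powr (- \<alpha>)) * K (u + v) \<partial>half_line) \<partial>half_line) =
      (\<integral>\<^sup>+u. (\<integral>\<^sup>+w. H u w \<partial>lborel) \<partial>lborel)"
    by (simp add: nn_integral_half_line_indicator[of "\<lambda>u. \<integral>\<^sup>+v. ennreal (u powr (\<alpha> - 1) * v powr (- \<alpha>)) * K (u + v) \<partial>half_line"])
  also have "\<dots> = (\<integral>\<^sup>+w. (\<integral>\<^sup>+u. H u w \<partial>lborel) \<partial>lborel)"
    by (rule lborel_pair.Fubini'[symmetric]) measurable
  also have "\<dots> = (\<integral>\<^sup>+w. ennreal (Gamma \<alpha> * Gamma (1 - \<alpha>)) * (K w * indicator {0<..} w) \<partial>lborel)"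
  proof (rule nn_integral_cong)
    fix w
    show "(\<integral>\<^sup>+u. H u w \<partial>lborel) = ennreal (Gamma \<alpha> * Gamma (1 - \<alpha>)) * (K w * indicator {0<..} w)"
    proof (cases "0 < w")
      case True
      have "(\<integral>\<^sup>+u. H u w \<partial>lborel) = (\<integral>\<^sup>+u. K w * (ennreal (u powr (\<alpha> - 1) * (w - u) powr (- \<alpha>)) * indicator {0<..<w} u) \<partial>lborel)"
        by (simp add: H_def mult_ac)
      also have "\<dots> = K w * ennreal (Gamma \<alpha> * Gamma (1 - \<alpha>))"
        by (subst nn_integral_cmult) (auto simp: nn_integral_Beta[OF \<alpha> True])
      finally show ?thesis using True by (simp add: mult.commute)
    qed (simp add: H_def)
  qed
  also have "\<dots> = ennreal (Gamma \<alpha> * Gamma (1 - \<alpha>)) * (\<integral>\<^sup>+w. K w \<partial>half_line)"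
    by (subst nn_integral_cmult) (auto simp: nn_integral_half_line_indicator)
  finally show ?thesis .
qed

lemma integral_Beta_convolution:
  fixes k :: "real \<Rightarrow> real"
  assumes \<alpha>: "0 < \<alpha>" "\<alpha> < 1" and cont: "continuous_on {0<..} k"
    and fin: "(\<integral>\<^sup>+w. norm (k w) \<partial>half_line) < \<infinity>"
  shows "(\<integral>u. (\<integral>v. u powr (\<alpha> - 1) * v powr (- \<alpha>) * k (u + v) \<partial>half_line) \<partial>half_line) =
    Gamma \<alpha> * Gamma (1 - \<alpha>) * (\<integral>w. k w \<partial>half_line)"
proof -
  interpret pair_sigma_finite half_line half_line by (rule pair_sigma_finite_half_line)
  note [measurable] = measurable_half_line_ident
  \<comment> \<open>Extension by zero makes the function Borel on the whole line, as the nonnegative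
    version requires.\<close>
  define k0 where "k0 w = indicator {0<..} w * k w" for w
  have [measurable]: "k0 \<in> borel_measurable borel"
    unfolding k0_def using borel_measurable_continuous_on_indicator[OF _ cont] by simp
  have k0: "k0 w = k w" if "0 < w" for w using that by (simp add: k0_def)
  define F where "F u v = u powr (\<alpha> - 1) * v powr (- \<alpha>) * k0 (u + v)" for u v
  have [measurable]: "case_prod F \<in> borel_measurable (half_line \<Otimes>\<^sub>M half_line)"
    unfolding F_def by measurable
  let ?B = "Gamma \<alpha> * Gamma (1 - \<alpha>)"
  have B: "0 \<le> ?B" using \<alpha> by (simp add: Gamma_real_nonneg)
  \<comment> \<open>\<open>g\<close> will be the norm, the identity and the negation. Nonnegative
    homogeneity suffices to pull out the weight, so a single computation yields integrability as
    well as the positive and negative parts.\<close>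
  have nn: "(\<integral>\<^sup>+p. ennreal (g (F (fst p) (snd p))) \<partial>(half_line \<Otimes>\<^sub>M half_line)) = ennreal ?B * (\<integral>\<^sup>+w. ennreal (g (k w)) \<partial>half_line)"
    if [measurable]: "g \<in> borel_measurable borel" and g: "\<And>c x. 0 \<le> c \<Longrightarrow> g (c * x) = c * g x" for g :: "real \<Rightarrow> real"
  proof -
    have "(\<integral>\<^sup>+p. ennreal (g (F (fst p) (snd p))) \<partial>(half_line \<Otimes>\<^sub>M half_line)) =
        (\<integral>\<^sup>+u. (\<integral>\<^sup>+v. ennreal (g (F u v)) \<partial>half_line) \<partial>half_line)"
      by (subst sigma_finite_measure.nn_integral_fst[OF sigma_finite_half_line, symmetric]) (simp_all add: F_def)
    also have "\<dots> = (\<integral>\<^sup>+u. (\<integral>\<^sup>+v. ennreal (u powr (\<alpha> - 1) * v powr (- \<alpha>)) * ennreal (g (k0 (u + v))) \<partial>half_line) \<partial>half_line)"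
      by (intro nn_integral_cong) (simp add: F_def g ennreal_mult')
    also have "\<dots> = ennreal ?B * (\<integral>\<^sup>+w. ennreal (g (k0 w)) \<partial>half_line)"
      by (rule nn_integral_Beta_convolution[OF \<alpha>]) measurable
    also have "(\<integral>\<^sup>+w. ennreal (g (k0 w)) \<partial>half_line) = (\<integral>\<^sup>+w. ennreal (g (k w)) \<partial>half_line)"
      by (intro nn_integral_cong) (simp add: k0)
    finally show ?thesis .
  qed
  have intF: "integrable (half_line \<Otimes>\<^sub>M half_line) (\<lambda>p. F (fst p) (snd p))"
  proof (rule integrableI_bounded)
    show "(\<integral>\<^sup>+p. ennreal (norm (F (fst p) (snd p))) \<partial>(half_line \<Otimes>\<^sub>M half_line)) < \<infinity>"
      by (subst nn) (use fin in \<open>auto simp: abs_mult ennreal_mult_less_top\<close>)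
    have "(\<lambda>p. F (fst p) (snd p)) = case_prod F" by auto
    then show "(\<lambda>p. F (fst p) (snd p)) \<in> borel_measurable (half_line \<Otimes>\<^sub>M half_line)" by simp
  qed
  have intk: "integrable half_line k"
    by (rule integrableI_bounded) (use fin borel_measurable_half_line[OF cont] in auto)
  have "(\<integral>u. (\<integral>v. u powr (\<alpha> - 1) * v powr (- \<alpha>) * k (u + v) \<partial>half_line) \<partial>half_line) =
      (\<integral>u. (\<integral>v. F u v \<partial>half_line) \<partial>half_line)"
    by (intro Bochner_Integration.integral_cong refl) (simp add: F_def k0)
  also have "\<dots> = (\<integral>p. F (fst p) (snd p) \<partial>(half_line \<Otimes>\<^sub>M half_line))"
    using integral_fst'[OF intF] by simp
  also have "\<dots> = enn2real (ennreal ?B * (\<integral>\<^sup>+w. ennreal (k w) \<partial>half_line)) - enn2real (ennreal ?B * (\<integral>\<^sup>+w. ennreal (- k w) \<partial>half_line))"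
    unfolding real_lebesgue_integral_def[OF intF] using nn[of "\<lambda>x. x"] nn[of "\<lambda>x. - x"] by simp
  also have "\<dots> = ?B * (\<integral>w. k w \<partial>half_line)"
    unfolding real_lebesgue_integral_def[OF intk] using B by (simp add: enn2real_mult right_diff_distrib)
  finally show ?thesis .
qed

text \<open>By Fubini the integral over \<open>r\<close> can be done first and gives Gamma \<alpha>
  v^(-\<alpha>). The left side is Balakrishnan's integral once the resolvent is replaced by its
  Laplace representation.\<close>

lemma integral_Gamma_Laplace:
  fixes g :: "real \<Rightarrow> real"
  assumes \<alpha>: "0 < \<alpha>" and cont: "continuous_on {0<..} g"
    and fin: "(\<integral>\<^sup>+v. norm (v powr (- \<alpha>) * g v) \<partial>half_line) < \<infinity>"
  shows "(\<integral>r. (\<integral>v. r powr (\<alpha> - 1) * (exp (- r * v) * g v) \<partial>half_line) \<partial>half_line) =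
    Gamma \<alpha> * (\<integral>v. v powr (- \<alpha>) * g v \<partial>half_line)"
proof -
  interpret pair_sigma_finite half_line half_line by (rule pair_sigma_finite_half_line)
  note [measurable] = measurable_half_line_ident
  have [measurable]: "g \<in> borel_measurable half_line" by (rule borel_measurable_half_line[OF cont])
  define F where "F r v = r powr (\<alpha> - 1) * (exp (- r * v) * g v)" for r v
  have mF[measurable]: "case_prod F \<in> borel_measurable (half_line \<Otimes>\<^sub>M half_line)"
    unfolding F_def by measurable
  have G: "0 \<le> Gamma \<alpha>" using \<alpha> by (simp add: Gamma_real_nonneg)
  have inner: "has_bochner_integral half_line (\<lambda>r. F r v) (Gamma \<alpha> * v powr (- \<alpha>) * g v)" if "0 < v" for v
  proof -
    have "has_bochner_integral half_line (\<lambda>r. r powr (\<alpha> - 1) * exp (- r * v)) (Gamma \<alpha> * v powr (- \<alpha>))"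
      by (rule has_bochner_integral_nn_integral) (use nn_integral_Gamma_exp[OF \<alpha> that] G in auto)
    then have "has_bochner_integral half_line (\<lambda>r. r powr (\<alpha> - 1) * exp (- r * v) * g v) (Gamma \<alpha> * v powr (- \<alpha>) * g v)"
      by (rule has_bochner_integral_mult_left)
    then show ?thesis by (simp add: F_def mult.assoc)
  qed
  have intF: "integrable (half_line \<Otimes>\<^sub>M half_line) (case_prod F)"
  proof (rule integrableI_bounded)
    have "(\<integral>\<^sup>+p. ennreal (norm (case_prod F p)) \<partial>(half_line \<Otimes>\<^sub>M half_line)) =
        (\<integral>\<^sup>+v. (\<integral>\<^sup>+r. ennreal (norm (F r v)) \<partial>half_line) \<partial>half_line)"
      by (subst nn_integral_snd[symmetric]) auto
    also have "\<dots> = (\<integral>\<^sup>+v. ennreal (Gamma \<alpha>) * ennreal (norm (v powr (- \<alpha>) * g v)) \<partial>half_line)"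
    proof (rule nn_integral_cong)
      fix v assume "v \<in> space half_line"
      then have v: "0 < v" by simp
      have "(\<integral>\<^sup>+r. ennreal (norm (F r v)) \<partial>half_line) = (\<integral>\<^sup>+r. ennreal (r powr (\<alpha> - 1) * exp (- r * v)) * ennreal \<bar>g v\<bar> \<partial>half_line)"
        by (intro nn_integral_cong) (simp add: F_def abs_mult ennreal_mult mult.assoc)
      also have "\<dots> = ennreal (Gamma \<alpha> * v powr (- \<alpha>)) * ennreal \<bar>g v\<bar>"
        by (subst nn_integral_multc) (auto simp: nn_integral_Gamma_exp[OF \<alpha> v, simplified])
      finally show "(\<integral>\<^sup>+r. ennreal (norm (F r v)) \<partial>half_line) = ennreal (Gamma \<alpha>) * ennreal (norm (v powr (- \<alpha>) * g v))"
        using G by (simp add: abs_mult ennreal_mult mult.assoc)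
    qed
    also have "\<dots> = ennreal (Gamma \<alpha>) * (\<integral>\<^sup>+v. ennreal (norm (v powr (- \<alpha>) * g v)) \<partial>half_line)"
      by (rule nn_integral_cmult) measurable
    also have "\<dots> < \<infinity>" using fin by (simp add: ennreal_mult_less_top)
    finally show "(\<integral>\<^sup>+p. ennreal (norm (case_prod F p)) \<partial>(half_line \<Otimes>\<^sub>M half_line)) < \<infinity>" .
  qed (rule mF)
  have "(\<integral>r. (\<integral>v. F r v \<partial>half_line) \<partial>half_line) = (\<integral>v. (\<integral>r. F r v \<partial>half_line) \<partial>half_line)"
    by (rule Fubini_integral[OF intF, symmetric])
  also have "\<dots> = (\<integral>v. Gamma \<alpha> * (v powr (- \<alpha>) * g v) \<partial>half_line)"
    by (intro Bochner_Integration.integral_cong refl)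
      (use inner[THEN has_bochner_integral_integral_eq] in \<open>simp add: mult.assoc\<close>)
  finally show ?thesis by (simp add: F_def)
qed

text \<open>Passes from Lebesgue integrals on the half-line to limits over \<open>{0..b}\<close>,
  where the fundamental theorem of calculus can be applied.\<close>

lemma integral_half_line_at_top:
  fixes f :: "real \<Rightarrow> real"
  assumes "integrable half_line f"
  shows "f integrable_on {0..b}" "((\<lambda>b. integral {0..b} f) \<longlongrightarrow> (\<integral>x. f x \<partial>half_line)) at_top"
proof -
  have i: "integrable lborel (\<lambda>x. indicator {0<..} x *\<^sub>R f x)"
    using assms by (simp add: integrable_restrict_space)
  have i': "set_integrable lborel {0<..b} f" for b
  proof -
    have "integrable lborel (\<lambda>x. indicator {..b} x *\<^sub>R (indicator {0<..} x *\<^sub>R f x))"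
      by (rule integrable_mult_indicator[OF _ i]) simp
    moreover have "indicator {..b} x *\<^sub>R (indicator {0<..} x *\<^sub>R f x) = indicator {0<..b} x *\<^sub>R f x" for x
      by (auto simp: indicator_def)
    ultimately show ?thesis by (simp only: set_integrable_def)
  qed
  have hk: "(f has_integral (LINT x:{0<..b}|lborel. f x)) {0..b}" for b
  proof (rule has_integral_spike_set_eq[THEN iffD1])
    show "(f has_integral (LINT x:{0<..b}|lborel. f x)) {0<..b}"
      using set_borel_integral_eq_integral[OF i'[of b]] by (simp add: has_integral_integral)
    have "{x \<in> {0<..b} - {0..b}. f x \<noteq> 0} = {}" by auto
    then show "negligible {x \<in> {0<..b} - {0..b}. f x \<noteq> 0}" by (simp only: negligible_empty)
    show "negligible {x \<in> {0..b} - {0<..b}. f x \<noteq> 0}"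
      by (rule negligible_subset[of "{0::real}"]) auto
  qed
  then show "f integrable_on {0..b}" by blast
  have "((\<lambda>b. \<integral>x. indicator {..b} x *\<^sub>R (indicator {0<..} x *\<^sub>R f x) \<partial>lborel) \<longlongrightarrow> (\<integral>x. indicator {0<..} x *\<^sub>R f x \<partial>lborel)) at_top"
    by (rule tendsto_integral_at_top[OF _ i]) simp
  moreover have "(\<integral>x. indicator {..b} x *\<^sub>R (indicator {0<..} x *\<^sub>R f x) \<partial>lborel) = integral {0..b} f" for b
  proof -
    have "(\<integral>x. indicator {..b} x *\<^sub>R (indicator {0<..} x *\<^sub>R f x) \<partial>lborel) = (LINT x:{0<..b}|lborel. f x)"
      unfolding set_lebesgue_integral_def
      by (intro Bochner_Integration.integral_cong refl) (auto simp: indicator_def)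
    then show ?thesis using hk[of b] by (simp add: integral_unique)
  qed
  ultimately show "((\<lambda>b. integral {0..b} f) \<longlongrightarrow> (\<integral>x. f x \<partial>half_line)) at_top"
    by (simp add: integral_restrict_space)
qed

text \<open>Integration by parts on \<open>{t..}\<close> uses the boundedness of \<open>p\<close>. Bounding \<open>p'\<close> by \<open>R / u\<close>
  there instead would cost a factor \<open>1 / (1 - \<alpha>)\<close>.\<close>

lemma integral_powr_derivative_bound:
  fixes p p' :: "real \<Rightarrow> real"
  assumes \<alpha>: "0 < \<alpha>" "\<alpha> < 1" and t: "0 < t"
    and deriv: "\<And>u. 0 < u \<Longrightarrow> (p has_real_derivative p' u) (at u)"
    and cont: "continuous_on {0<..} p'"
    and P: "\<And>u. 0 < u \<Longrightarrow> \<bar>p u\<bar> \<le> P" and Q: "\<And>u. 0 < u \<Longrightarrow> u \<le> t \<Longrightarrow> \<bar>p' u\<bar> \<le> Q"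
    and R: "\<And>u. 0 < u \<Longrightarrow> \<bar>p' u\<bar> \<le> R / u"
  shows "\<bar>\<integral>u. u powr (\<alpha> - 1) * p' u \<partial>half_line\<bar> \<le> Q * (t powr \<alpha> / \<alpha>) + 2 * P * t powr (\<alpha> - 1)"
proof -
  let ?f = "\<lambda>u. u powr (\<alpha> - 1) * p' u"
  have nonneg: "0 \<le> P" "0 \<le> Q" "0 \<le> R"
    using P[of t] Q[of t] R[of t] t by (auto simp: zero_le_divide_iff dest: order_trans[OF abs_ge_zero])
  have contf: "continuous_on {0<..} ?f" by (intro continuous_intros cont) auto
  \<comment> \<open>The decay \<open>R / u\<close> serves only to show integrability. Its constant,
    which degenerates as \<alpha> tends to 1, does not enter the final bound.\<close>
  have "(\<integral>\<^sup>+u. norm (?f u) \<partial>half_line) \<le> (\<integral>\<^sup>+u. ennreal (if u \<le> t then Q * u powr (\<alpha> - 1) else R * u powr (\<alpha> - 2)) \<partial>half_line)"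
  proof (intro nn_integral_mono ennreal_leI)
    fix u assume "u \<in> space half_line"
    then have u: "0 < u" by simp
    then have "u powr (\<alpha> - 1) = u * u powr (\<alpha> - 2)" using powr_mult_base[of u "\<alpha> - 2"] by simp
    then have "u powr (\<alpha> - 1) * (R / u) = R * u powr (\<alpha> - 2)" using u by simp
    then show "norm (?f u) \<le> (if u \<le> t then Q * u powr (\<alpha> - 1) else R * u powr (\<alpha> - 2))"
      using mult_left_mono[OF Q[OF u], of "u powr (\<alpha> - 1)"] mult_left_mono[OF R[OF u], of "u powr (\<alpha> - 1)"]
      by (simp add: abs_mult mult.commute)
  qed
  also have "\<dots> < \<infinity>" using nn_integral_powr_min[OF \<alpha> t nonneg(2,3)] by simp
  finally have int: "integrable half_line ?f"
    by (intro integrableI_bounded borel_measurable_half_line[OF contf])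
  note lim = integral_half_line_at_top[OF int]
  have "\<bar>integral {0..b} ?f\<bar> \<le> Q * (t powr \<alpha> / \<alpha>) + 2 * P * t powr (\<alpha> - 1)" if b: "t \<le> b" for b
  proof -
    have "\<bar>integral {0..t} ?f\<bar> \<le> Q * (t powr \<alpha> / \<alpha>)"
    proof -
      have 1: "((\<lambda>u. Q * u powr (\<alpha> - 1)) has_integral Q * (t powr \<alpha> / \<alpha>)) {0..t}"
        using has_integral_mult_right[OF has_integral_powr_from_0[of "\<alpha> - 1" t], of Q] \<alpha> t by simp
      have "norm (integral {0..t} ?f) \<le> integral {0..t} (\<lambda>u. Q * u powr (\<alpha> - 1))"
      proof (rule integral_norm_bound_integral)
        show "?f integrable_on {0..t}" by (rule lim)
        show "(\<lambda>u. Q * u powr (\<alpha> - 1)) integrable_on {0..t}" using 1 by blast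
        show "norm (?f u) \<le> Q * u powr (\<alpha> - 1)" if "u \<in> {0..t}" for u
          using that mult_left_mono[OF Q[of u], of "u powr (\<alpha> - 1)"]
          by (cases "u = 0") (auto simp: abs_mult mult.commute)
      qed
      then show ?thesis using integral_unique[OF 1] by simp
    qed
    moreover have "\<bar>integral {t..b} ?f\<bar> \<le> 2 * P * t powr (\<alpha> - 1)"
    proof -
      \<comment> \<open>The derivative of u^(\<alpha> - 1) p is \<open>?f\<close> minus
        \<open>?q\<close>. The boundary term at \<open>t\<close> and the integral of
        \<open>?q\<close> contribute at most P t^(\<alpha> - 1) each, up to terms at
        \<open>b\<close> that cancel in the sum.\<close>
      let ?q = "\<lambda>u. (1 - \<alpha>) * (u powr (\<alpha> - 2) * p u)"
      have ftc: "((\<lambda>u. ?f u - ?q u) has_integral b powr (\<alpha> - 1) * p b - t powr (\<alpha> - 1) * p t) {t..b}"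
      proof (rule fundamental_theorem_of_calculus[OF b])
        fix u assume "u \<in> {t..b}"
        then have u: "0 < u" using t by simp
        have "((\<lambda>u. u powr (\<alpha> - 1) * p u) has_real_derivative
            ((\<alpha> - 1) * u powr (\<alpha> - 1 - 1)) * p u + p' u * u powr (\<alpha> - 1)) (at u)"
          by (rule DERIV_mult[OF has_real_derivative_powr[OF u] deriv[OF u]])
        then have "((\<lambda>u. u powr (\<alpha> - 1) * p u) has_real_derivative ?f u - ?q u) (at u)"
          by (rule DERIV_cong) (simp add: algebra_simps)
        then show "((\<lambda>u. u powr (\<alpha> - 1) * p u) has_vector_derivative ?f u - ?q u) (at u within {t..b})"
          by (simp add: has_real_derivative_iff_has_vector_derivative has_vector_derivative_at_within)
      qed
      have fint: "?f integrable_on {t..b}"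
        using lim(1)[of b] integrable_on_subinterval[of ?f "{0..b}" t b] t by auto
      have qint: "?q integrable_on {t..b}"
        using integrable_diff[OF fint has_integral_integrable[OF ftc]] by simp
      have bound: "((\<lambda>u. P * ((1 - \<alpha>) * u powr (\<alpha> - 2))) has_integral P * (t powr (\<alpha> - 1) - b powr (\<alpha> - 1))) {t..b}"
      proof -
        have "((\<lambda>u. (1 - \<alpha>) * u powr (\<alpha> - 2)) has_integral - (b powr (\<alpha> - 1)) - (- (t powr (\<alpha> - 1)))) {t..b}"
        proof (rule fundamental_theorem_of_calculus[OF b])
          fix u assume "u \<in> {t..b}"
          then have u: "0 < u" using t by simp
          have "((\<lambda>u. - (u powr (\<alpha> - 1))) has_real_derivative - ((\<alpha> - 1) * u powr (\<alpha> - 1 - 1))) (at u)"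
            by (rule DERIV_minus[OF has_real_derivative_powr[OF u]])
          then have "((\<lambda>u. - (u powr (\<alpha> - 1))) has_real_derivative (1 - \<alpha>) * u powr (\<alpha> - 2)) (at u)"
            by (rule DERIV_cong) (simp add: algebra_simps)
          then show "((\<lambda>u. - (u powr (\<alpha> - 1))) has_vector_derivative (1 - \<alpha>) * u powr (\<alpha> - 2)) (at u within {t..b})"
            by (simp add: has_real_derivative_iff_has_vector_derivative has_vector_derivative_at_within)
        qed
        from has_integral_mult_right[OF this, of P] show ?thesis by simp
      qed
      have "norm (integral {t..b} ?q) \<le> integral {t..b} (\<lambda>u. P * ((1 - \<alpha>) * u powr (\<alpha> - 2)))"
      proof (rule integral_norm_bound_integral[OF qint has_integral_integrable[OF bound]])
        fix u assume "u \<in> {t..b}"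
        then have u: "0 < u" using t by simp
        show "norm (?q u) \<le> P * ((1 - \<alpha>) * u powr (\<alpha> - 2))"
          using mult_left_mono[OF P[OF u], of "(1 - \<alpha>) * u powr (\<alpha> - 2)"] \<alpha>
          by (simp add: abs_mult mult_ac)
      qed
      then have "\<bar>integral {t..b} ?q\<bar> \<le> P * t powr (\<alpha> - 1) - P * b powr (\<alpha> - 1)"
        using integral_unique[OF bound] by (simp add: right_diff_distrib)
      moreover have "integral {t..b} ?f - integral {t..b} ?q = b powr (\<alpha> - 1) * p b - t powr (\<alpha> - 1) * p t"
        using integral_unique[OF ftc] Henstock_Kurzweil_Integration.integral_diff[OF fint qint] by simp
      moreover have "\<bar>b powr (\<alpha> - 1) * p b\<bar> \<le> P * b powr (\<alpha> - 1)" "\<bar>t powr (\<alpha> - 1) * p t\<bar> \<le> P * t powr (\<alpha> - 1)"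
        using mult_left_mono[OF P[of b], of "b powr (\<alpha> - 1)"] mult_left_mono[OF P[of t], of "t powr (\<alpha> - 1)"] t b
        by (auto simp: abs_mult mult.commute)
      ultimately show ?thesis by linarith
    qed
    moreover have "integral {0..t} ?f + integral {t..b} ?f = integral {0..b} ?f"
      by (rule Henstock_Kurzweil_Integration.integral_combine) (use t b lim in auto)
    ultimately show ?thesis by linarith
  qed
  then have "eventually (\<lambda>b. \<bar>integral {0..b} ?f\<bar> \<le> Q * (t powr \<alpha> / \<alpha>) + 2 * P * t powr (\<alpha> - 1)) at_top"
    by (intro eventually_mono[OF eventually_ge_at_top[of t]])
  moreover have "((\<lambda>b. \<bar>integral {0..b} ?f\<bar>) \<longlongrightarrow> \<bar>\<integral>u. ?f u \<partial>half_line\<bar>) at_top"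
    by (intro tendsto_rabs lim)
  ultimately show ?thesis by (intro tendsto_upperbound) auto
qed

section \<open>Fractional powers and the semigroup\<close>

context analytic_semigroup
begin

text \<open>Two Fubini arguments turn Balakrishnan's formula for \<open>y = A\<^sup>\<alpha> x\<close> into
  $\Gamma(\alpha)\, B A x = \int_0^\infty u^{\alpha-1} A e^{-uA} B y\,du$.\<close>

lemma balakrishnan_inverse:
  fixes l :: "'a \<Rightarrow> real"
  assumes \<alpha>: "0 < \<alpha>" "\<alpha> < 1" and xz: "(x, z) \<in> A"
    and w: "has_Bochner_integral half_line (\<lambda>r. r powr (\<alpha> - 1) *\<^sub>R resolvent_at A r z) w"
    and B: "bounded_linear B" and comm: "\<And>s v. 0 \<le> s \<Longrightarrow> B (T s v) = T s (B v)"
    and b: "0 < t" "\<And>u v. 0 < u \<Longrightarrow> u \<le> t \<Longrightarrow> norm (G u (B v)) \<le> b * norm v"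
    and l: "bounded_linear l"
  shows "(\<integral>u. u powr (\<alpha> - 1) * l (G u (B ((sin (pi * \<alpha>) / pi) *\<^sub>R w))) \<partial>half_line) = Gamma \<alpha> * l (B z)"
proof -
  interpret B: bounded_linear B by fact
  interpret l: bounded_linear l by fact
  obtain L where L: "0 < L" "\<And>v. \<bar>l v\<bar> \<le> norm v * L" using l.pos_bounded by auto
  obtain a where a: "0 < a" "\<And>v. norm (B v) \<le> norm v * a" using B.pos_bounded by auto
  define k where "k w = l (G w (B z))" for w
  have contk: "continuous_on {0<..} k"
    unfolding k_def by (intro l.continuous_on G_continuous)
  have xz': "(B x, B z) \<in> A"
    by (rule neg_generator_commute[OF xz B]) (use comm in auto)
  \<comment> \<open>Since \<open>z\<close> is A x, this vector is A^2 exp(-uA) B x, which explains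
    the decay u^(-2).\<close>
  have G2: "norm (G u (B z)) \<le> (2 * M / u) * ((2 * M / u) * (norm x * a))" if u: "0 < u" for u
  proof -
    have "G u (B z) = G (u / 2) (T (u / 2) (B z))" using G_add(2)[of "u / 2" "u / 2" "B z"] u by simp
    also have "T (u / 2) (B z) = G (u / 2) (B x)" using G_eq[OF xz', of "u / 2"] u by simp
    also have "norm (G (u / 2) (G (u / 2) (B x))) \<le> M / (u / 2) * norm (G (u / 2) (B x))"
      using u by (intro norm_G_le) simp
    also have "\<dots> \<le> M / (u / 2) * (M / (u / 2) * norm (B x))"
      using u M by (intro mult_left_mono norm_G_le) auto
    also have "\<dots> \<le> M / (u / 2) * (M / (u / 2) * (norm x * a))"
      using u M a by (intro mult_left_mono) auto
    finally show ?thesis by (simp add: mult.commute)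
  qed
  \<comment> \<open>The three entries cover \<open>u \<le> t\<close> through the smoothing bound
    \<open>b\<close>, \<open>u > t\<close> through the quadratic decay with \<open>u\<close>
    replaced by \<open>t\<close>, and the quadratic decay itself. Boundedness near zero is where
    \<open>B\<close> has to smooth.\<close>
  define C where "C = max (L * (b * norm z)) (max (L * (4 * M * M * (norm x * a) / t\<^sup>2)) (L * (4 * M * M * (norm x * a))))"
  have C: "\<bar>k u\<bar> \<le> C" "\<bar>k u\<bar> \<le> C / u\<^sup>2" if u: "0 < u" for u
  proof -
    have kn: "\<bar>k u\<bar> \<le> norm (G u (B z)) * L" unfolding k_def by (rule L)
    have sq: "(2 * M / u) * ((2 * M / u) * (norm x * a)) = 4 * M * M * (norm x * a) / u\<^sup>2"
      by (simp add: power2_eq_square)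
    have "\<bar>k u\<bar> \<le> L * (4 * M * M * (norm x * a) / u\<^sup>2)"
      using L(1) by (subst mult.commute, intro order_trans[OF kn] mult_right_mono order_trans[OF G2[OF u]])
        (simp_all only: sq order_refl less_imp_le)
    then have k2: "\<bar>k u\<bar> \<le> L * (4 * M * M * (norm x * a)) / u\<^sup>2" by simp
    also have "\<dots> \<le> C / u\<^sup>2" unfolding C_def by (intro divide_right_mono) auto
    finally show "\<bar>k u\<bar> \<le> C / u\<^sup>2" .
    show "\<bar>k u\<bar> \<le> C"
    proof (cases "u \<le> t")
      case True
      have "\<bar>k u\<bar> \<le> (b * norm z) * L"
        using L(1) by (intro order_trans[OF kn] mult_right_mono b u True) auto
      then show ?thesis by (simp add: C_def mult.commute)
    next
      case False
      then have "L * (4 * M * M * (norm x * a)) / u\<^sup>2 \<le> L * (4 * M * M * (norm x * a)) / t\<^sup>2"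
        using L a M b(1) by (intro divide_left_mono power_mono mult_nonneg_nonneg mult_pos_pos) auto
      then show ?thesis using k2 by (simp add: C_def)
    qed
  qed
  have C0': "0 \<le> C" using C(1)[of 1] by simp
  have fin1: "(\<integral>\<^sup>+v. norm (v powr (- \<alpha>) * k (u + v)) \<partial>half_line) < \<infinity>" if u: "0 < u" for u
  proof -
    have "(\<integral>\<^sup>+v. norm (v powr (- \<alpha>) * k (u + v)) \<partial>half_line) \<le>
        (\<integral>\<^sup>+v. ennreal (if v \<le> 1 then C * v powr ((1 - \<alpha>) - 1) else C * v powr ((1 - \<alpha>) - 2)) \<partial>half_line)"
    proof (intro nn_integral_mono ennreal_leI)
      fix v assume "v \<in> space half_line"
      then have v: "0 < v" by simp
      show "norm (v powr (- \<alpha>) * k (u + v)) \<le> (if v \<le> 1 then C * v powr ((1 - \<alpha>) - 1) else C * v powr ((1 - \<alpha>) - 2))"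
      proof (cases "v \<le> 1")
        case True
        then show ?thesis
          using mult_left_mono[OF C(1)[of "u + v"], of "v powr (- \<alpha>)"] u v by (simp add: abs_mult mult.commute)
      next
        case False
        have "\<bar>k (u + v)\<bar> \<le> C / (u + v)\<^sup>2" using C(2)[of "u + v"] u v by simp
        also have "\<dots> \<le> C / v"
        proof (rule divide_left_mono)
          have "v * 1 \<le> (u + v) * (u + v)" using u v False by (intro mult_mono) auto
          then show "v \<le> (u + v)\<^sup>2" by (simp add: power2_eq_square)
        qed (use u v C0' in auto)
        finally have "v powr (- \<alpha>) * \<bar>k (u + v)\<bar> \<le> v powr (- \<alpha>) * (C / v)" by (intro mult_left_mono) auto
        also have "v powr (- \<alpha>) * (C / v) = C * v powr ((1 - \<alpha>) - 2)"
          using v powr_mult_base[of v "(1 - \<alpha>) - 2", symmetric] by simp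
        finally show ?thesis using False by (simp add: abs_mult)
      qed
    qed
    also have "\<dots> < \<infinity>" using nn_integral_powr_min[of "1 - \<alpha>" 1 C C] \<alpha> C0' by simp
    finally show ?thesis .
  qed
  \<comment> \<open>Any exponent in (0, 1) would do. With 1/2, both the bound \<open>C\<close> near
    zero and the quadratic decay at infinity lie below the integrable majorant.\<close>
  have fin2: "(\<integral>\<^sup>+v. norm (k v) \<partial>half_line) < \<infinity>"
  proof -
    have "(\<integral>\<^sup>+v. norm (k v) \<partial>half_line) \<le>
        (\<integral>\<^sup>+v. ennreal (if v \<le> 1 then C * v powr (1 / 2 - 1) else C * v powr (1 / 2 - 2)) \<partial>half_line)"
    proof (intro nn_integral_mono ennreal_leI)
      fix v assume "v \<in> space half_line"
      then have v: "0 < v" by simp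
      show "norm (k v) \<le> (if v \<le> 1 then C * v powr (1 / 2 - 1) else C * v powr (1 / 2 - 2))"
      proof (cases "v \<le> 1")
        case True
        have "1 powr (1 / 2 - 1) \<le> v powr (1 / 2 - 1)" using v True by (intro powr_mono2') auto
        then have "C * 1 \<le> C * v powr (1 / 2 - 1)" using C0' by (intro mult_left_mono) auto
        then show ?thesis using C(1)[OF v] True by simp
      next
        case False
        have "v powr (- 2) \<le> v powr (1 / 2 - 2)" using False by (intro powr_mono) auto
        then have "C * v powr (- 2) \<le> C * v powr (1 / 2 - 2)" using C0' by (intro mult_left_mono) auto
        moreover have "v powr (- 2) = 1 / v\<^sup>2" using v by (simp add: powr_minus_divide)
        ultimately show ?thesis using C(2)[OF v] False by simp
      qed
    qed
    also have "\<dots> < \<infinity>" using nn_integral_powr_min[of "1 / 2" 1 C C] C0' by simp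
    finally show ?thesis .
  qed
  let ?s = "sin (pi * \<alpha>) / pi"
  \<comment> \<open>First Fubini argument: the resolvent is written as a Laplace integral, and the
    integral over its parameter \<open>r\<close> is carried out by
    \<open>integral_Gamma_Laplace\<close>.\<close>
  have step1: "l (G u (B (?s *\<^sub>R w))) = ?s * Gamma \<alpha> * (\<integral>v. v powr (- \<alpha>) * k (u + v) \<partial>half_line)" if u: "0 < u" for u
  proof -
    have bl: "bounded_linear (\<lambda>v. l (G u (B v)))"
      by (intro bounded_linear_compose[OF l] bounded_linear_compose[OF blinfun.bounded_linear_right] B)
    then interpret bl: bounded_linear "\<lambda>v. l (G u (B v))" .
    have res: "l (G u (B (resolvent_at A r z))) = (\<integral>v. exp (- r * v) * k (u + v) \<partial>half_line)" if r: "0 < r" for r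
    proof -
      have "(\<integral>v. l (G u (B (exp (- r * v) *\<^sub>R T v z))) \<partial>half_line) = l (G u (B (resolvent_at A r z)))"
        by (rule has_bochner_integral_integral_eq[OF has_Bochner_integral_functional[OF resolvent_at_has_Bochner_integral[OF r] bl]])
      moreover have "(\<integral>v. l (G u (B (exp (- r * v) *\<^sub>R T v z))) \<partial>half_line) = (\<integral>v. exp (- r * v) * k (u + v) \<partial>half_line)"
      proof (intro Bochner_Integration.integral_cong refl)
        fix v assume "v \<in> space half_line"
        then have "G u (B (T v z)) = G (u + v) (B z)"
          using G_add(2)[of v u "B z"] u comm[of v z] by (simp add: add.commute)
        then show "l (G u (B (exp (- r * v) *\<^sub>R T v z))) = exp (- r * v) * k (u + v)"
          using bl.scaleR[of "exp (- r * v)" "T v z"] by (simp add: k_def)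
      qed
      ultimately show ?thesis by simp
    qed
    have "l (G u (B w)) = (\<integral>r. l (G u (B (r powr (\<alpha> - 1) *\<^sub>R resolvent_at A r z))) \<partial>half_line)"
      by (rule has_bochner_integral_integral_eq[OF has_Bochner_integral_functional[OF w bl], symmetric])
    also have "\<dots> = (\<integral>r. (\<integral>v. r powr (\<alpha> - 1) * (exp (- r * v) * k (u + v)) \<partial>half_line) \<partial>half_line)"
      by (intro Bochner_Integration.integral_cong refl) (simp add: bl.scaleR res)
    also have "\<dots> = Gamma \<alpha> * (\<integral>v. v powr (- \<alpha>) * k (u + v) \<partial>half_line)"
    proof (rule integral_Gamma_Laplace[OF \<alpha>(1) _ fin1[OF u]])
      show "continuous_on {0<..} (\<lambda>v. k (u + v))"
        by (rule continuous_on_compose2[OF contk]) (use u in \<open>auto intro!: continuous_intros\<close>)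
    qed
    finally show ?thesis by (simp add: bl.scaleR)
  qed
  have "(\<integral>u. u powr (\<alpha> - 1) * l (G u (B (?s *\<^sub>R w))) \<partial>half_line) =
      (\<integral>u. (?s * Gamma \<alpha>) * (\<integral>v. u powr (\<alpha> - 1) * v powr (- \<alpha>) * k (u + v) \<partial>half_line) \<partial>half_line)"
    by (intro Bochner_Integration.integral_cong refl) (simp add: step1 mult.assoc)
  also have "\<dots> = (?s * Gamma \<alpha>) * (Gamma \<alpha> * Gamma (1 - \<alpha>) * (\<integral>v. k v \<partial>half_line))"
    by (subst integral_mult_right_zero) (simp add: integral_Beta_convolution[OF \<alpha> contk fin2])
  \<comment> \<open>\<open>k\<close> is the derivative of \<open>- l (T u (B z))\<close>, so the
    integral telescopes. The term at infinity vanishes because \<open>T b (B z) = G b (B x)\<close>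
    has norm of order \<open>1 / b\<close>.\<close>
  also have "(\<integral>v. k v \<partial>half_line) = l (B z)"
  proof -
    have int: "integrable half_line k"
      by (rule integrableI_bounded[OF borel_measurable_half_line[OF contk] fin2])
    have "integral {0..b} k = l (B z) - l (T b (B z))" if "0 \<le> b" for b
    proof -
      have "(k has_integral - l (T b (B z)) - (- l (T 0 (B z)))) {0..b}"
      proof (rule fundamental_theorem_of_calculus_interior[OF that])
        show "continuous_on {0..b} (\<lambda>u. - l (T u (B z)))"
          by (intro continuous_intros l.continuous_on continuous_on_subset[OF T_continuous]) auto
        fix u assume "u \<in> {0<..<b}"
        then have "((\<lambda>u. l (T u (B z))) has_vector_derivative l (- G u (B z))) (at u)"
          by (intro l.has_vector_derivative deriv_Tx) simp
        from has_vector_derivative_minus[OF this]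
        show "((\<lambda>u. - l (T u (B z))) has_vector_derivative k u) (at u)" by (simp add: k_def l.neg)
      qed
      then show ?thesis by (simp add: integral_unique T_zero)
    qed
    then have "eventually (\<lambda>b. l (B z) - l (T b (B z)) = integral {0..b} k) at_top"
      by (intro eventually_mono[OF eventually_ge_at_top[of 0]]) simp
    moreover have "((\<lambda>b. l (B z) - l (T b (B z))) \<longlongrightarrow> l (B z) - 0) at_top"
    proof (rule tendsto_diff[OF tendsto_const Lim_null_comparison])
      show "eventually (\<lambda>b. norm (l (T b (B z))) \<le> L * (M * norm (B x)) / b) at_top"
      proof (rule eventually_mono[OF eventually_gt_at_top[of 0]])
        fix b :: real assume b: "0 < b"
        have "norm (l (T b (B z))) \<le> norm (G b (B x)) * L" using L(2) G_eq[OF xz' b] by simp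
        also have "\<dots> \<le> (M / b * norm (B x)) * L" using L(1) b by (intro mult_right_mono norm_G_le) auto
        finally show "norm (l (T b (B z))) \<le> L * (M * norm (B x)) / b" by (simp add: mult.commute)
      qed
      show "((\<lambda>b. L * (M * norm (B x)) / b) \<longlongrightarrow> 0) at_top"
        by (rule tendsto_divide_0[OF tendsto_const]) (simp add: filterlim_at_top_imp_at_infinity filterlim_ident)
    qed
    ultimately have "((\<lambda>b. integral {0..b} k) \<longlongrightarrow> l (B z) - 0) at_top"
      by (rule Lim_transform_eventually[rotated])
    then have "((\<lambda>b. integral {0..b} k) \<longlongrightarrow> l (B z)) at_top" by simp
    then show ?thesis using integral_half_line_at_top(2)[OF int] by (metis tendsto_unique trivial_limit_at_top_linorder)
  qed
  also have "?s * Gamma \<alpha> * (Gamma \<alpha> * Gamma (1 - \<alpha>) * l (B z)) = (?s * (Gamma \<alpha> * Gamma (1 - \<alpha>))) * (Gamma \<alpha> * l (B z))"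
    by (simp add: mult_ac)
  \<comment> \<open>Euler's reflection formula: the Beta integral cancels the normalising sine of
    Balakrishnan's formula.\<close>
  also have "?s * (Gamma \<alpha> * Gamma (1 - \<alpha>)) = 1"
  proof -
    have eq: "1 - complex_of_real \<alpha> = of_real (1 - \<alpha>)" "of_real pi * complex_of_real \<alpha> = of_real (pi * \<alpha>)"
      by simp_all
    have "Gamma \<alpha> * Gamma (1 - \<alpha>) = pi / sin (pi * \<alpha>)"
      using Gamma_reflection_complex[of "of_real \<alpha>"]
      unfolding eq Gamma_complex_of_real sin_of_real of_real_mult[symmetric] of_real_divide[symmetric] of_real_eq_iff .
    moreover have "0 < sin (pi * \<alpha>)" using \<alpha> by (intro sin_gt_zero) auto
    ultimately show ?thesis by simp
  qed
  finally show ?thesis by simp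
qed

text \<open>In the inversion formula the weight multiplies the derivative of
  \<open>- l (T u (B y))\<close>, so the integral estimate with cut at \<open>t\<close> applies.
  Dividing by Gamma \<alpha> turns its two constants into values of \<open>rGamma\<close>, the
  factor 1 / \<alpha> being absorbed into \<open>rGamma (\<alpha> + 1)\<close>.\<close>

lemma balakrishnan_bound:
  assumes \<alpha>: "0 < \<alpha>" "\<alpha> < 1" and xz: "(x, z) \<in> A"
    and w: "has_Bochner_integral half_line (\<lambda>r. r powr (\<alpha> - 1) *\<^sub>R resolvent_at A r z) w"
    and y: "y = (sin (pi * \<alpha>) / pi) *\<^sub>R w"
    and B: "bounded_linear B" and comm: "\<And>s v. 0 \<le> s \<Longrightarrow> B (T s v) = T s (B v)"
    and a: "\<And>v. norm (B v) \<le> a * norm v"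
    and t: "0 < t" and b: "\<And>u v. 0 < u \<Longrightarrow> u \<le> t \<Longrightarrow> norm (G u (B v)) \<le> b * norm v"
  shows "norm (B z) \<le> (b * t powr \<alpha> * rGamma (\<alpha> + 1) + 2 * (M * a) * t powr (\<alpha> - 1) * rGamma \<alpha>) * norm y"
proof (rule norm_le_functional)
  fix l :: "'a \<Rightarrow> real" assume l: "bounded_linear l" "\<And>v. \<bar>l v\<bar> \<le> norm v"
  interpret l: bounded_linear l by fact
  have G: "0 < Gamma \<alpha>" using \<alpha> by (intro Gamma_real_pos)
  have "Gamma \<alpha> * l (B z) = (\<integral>u. u powr (\<alpha> - 1) * l (G u (B y)) \<partial>half_line)"
    unfolding y by (rule balakrishnan_inverse[OF \<alpha> xz w B comm t b l(1), symmetric])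
  also have "\<dots> \<le> (b * norm y) * (t powr \<alpha> / \<alpha>) + 2 * (M * (a * norm y)) * t powr (\<alpha> - 1)"
  proof (rule order_trans[OF abs_ge_self], rule integral_powr_derivative_bound[OF \<alpha> t])
    fix u :: real assume u: "0 < u"
    have "((\<lambda>u. l (T u (B y))) has_vector_derivative l (- G u (B y))) (at u)"
      by (intro l.has_vector_derivative deriv_Tx u)
    from has_vector_derivative_minus[OF this]
    show "((\<lambda>u. - l (T u (B y))) has_real_derivative l (G u (B y))) (at u)"
      by (simp add: l.neg has_real_derivative_iff_has_vector_derivative)
    have "\<bar>l (T u (B y))\<bar> \<le> M * norm (B y)" using l(2) norm_T_le[of u "B y"] u by (meson less_imp_le order_trans)
    also have "\<dots> \<le> M * (a * norm y)" using a M by (intro mult_left_mono) auto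
    finally show "\<bar>- l (T u (B y))\<bar> \<le> M * (a * norm y)" by simp
    show "\<bar>l (G u (B y))\<bar> \<le> b * norm y" if "u \<le> t" using l(2) b[OF u that, of y] order_trans by blast
    show "\<bar>l (G u (B y))\<bar> \<le> (M * norm (B y)) / u" using l(2)[of "G u (B y)"] norm_G_le[OF u, of "B y"] by simp
  next
    show "continuous_on {0<..} (\<lambda>u. l (G u (B y)))" by (intro l.continuous_on G_continuous)
  qed
  finally have "l (B z) \<le> ((b * norm y) * (t powr \<alpha> / \<alpha>) + 2 * (M * (a * norm y)) * t powr (\<alpha> - 1)) / Gamma \<alpha>"
    using G by (simp add: field_simps)
  also have "\<dots> = (b * t powr \<alpha> * (1 / (\<alpha> * Gamma \<alpha>)) + 2 * (M * a) * t powr (\<alpha> - 1) * (1 / Gamma \<alpha>)) * norm y"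
    using G \<alpha> by (simp add: add_divide_distrib distrib_right distrib_left mult_ac)
  also have "1 / (\<alpha> * Gamma \<alpha>) = rGamma (\<alpha> + 1)"
  proof -
    have "rGamma (\<alpha> + 1) = rGamma \<alpha> / \<alpha>"
      using \<alpha> rGamma_plus1[of \<alpha>] by (simp add: eq_divide_eq mult.commute)
    then show ?thesis by (simp add: rGamma_inverse_Gamma[of \<alpha>] divide_inverse mult.commute)
  qed
  also have "1 / Gamma \<alpha> = rGamma \<alpha>" by (simp add: rGamma_inverse_Gamma inverse_eq_divide)
  finally show "l (B z) \<le> (b * t powr \<alpha> * rGamma (\<alpha> + 1) + 2 * (M * a) * t powr (\<alpha> - 1) * rGamma \<alpha>) * norm y" .
qed

end

section \<open>Estimates uniform in the order \<alpha>\<close>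

text \<open>The reciprocal Gamma function is continuous even at the pole 0 of Gamma. The interval
  \<open>{0..2}\<close> contains both \<alpha> and \<alpha> + 1.\<close>

lemma rGamma_bounded:
  obtains C :: real where "C > 0" "\<And>x. x \<in> {0..2} \<Longrightarrow> rGamma x \<le> C"
proof -
  have "compact ((rGamma :: real \<Rightarrow> real) ` {0..2})"
    by (intro compact_continuous_image continuous_on_rGamma) auto
  then obtain C where C: "\<And>x. x \<in> {0..2} \<Longrightarrow> norm (rGamma x :: real) \<le> C"
    using compact_imp_bounded by (metis bounded_iff image_eqI)
  show ?thesis
  proof (rule that[of "max C 1"])
    fix x :: real assume "x \<in> {0..2}"
    then show "rGamma x \<le> max C 1" using C[of x] by simp
  qed simp
qed

context analytic_semigroup
begin

lemma T_integrable: "(\<lambda>q. T q v) integrable_on {0..t}"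
  by (intro integrable_continuous_real continuous_on_subset[OF T_continuous]) auto

text \<open>This operator sends A x to \<open>x - T t x\<close>. It is one of the two operators
  \<open>B\<close> to which the inversion of Balakrishnan's formula is applied.\<close>

lemma bounded_linear_integral_T:
  assumes "0 \<le> t"
  shows "bounded_linear (\<lambda>v. integral {0..t} (\<lambda>q. T q v))"
    "norm (integral {0..t} (\<lambda>q. T q v)) \<le> (M * t) * norm v"
proof -
  show bd: "norm (integral {0..t} (\<lambda>q. T q v)) \<le> (M * t) * norm v" for v
  proof -
    have "norm (integral {0..t} (\<lambda>q. T q v)) \<le> (M * norm v) * (t - 0)"
      by (rule integral_bound[OF assms continuous_on_subset[OF T_continuous]]) (auto intro: norm_T_le)
    then show ?thesis by (simp add: mult_ac)
  qed
  show "bounded_linear (\<lambda>v. integral {0..t} (\<lambda>q. T q v))"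
  proof (rule bounded_linear_intro[of _ "M * t"])
    show "integral {0..t} (\<lambda>q. T q (v + w)) = integral {0..t} (\<lambda>q. T q v) + integral {0..t} (\<lambda>q. T q w)" for v w
      by (simp add: blinfun.add_right Henstock_Kurzweil_Integration.integral_add[OF T_integrable T_integrable])
    show "norm (integral {0..t} (\<lambda>q. T q v)) \<le> norm v * (M * t)" for v
      using bd[of v] by (simp add: mult.commute)
  qed (simp add: blinfun.scaleR_right)
qed

lemma T_integral_T:
  assumes "0 \<le> s"
  shows "integral {0..t} (\<lambda>q. T q (T s v)) = T s (integral {0..t} (\<lambda>q. T q v))"
proof -
  have "T s (integral {0..t} (\<lambda>q. T q v)) = integral {0..t} (\<lambda>q. T s (T q v))"
    using integral_linear[OF T_integrable[of v t] blinfun.bounded_linear_right[of "T s"]] by (simp add: o_def)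
  also have "\<dots> = integral {0..t} (\<lambda>q. T q (T s v))"
    by (intro integral_cong) (use assms C0_semigroup_commute[OF C0] in auto)
  finally show ?thesis by simp
qed

text \<open>The integral of \<open>G (u + q) v\<close> over \<open>q\<close> telescopes. The result
  is bounded by \<open>2 * M * norm v\<close> uniformly in \<open>u\<close>, although
  \<open>G u\<close> itself is singular at zero.\<close>

lemma G_integral_T:
  assumes u: "0 < u" and t: "0 \<le> t"
  shows "G u (integral {0..t} (\<lambda>q. T q v)) = T u v - T (u + t) v"
proof -
  have "((\<lambda>q. G (u + q) v) has_integral - T (u + t) v - (- T (u + 0) v)) {0..t}"
  proof (rule fundamental_theorem_of_calculus[OF t])
    fix q assume "q \<in> {0..t}"
    then have q: "0 < u + q" using u by simp
    have 1: "((\<lambda>q. u + q) has_vector_derivative 1) (at q)" by (auto intro!: derivative_eq_intros)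
    from vector_diff_chain_at[OF 1 deriv_Tx[OF q, of v]]
    have "((\<lambda>q. T (u + q) v) has_vector_derivative - G (u + q) v) (at q)" by (simp add: o_def)
    from has_vector_derivative_minus[OF this]
    show "((\<lambda>q. - T (u + q) v) has_vector_derivative G (u + q) v) (at q within {0..t})"
      by (simp add: has_vector_derivative_at_within)
  qed
  moreover have "G u (integral {0..t} (\<lambda>q. T q v)) = integral {0..t} (\<lambda>q. G (u + q) v)"
  proof -
    have "G u (integral {0..t} (\<lambda>q. T q v)) = integral {0..t} (\<lambda>q. G u (T q v))"
      using integral_linear[OF T_integrable[of v t] blinfun.bounded_linear_right[of "G u"]] by (simp add: o_def)
    also have "\<dots> = integral {0..t} (\<lambda>q. G (u + q) v)"
      by (intro integral_cong) (use u G_add(2)[of _ u v] in \<open>auto simp: add.commute\<close>)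
    finally show ?thesis .
  qed
  ultimately show ?thesis by (simp add: integral_unique)
qed

lemma integral_T_generator:
  assumes "(x, z) \<in> A" "0 \<le> t"
  shows "integral {0..t} (\<lambda>q. T q z) = x - T t x"
proof -
  have "((\<lambda>q. T q z) has_integral - T t x - (- T 0 x)) {0..t}"
  proof (rule fundamental_theorem_of_calculus[OF assms(2)])
    fix q assume q: "q \<in> {0..t}"
    have "((\<lambda>t. T t x) has_vector_derivative - T q z) (at q within {0..t})"
      by (rule has_vector_derivative_within_subset[OF C0_semigroup_has_derivative[OF C0 assms(1)]])
        (use q in auto)
    from has_vector_derivative_minus[OF this]
    show "((\<lambda>t. - T t x) has_vector_derivative T q z) (at q within {0..t})" by simp
  qed
  then show ?thesis by (simp add: integral_unique T_zero)
qed

text \<open>Two choices of \<open>B\<close> in \<open>balakrishnan_bound\<close>: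
  \<open>T t\<close>, for which \<open>B z = G t x\<close>, with a = M and b = M^2 / t; and the
  integral of \<open>T\<close> over \<open>{0..t}\<close>, for which \<open>B z = x - T t x\<close>,
  with a = M t and b = 2 M.\<close>

lemma balakrishnan_estimates:
  obtains K where "K > 0"
    "\<And>\<alpha> x y t. 0 < \<alpha> \<Longrightarrow> \<alpha> < 1 \<Longrightarrow> (x, y) \<in> balakrishnan A \<alpha> \<Longrightarrow> 0 < t \<Longrightarrow>
      norm (G t x) \<le> K * t powr (\<alpha> - 1) * norm y"
    "\<And>\<alpha> x y t. 0 < \<alpha> \<Longrightarrow> \<alpha> < 1 \<Longrightarrow> (x, y) \<in> balakrishnan A \<alpha> \<Longrightarrow> 0 < t \<Longrightarrow>
      norm (x - T t x) \<le> K * t powr \<alpha> * norm y"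
proof -
  obtain C :: real where C: "C > 0" "\<And>x. x \<in> {0..2} \<Longrightarrow> rGamma x \<le> C" using rGamma_bounded by blast
  \<comment> \<open>The two choices give the constants 3 M^2 C and 2 (M + M^2) C; the latter is at
    most 4 M^2 C because \<open>M\<close> is at least 1.\<close>
  define K where "K = 4 * M\<^sup>2 * C"
  have K: "K > 0" using C(1) M by (simp add: K_def)
  have M2: "M \<le> M\<^sup>2" using M by (simp add: power2_eq_square)
  have est: "norm (B z) \<le> (b * t powr \<alpha> + 2 * (M * a) * t powr (\<alpha> - 1)) * C * norm y"
    if \<alpha>: "0 < \<alpha>" "\<alpha> < 1" and xz: "(x, z) \<in> A"
      and w: "has_Bochner_integral half_line (\<lambda>r. r powr (\<alpha> - 1) *\<^sub>R resolvent_at A r z) w"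
      and y: "y = (sin (pi * \<alpha>) / pi) *\<^sub>R w"
      and B: "bounded_linear B" "\<And>s v. 0 \<le> s \<Longrightarrow> B (T s v) = T s (B v)"
      and ab: "\<And>v. norm (B v) \<le> a * norm v" "0 < t"
        "\<And>u v. 0 < u \<Longrightarrow> u \<le> t \<Longrightarrow> norm (G u (B v)) \<le> b * norm v" "0 \<le> a" "0 \<le> b"
    for \<alpha> x y z w t a b and B :: "'a \<Rightarrow> 'a"
  proof -
    have "norm (B z) \<le> (b * t powr \<alpha> * rGamma (\<alpha> + 1) + 2 * (M * a) * t powr (\<alpha> - 1) * rGamma \<alpha>) * norm y"
      by (rule balakrishnan_bound[OF \<alpha> xz w y B ab(1-3)])
    also have "\<dots> \<le> (b * t powr \<alpha> * C + 2 * (M * a) * t powr (\<alpha> - 1) * C) * norm y"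
      using C(2)[of "\<alpha> + 1"] C(2)[of \<alpha>] \<alpha> ab M
      by (intro mult_right_mono add_mono mult_left_mono) auto
    finally show ?thesis by (simp add: algebra_simps)
  qed
  show ?thesis
  proof (rule that[OF K])
    fix \<alpha> t x y assume \<alpha>: "0 < \<alpha>" "\<alpha> < 1" and xy: "(x, y) \<in> balakrishnan A \<alpha>" and t: "0 < (t::real)"
    obtain z where xz: "(x, z) \<in> A" and y': "y = (sin (pi * \<alpha>) / pi) *\<^sub>R
      Bochner_integral half_line (\<lambda>r. r powr (\<alpha> - 1) *\<^sub>R resolvent_at A r z)"
      using xy by (auto simp: balakrishnan_def)
    obtain w where w: "has_Bochner_integral half_line (\<lambda>r. r powr (\<alpha> - 1) *\<^sub>R resolvent_at A r z) w"
      using balakrishnan_integral[OF \<alpha> xz] by blast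
    have y: "y = (sin (pi * \<alpha>) / pi) *\<^sub>R w" using y' Bochner_integral_eq[OF w] by simp
    have tt: "t powr \<alpha> = t * t powr (\<alpha> - 1)" using t powr_mult_base[of t "\<alpha> - 1"] by simp
    have "norm (T t z) \<le> ((M * (M / t)) * t powr \<alpha> + 2 * (M * M) * t powr (\<alpha> - 1)) * C * norm y"
    proof (rule est[OF \<alpha> xz w y])
      show "norm (G u (T t v)) \<le> M * (M / t) * norm v" if "0 < u" for u v
      proof -
        have "G u (T t v) = T u (G t v)" using G_add[of t u v] G_add[of u t v] that t by (simp add: add.commute)
        also have "norm \<dots> \<le> M * (M / t * norm v)"
          using norm_T_le[of u "G t v"] norm_G_le[OF t, of v] that M
          by (meson less_imp_le mult_left_mono order_trans zero_le_one)
        finally show ?thesis by simp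
      qed
    qed (use t M in \<open>auto simp: blinfun.bounded_linear_right C0_semigroup_commute[OF C0] norm_T_le\<close>)
    also have "\<dots> = (3 * M\<^sup>2 * C) * (t powr (\<alpha> - 1) * norm y)"
      using t by (simp add: tt power2_eq_square algebra_simps)
    also have "\<dots> \<le> K * (t powr (\<alpha> - 1) * norm y)"
      using C(1) M by (intro mult_right_mono) (auto simp: K_def)
    finally show "norm (G t x) \<le> K * t powr (\<alpha> - 1) * norm y"
      using G_eq[OF xz t] by (simp add: mult.assoc)
    have t0: "0 \<le> t" using t by simp
    have "norm (integral {0..t} (\<lambda>q. T q z)) \<le> ((2 * M) * t powr \<alpha> + 2 * (M * (M * t)) * t powr (\<alpha> - 1)) * C * norm y"
    proof (rule est[OF \<alpha> xz w y bounded_linear_integral_T(1)[OF t0]])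
      show "norm (G u (integral {0..t} (\<lambda>q. T q v))) \<le> 2 * M * norm v" if "0 < u" for u v
        using norm_triangle_ineq4[of "T u v" "T (u + t) v"] norm_T_le[of u v] norm_T_le[of "u + t" v] that t
        by (simp add: G_integral_T)
    qed (use t M bounded_linear_integral_T(2)[OF t0] T_integral_T in auto)
    also have "\<dots> = (2 * (M + M\<^sup>2) * C) * (t powr \<alpha> * norm y)"
      by (simp add: tt power2_eq_square algebra_simps)
    also have "\<dots> \<le> K * (t powr \<alpha> * norm y)"
      using C(1) M2 by (intro mult_right_mono) (auto simp: K_def)
    finally show "norm (x - T t x) \<le> K * t powr \<alpha> * norm y"
      using integral_T_generator[OF xz t0] by (simp add: mult.assoc)
  qed
qed

text \<open>For \<alpha> = 0 and \<alpha> = 1 the bounds come directly from \<open>norm_T\<close>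
  and \<open>norm_G\<close>, with constants at most 2 M. The interior orders have the constant
  \<open>K\<close>, so the maximum is uniform on the closed interval.\<close>

lemma frac_power_estimates:
  obtains K where "K > 0"
    "\<And>\<alpha> x y t. \<alpha> \<in> {0..1} \<Longrightarrow> (x, y) \<in> frac_power A \<alpha> \<Longrightarrow> 0 < t \<Longrightarrow>
      norm (G t x) \<le> K * t powr (\<alpha> - 1) * norm y"
    "\<And>\<alpha> x y t. \<alpha> \<in> {0..1} \<Longrightarrow> (x, y) \<in> frac_power A \<alpha> \<Longrightarrow> 0 < t \<Longrightarrow>
      norm (x - T t x) \<le> K * t powr \<alpha> * norm y"
proof -
  obtain K where K: "K > 0"
    and K1: "\<And>\<alpha> x y t. 0 < \<alpha> \<Longrightarrow> \<alpha> < 1 \<Longrightarrow> (x, y) \<in> balakrishnan A \<alpha> \<Longrightarrow> 0 < t \<Longrightarrow>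
      norm (G t x) \<le> K * t powr (\<alpha> - 1) * norm y"
    and K2: "\<And>\<alpha> x y t. 0 < \<alpha> \<Longrightarrow> \<alpha> < 1 \<Longrightarrow> (x, y) \<in> balakrishnan A \<alpha> \<Longrightarrow> 0 < t \<Longrightarrow>
      norm (x - T t x) \<le> K * t powr \<alpha> * norm y"
    using balakrishnan_estimates by blast
  define K' where "K' = max K (2 * M)"
  have "norm (G t x) \<le> K' * t powr (\<alpha> - 1) * norm y \<and> norm (x - T t x) \<le> K' * t powr \<alpha> * norm y"
    if \<alpha>: "\<alpha> \<in> {0..1}" and xy: "(x, y) \<in> frac_power A \<alpha>" and t: "0 < t" for \<alpha> x y t
  proof -
    consider "\<alpha> = 0" | "\<alpha> = 1" | "0 < \<alpha>" "\<alpha> < 1" using \<alpha> by force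
    then show ?thesis
    proof cases
      case 1
      then have "y = x" using xy by (simp add: frac_power_def)
      have "norm (G t x) \<le> (2 * M) * t powr (\<alpha> - 1) * norm y"
      proof -
        have "M / t * norm x \<le> (2 * M) / t * norm x" using M t by (intro mult_right_mono divide_right_mono) auto
        then show ?thesis using norm_G_le[OF t, of x] t 1 \<open>y = x\<close> by (simp add: powr_minus_divide)
      qed
      also have "\<dots> \<le> K' * t powr (\<alpha> - 1) * norm y" by (intro mult_right_mono) (auto simp: K'_def)
      finally have g: "norm (G t x) \<le> K' * t powr (\<alpha> - 1) * norm y" .
      have "norm (x - T t x) \<le> norm x + M * norm x"
        using norm_triangle_ineq4[of x "T t x"] norm_T_le[of t x] t by simp
      also have "\<dots> \<le> (2 * M) * norm x" using mult_right_mono[OF M, of "norm x"] by simp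
      also have "\<dots> \<le> K' * norm x" by (intro mult_right_mono) (auto simp: K'_def)
      finally show ?thesis using g t 1 \<open>y = x\<close> by simp
    next
      case 2
      then have xy': "(x, y) \<in> A" using xy by (simp add: frac_power_def)
      have KM: "M \<le> K'" using M by (simp add: K'_def)
      have "norm (G t x) \<le> M * norm y" using G_eq[OF xy' t] norm_T_le[of t y] t by simp
      also have "\<dots> \<le> K' * norm y" using KM by (intro mult_right_mono) auto
      finally have g: "norm (G t x) \<le> K' * t powr (\<alpha> - 1) * norm y" using 2 t by simp
      have "norm (x - T t x) \<le> (M * t) * norm y"
        using integral_T_generator[OF xy'] bounded_linear_integral_T(2)[of t y] t by simp
      also have "\<dots> \<le> (K' * t) * norm y" using KM t by (intro mult_right_mono) auto
      finally show ?thesis using g 2 t by simp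
    next
      case 3
      \<comment> \<open>Both estimates are closed conditions on a pair of the graph, so they survive
        the closure in \<open>frac_power\<close>.\<close>
      let ?S = "{p. norm (G t (fst p)) \<le> K * t powr (\<alpha> - 1) * norm (snd p) \<and>
        norm (fst p - T t (fst p)) \<le> K * t powr \<alpha> * norm (snd p)}"
      have "closed ?S"
        by (intro closed_Collect_conj closed_Collect_le continuous_intros)
      moreover have "balakrishnan A \<alpha> \<subseteq> ?S" using K1 K2 3 t by auto
      ultimately have "closure (balakrishnan A \<alpha>) \<subseteq> ?S" by (rule closure_minimal[rotated])
      then have "(x, y) \<in> ?S" using xy 3 by (auto simp: frac_power_def)
      moreover have "K * t powr (\<alpha> - 1) * norm y \<le> K' * t powr (\<alpha> - 1) * norm y"
        "K * t powr \<alpha> * norm y \<le> K' * t powr \<alpha> * norm y"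
        by (intro mult_right_mono; simp add: K'_def)+
      ultimately show ?thesis by auto
    qed
  qed
  then show ?thesis using that[of K'] K by (simp add: K'_def)
qed

section \<open>Taylor remainder and its integral against the subordinator\<close>

text \<open>For \<open>s \<ge> t / 2\<close> the second derivative A^2 exp(-rA) x is of order
  t^(\<alpha> - 2) between \<open>s\<close> and \<open>t\<close>. It may be far larger near zero, so
  for \<open>s < t / 2\<close> the three terms are bounded separately by N t^\<alpha> each, and t^2
  is at most 4 (s - t)^2.\<close>

lemma taylor_estimate:
  assumes t: "0 < t" and s: "0 \<le> s" and \<alpha>: "0 \<le> \<alpha>" "\<alpha> \<le> 1" and N: "0 \<le> N"
    and G: "\<And>r. 0 < r \<Longrightarrow> norm (G r x) \<le> N * r powr (\<alpha> - 1)"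
    and D: "\<And>r. 0 < r \<Longrightarrow> norm (x - T r x) \<le> N * r powr \<alpha>"
  shows "norm (T s x - T t x + (s - t) *\<^sub>R G t x) \<le> 16 * M * N * t powr (\<alpha> - 2) * (s - t)\<^sup>2"
proof (cases "s < t / 2")
  case True
  have tt: "t powr \<alpha> = t * t powr (\<alpha> - 1)" "t powr \<alpha> = t\<^sup>2 * t powr (\<alpha> - 2)"
    using t powr_mult_base[of t "\<alpha> - 1"] powr_mult_base[of t "\<alpha> - 2"] by (auto simp: power2_eq_square mult.assoc)
  have "norm (x - T s x) \<le> N * t powr \<alpha>"
  proof (cases "s = 0")
    case False
    then have "norm (x - T s x) \<le> N * s powr \<alpha>" using D s by simp
    also have "\<dots> \<le> N * t powr \<alpha>" using True s t \<alpha> N by (intro mult_left_mono powr_mono2) auto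
    finally show ?thesis .
  qed (use T_zero N in simp)
  moreover have "norm (x - T t x) \<le> N * t powr \<alpha>" by (rule D[OF t])
  moreover have "norm ((s - t) *\<^sub>R G t x) \<le> N * t powr \<alpha>"
  proof -
    have "\<bar>s - t\<bar> * norm (G t x) \<le> t * (N * t powr (\<alpha> - 1))"
      using True s t G[OF t] by (intro mult_mono) auto
    then show ?thesis by (simp add: tt(1) mult.left_commute)
  qed
  moreover have "T s x - T t x + (s - t) *\<^sub>R G t x = (x - T t x) - (x - T s x) + (s - t) *\<^sub>R G t x" by simp
  moreover have "norm ((x - T t x) - (x - T s x) + (s - t) *\<^sub>R G t x) \<le>
      norm (x - T t x) + norm (x - T s x) + norm ((s - t) *\<^sub>R G t x)"
    by (meson add_right_mono norm_triangle_ineq norm_triangle_ineq4 order_trans)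
  ultimately have "norm (T s x - T t x + (s - t) *\<^sub>R G t x) \<le> 3 * N * t powr \<alpha>" by simp
  also have "\<dots> = 3 * N * t powr (\<alpha> - 2) * t\<^sup>2" unfolding tt(2) by simp
  also have "\<dots> \<le> 3 * N * t powr (\<alpha> - 2) * (4 * (s - t)\<^sup>2)"
  proof (intro mult_left_mono)
    have "(t / 2)\<^sup>2 \<le> (t - s)\<^sup>2" using True t by (intro power_mono) auto
    then show "t\<^sup>2 \<le> 4 * (s - t)\<^sup>2" by (simp add: power2_commute[of s t] power_divide)
  qed (use N in auto)
  also have "\<dots> = 12 * (N * t powr (\<alpha> - 2) * (s - t)\<^sup>2)" by simp
  also have "\<dots> \<le> (16 * M) * (N * t powr (\<alpha> - 2) * (s - t)\<^sup>2)"
    using M N by (intro mult_right_mono) auto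
  finally show ?thesis by (simp add: mult.assoc)
next
  case False
  \<comment> \<open>The 16 is 4 times 4: one half-time factor costs \<open>4 * M / t\<close>, the
    other at most N 4^(1 - \<alpha>) t^(\<alpha> - 1), and 4^(1 - \<alpha>) is at most 4. This
    exceeds the 12 of the other case.\<close>
  have G2: "norm (G (r / 2) (G (r / 2) x)) \<le> 16 * M * N * t powr (\<alpha> - 2)" if r: "t / 2 \<le> r" for r
  proof -
    have r0: "0 < r" using r t by simp
    have "norm (G (r / 2) (G (r / 2) x)) \<le> M / (r / 2) * norm (G (r / 2) x)"
      using r0 by (intro norm_G_le) simp
    also have "\<dots> \<le> (4 * M / t) * (N * (4 * t powr (\<alpha> - 1)))"
    proof (rule mult_mono)
      have "M / (r / 2) \<le> M / (t / 4)" using r t M by (intro divide_left_mono) auto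
      then show "M / (r / 2) \<le> 4 * M / t" by (simp add: mult.commute)
      have "norm (G (r / 2) x) \<le> N * (r / 2) powr (\<alpha> - 1)" using r0 by (intro G) simp
      also have "\<dots> \<le> N * (4 * t powr (\<alpha> - 1))"
      proof (rule mult_left_mono[OF _ N])
        have "(r / 2) powr (\<alpha> - 1) \<le> (t / 4) powr (\<alpha> - 1)" using r t \<alpha> by (intro powr_mono2') auto
        also have "\<dots> = 4 powr (1 - \<alpha>) * t powr (\<alpha> - 1)"
          using t by (simp add: powr_divide powr_minus_divide[of 4 "1 - \<alpha>", simplified])
        also have "\<dots> \<le> 4 powr 1 * t powr (\<alpha> - 1)" using \<alpha> by (intro mult_right_mono powr_mono) auto
        finally show "(r / 2) powr (\<alpha> - 1) \<le> 4 * t powr (\<alpha> - 1)" by simp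
      qed
      finally show "norm (G (r / 2) x) \<le> N * (4 * t powr (\<alpha> - 1))" .
    qed (use M t in auto)
    also have "t powr (\<alpha> - 1) = t * t powr (\<alpha> - 2)" using t powr_mult_base[of t "\<alpha> - 2"] by simp
    finally show ?thesis using t by (simp add: mult_ac)
  qed
  show ?thesis
  proof (rule norm_le_functional)
    fix l :: "'a \<Rightarrow> real" assume l: "bounded_linear l" "\<And>v. \<bar>l v\<bar> \<le> norm v"
    interpret l: bounded_linear l by fact
    define d where "d m r = (if m = 0 then l (T r x) else if m = 1 then - l (G r x) else l (G (r / 2) (G (r / 2) x)))"
      for m :: nat and r
    show "l (T s x - T t x + (s - t) *\<^sub>R G t x) \<le> 16 * M * N * t powr (\<alpha> - 2) * (s - t)\<^sup>2"
    proof (cases "s = t")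
      case st: False
      have "\<exists>r. (if s < t then s < r \<and> r < t else t < r \<and> r < s) \<and>
          l (T s x) = (\<Sum>m<2. d m t / fact m * (s - t) ^ m) + d 2 r / fact 2 * (s - t) ^ 2"
      proof (rule Taylor[of 2 d "\<lambda>r. l (T r x)" "t / 2" "max s t"])
        show "\<forall>m r. m < 2 \<and> t / 2 \<le> r \<and> r \<le> max s t \<longrightarrow> (d m has_real_derivative d (Suc m) r) (at r)"
        proof (intro allI impI)
          fix m :: nat and r assume mr: "m < 2 \<and> t / 2 \<le> r \<and> r \<le> max s t"
          then have r: "0 < r" using t by linarith
          have "(d 0 has_real_derivative d 1 r) (at r)"
            using l.has_vector_derivative[OF deriv_Tx[OF r, of x]]
            by (simp add: d_def[abs_def] l.neg has_real_derivative_iff_has_vector_derivative)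
          moreover have "(d 1 has_real_derivative d 2 r) (at r)"
            using has_vector_derivative_minus[OF l.has_vector_derivative[OF deriv_Gx[OF r, of x]]]
            by (simp add: d_def[abs_def] l.neg has_real_derivative_iff_has_vector_derivative)
          moreover have "m = 0 \<or> m = 1" using mr by auto
          ultimately show "(d m has_real_derivative d (Suc m) r) (at r)" by (auto simp: numeral_2_eq_2)
        qed
      qed (use False st t in \<open>auto simp: d_def\<close>)
      then obtain r where r: "min s t < r" and eq: "l (T s x) = (\<Sum>m<2. d m t / fact m * (s - t) ^ m) + d 2 r / fact 2 * (s - t) ^ 2"
        by (auto split: if_splits)
      have "l (T s x - T t x + (s - t) *\<^sub>R G t x) = d 2 r / 2 * (s - t)\<^sup>2"
        using eq by (simp add: numeral_2_eq_2 d_def l.add l.diff l.scaleR)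
      also have "\<dots> \<le> (16 * M * N * t powr (\<alpha> - 2)) * (s - t)\<^sup>2"
      proof (rule mult_right_mono)
        have "d 2 r \<le> 16 * M * N * t powr (\<alpha> - 2)"
          using l(2)[of "G (r / 2) (G (r / 2) x)"] G2[of r] r False t by (simp add: d_def min_def split: if_splits)
        moreover have "0 \<le> 16 * M * N * t powr (\<alpha> - 2)" using M N by simp
        ultimately show "d 2 r / 2 \<le> 16 * M * N * t powr (\<alpha> - 2)" by linarith
      qed simp
      finally show ?thesis .
    qed (use l.zero in simp)
  qed
qed

text \<open>The measure \<open>\<nu>\<close> has mean \<open>\<tau>\<close>, so the first-order term of Taylor's formula integrates to zero.\<close>

lemma subordination_estimate:
  assumes sets: "sets \<nu> = sets (restrict_space borel {0..})" and prob: "emeasure \<nu> (space \<nu>) = 1"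
    and mean: "has_bochner_integral \<nu> (\<lambda>s. s) \<tau>"
    and int2: "integrable \<nu> (\<lambda>s. (s - \<tau>)\<^sup>2)" and var: "(\<integral>s. (s - \<tau>)\<^sup>2 \<partial>\<nu>) \<le> V"
    and c: "0 < c" and \<tau>: "0 < \<tau>" and t: "t = c * \<tau>" and \<alpha>: "0 \<le> \<alpha>" "\<alpha> \<le> 1" and N: "0 \<le> N"
    and G: "\<And>r. 0 < r \<Longrightarrow> norm (G r x) \<le> N * r powr (\<alpha> - 1)"
    and D: "\<And>r. 0 < r \<Longrightarrow> norm (x - T r x) \<le> N * r powr \<alpha>"
  shows "norm (Bochner_integral \<nu> (\<lambda>s. generated_semigroup (scale_op c A) s x) - T t x)
    \<le> 16 * M * N * t powr (\<alpha> - 2) * (c\<^sup>2 * V)"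
proof -
  have sp: "space \<nu> = {0..}" using sets_eq_imp_space_eq[OF sets] by (simp add: space_restrict_space)
  interpret prob_space \<nu> by (rule prob_spaceI) (rule prob)
  have t0: "0 < t" using t c \<tau> by simp
  have "\<exists>y. has_Bochner_integral \<nu> (\<lambda>s. T (c * s) x) y"
  proof (rule has_Bochner_integral_exists[OF sets, where a = "\<lambda>_. 0" and b = "\<lambda>n. real n"])
    show "{0..} = (\<Union>n. {0..real n})" by (auto simp: real_arch_simple)
    show "incseq (\<lambda>n. {0..real n})" by (intro monoI) auto
    show "emeasure \<nu> {0..real n} < \<infinity>" for n unfolding infinity_ennreal_def less_top[symmetric] by (rule emeasure_finite)
    show "continuous_on {0..} (\<lambda>s. T (c * s) x)"
      by (rule continuous_on_compose2[OF T_continuous]) (use c in \<open>auto intro!: continuous_intros\<close>)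
    have "(\<integral>\<^sup>+s. norm (T (c * s) x) \<partial>\<nu>) \<le> (\<integral>\<^sup>+s. ennreal (M * norm x) \<partial>\<nu>)"
      by (intro nn_integral_mono ennreal_leI norm_T_le) (use sp c in auto)
    also have "\<dots> < \<infinity>" using prob by simp
    finally show "(\<integral>\<^sup>+s. norm (T (c * s) x) \<partial>\<nu>) < \<infinity>" .
  qed
  then obtain y where y: "has_Bochner_integral \<nu> (\<lambda>s. T (c * s) x) y" by blast
  have "has_Bochner_integral \<nu> (\<lambda>s. generated_semigroup (scale_op c A) s x) y"
    by (rule has_Bochner_integral_cong[THEN iffD1, OF _ y])
      (use sp generated_semigroup_scale[OF C0 dense c] in simp)
  then have "Bochner_integral \<nu> (\<lambda>s. generated_semigroup (scale_op c A) s x) = y"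
    by (rule Bochner_integral_eq)
  moreover have "norm (y - T t x) \<le> 16 * M * N * t powr (\<alpha> - 2) * (c\<^sup>2 * V)"
  proof (rule norm_le_functional)
    fix l :: "'a \<Rightarrow> real" assume l: "bounded_linear l" "\<And>v. \<bar>l v\<bar> \<le> norm v"
    interpret l: bounded_linear l by fact
    let ?C = "16 * M * N * t powr (\<alpha> - 2)"
    have hy: "has_bochner_integral \<nu> (\<lambda>s. l (T (c * s) x)) (l y)"
      by (rule has_Bochner_integral_functional[OF y l(1)])
    have const: "has_bochner_integral \<nu> (\<lambda>s. u) u" for u :: real
      by (simp add: has_bochner_integral_iff prob_space)
    have "has_bochner_integral \<nu> (\<lambda>s. l (T (c * s) x) - l (T t x) + (c * s - c * \<tau>) * l (G t x))
        (l y - l (T t x) + (c * \<tau> - c * \<tau>) * l (G t x))"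
      by (intro has_bochner_integral_add has_bochner_integral_diff has_bochner_integral_mult_left
          has_bochner_integral_mult_right hy mean const)
    then have int: "integrable \<nu> (\<lambda>s. l (T (c * s) x) - l (T t x) + (c * s - c * \<tau>) * l (G t x))"
      and eq: "(\<integral>s. l (T (c * s) x) - l (T t x) + (c * s - c * \<tau>) * l (G t x) \<partial>\<nu>) = l (y - T t x)"
      by (auto simp: has_bochner_integral_iff l.diff)
    have "l (y - T t x) \<le> (\<integral>s. ?C * (c\<^sup>2 * (s - \<tau>)\<^sup>2) \<partial>\<nu>)"
      unfolding eq[symmetric]
    proof (rule integral_mono[OF int])
      show "integrable \<nu> (\<lambda>s. ?C * (c\<^sup>2 * (s - \<tau>)\<^sup>2))" using int2 by simp
      fix s assume "s \<in> space \<nu>"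
      then have s: "0 \<le> c * s" using sp c by simp
      have "l (T (c * s) x) - l (T t x) + (c * s - c * \<tau>) * l (G t x) = l (T (c * s) x - T t x + (c * s - t) *\<^sub>R G t x)"
        by (simp add: l.add l.diff l.scaleR t)
      also have "\<dots> \<le> norm (T (c * s) x - T t x + (c * s - t) *\<^sub>R G t x)" using l(2) abs_le_D1 by blast
      also have "\<dots> \<le> ?C * (c * s - t)\<^sup>2" by (rule taylor_estimate[OF t0 s \<alpha> N G D])
      also have "(c * s - t)\<^sup>2 = c\<^sup>2 * (s - \<tau>)\<^sup>2"
        by (simp add: t flip: right_diff_distrib power_mult_distrib)
      finally show "l (T (c * s) x) - l (T t x) + (c * s - c * \<tau>) * l (G t x) \<le> ?C * (c\<^sup>2 * (s - \<tau>)\<^sup>2)" .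
    qed
    also have "\<dots> = ?C * (c\<^sup>2 * (\<integral>s. (s - \<tau>)\<^sup>2 \<partial>\<nu>))" by simp
    also have "\<dots> \<le> ?C * (c\<^sup>2 * V)" using var M N by (intro mult_left_mono) auto
    finally show "l (y - T t x) \<le> ?C * (c\<^sup>2 * V)" .
  qed
  ultimately show ?thesis by simp
qed

end

section \<open>Completely monotone functions as Laplace transforms\<close>

abbreviation right_half_plane :: "complex set" where
  "right_half_plane \<equiv> {z. 0 < Re z}"

lemma open_right_half_plane: "open right_half_plane"
  by (rule open_halfspace_Re_gt)

lemma holomorphic_real_deriv:
  assumes g: "g holomorphic_on right_half_plane" and real: "\<And>x. 0 < x \<Longrightarrow> Im (g (of_real x)) = 0"
    and F: "\<And>x. 0 < x \<Longrightarrow> F x = Re (g (of_real x))" and x: "0 < x"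
  shows "(F has_real_derivative Re (deriv g (of_real x))) (at x)" "Im (deriv g (of_real x)) = 0"
proof -
  have "(g has_field_derivative deriv g (of_real x)) (at (of_real x))"
    by (rule holomorphic_derivI[OF g open_right_half_plane]) (use x in simp)
  then have v: "((\<lambda>r. g (of_real r)) has_vector_derivative deriv g (of_real x)) (at x)"
    by (rule has_vector_derivative_real_field)
  have "((\<lambda>r. Re (g (of_real r))) has_vector_derivative Re (deriv g (of_real x))) (at x)"
    by (rule bounded_linear.has_vector_derivative[OF bounded_linear_Re v])
  then have "(F has_vector_derivative Re (deriv g (of_real x))) (at x)"
    by (rule has_vector_derivative_transform_within_open[of _ _ _ "{0<..}"]) (use F x in auto)
  then show "(F has_real_derivative Re (deriv g (of_real x))) (at x)"
    by (simp add: has_real_derivative_iff_has_vector_derivative)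
  have "((\<lambda>r. Im (g (of_real r))) has_vector_derivative Im (deriv g (of_real x))) (at x)"
    by (rule bounded_linear.has_vector_derivative[OF bounded_linear_Im v])
  then have "((\<lambda>r. 0) has_vector_derivative Im (deriv g (of_real x))) (at x)"
    by (rule has_vector_derivative_transform_within_open[of _ _ _ "{0<..}"]) (use real x in auto)
  then show "Im (deriv g (of_real x)) = 0"
    using has_vector_derivative_const vector_derivative_unique_at by blast
qed

text \<open>Transfers the sign conditions, which concern real derivatives, to complex ones. Complex
  Taylor series can then be used for the Laplace transforms.\<close>

lemma deriv_pos_restriction:
  assumes \<phi>: "bernstein_function \<phi>" and x: "0 < x"
  shows "(deriv ^^ n) (pos_restriction \<phi>) x = Re ((deriv ^^ n) \<phi> (of_real x))"
    "Im ((deriv ^^ n) \<phi> (of_real x)) = 0"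
proof -
  have "(deriv ^^ n) (pos_restriction \<phi>) x = Re ((deriv ^^ n) \<phi> (of_real x)) \<and>
    Im ((deriv ^^ n) \<phi> (of_real x)) = 0"
    using x
  proof (induction n arbitrary: x)
    case 0
    then show ?case
      using \<phi> by (simp add: pos_restriction_def bernstein_function_def complex_is_Real_iff)
  next
    case (Suc n)
    have hol: "(deriv ^^ n) \<phi> holomorphic_on right_half_plane"
      using \<phi> by (intro holomorphic_higher_deriv open_right_half_plane) (simp add: bernstein_function_def)
    note d = holomorphic_real_deriv[OF hol conjunct2[OF Suc.IH] conjunct1[OF Suc.IH] Suc.prems]
    show ?case using DERIV_imp_deriv[OF d(1)] d(2) by simp
  qed
  then show "(deriv ^^ n) (pos_restriction \<phi>) x = Re ((deriv ^^ n) \<phi> (of_real x))"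
    "Im ((deriv ^^ n) \<phi> (of_real x)) = 0" by auto
qed

lemma bernstein_deriv_sign:
  assumes \<phi>: "bernstein_function \<phi>" and x: "0 < x"
  shows "(- 1) ^ n * (deriv ^^ Suc n) \<phi> (of_real x) \<in> \<real>\<^sub>\<ge>\<^sub>0"
proof -
  have "0 \<le> (- 1) ^ n * (deriv ^^ n) (deriv (pos_restriction \<phi>)) x"
    using \<phi> x by (auto simp: bernstein_function_def bernstein_on_pos_def completely_monotone_def)
  also have "(deriv ^^ n) (deriv (pos_restriction \<phi>)) x = (deriv ^^ Suc n) (pos_restriction \<phi>) x"
    by (simp add: funpow_swap1)
  also have "\<dots> = Re ((deriv ^^ Suc n) \<phi> (of_real x))" by (rule deriv_pos_restriction[OF \<phi> x])
  finally have "0 \<le> (- 1) ^ n * Re ((deriv ^^ Suc n) \<phi> (of_real x))" .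
  moreover have "(- 1) ^ n * (deriv ^^ Suc n) \<phi> (of_real x) = of_real ((- 1) ^ n * Re ((deriv ^^ Suc n) \<phi> (of_real x)))"
    using deriv_pos_restriction(2)[OF \<phi> x, of "Suc n"] by (simp add: complex_eq_iff del: funpow.simps)
  ultimately show ?thesis by (simp only: nonneg_Reals_of_real_iff)
qed

lemma nonneg_Reals_sum: "(\<And>i. i \<in> I \<Longrightarrow> f i \<in> \<real>\<^sub>\<ge>\<^sub>0) \<Longrightarrow> sum f I \<in> \<real>\<^sub>\<ge>\<^sub>0"
  by (induction I rule: infinite_finite_induct) auto

text \<open>By the product rule, since $(e^{-\tau\varphi})' = -\tau\varphi' e^{-\tau\varphi}$.\<close>

lemma exp_bernstein_deriv_sign:
  fixes \<phi> :: "complex \<Rightarrow> complex"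
  assumes \<phi>: "bernstein_function \<phi>" and \<tau>: "0 \<le> \<tau>" and x: "0 < x"
  shows "(- 1) ^ n * (deriv ^^ n) (\<lambda>z. exp (- of_real \<tau> * \<phi> z)) (of_real x) \<in> \<real>\<^sub>\<ge>\<^sub>0"
proof (induction n rule: less_induct)
  case (less n)
  let ?h = "\<lambda>z. exp (- of_real \<tau> * \<phi> z)" and ?x = "complex_of_real x"
  have hol: "\<phi> holomorphic_on right_half_plane" using \<phi> by (simp add: bernstein_function_def)
  have holh: "?h holomorphic_on right_half_plane" by (intro holomorphic_intros hol)
  have hold: "deriv \<phi> holomorphic_on right_half_plane" by (intro holomorphic_deriv hol open_right_half_plane)
  have mem: "?x \<in> right_half_plane" using x by simp
  show ?case
  proof (cases n)
    case 0
    have "\<phi> ?x = of_real (Re (\<phi> ?x))"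
      using deriv_pos_restriction(2)[OF \<phi> x, of 0] by (simp add: complex_eq_iff)
    then have "?h ?x = of_real (exp (- \<tau> * Re (\<phi> ?x)))"
      by (metis exp_of_real of_real_minus of_real_mult)
    then show ?thesis using 0 by simp
  next
    case (Suc m)
    have "(deriv ^^ n) ?h ?x = (deriv ^^ m) (deriv ?h) ?x" by (simp add: Suc funpow_swap1)
    also have "\<dots> = (deriv ^^ m) (\<lambda>z. - of_real \<tau> * (deriv \<phi> z * ?h z)) ?x"
    proof (rule higher_deriv_transform_within_open[OF _ _ open_right_half_plane mem])
      show "deriv ?h holomorphic_on right_half_plane" by (intro holomorphic_deriv holh open_right_half_plane)
      show "(\<lambda>z. - of_real \<tau> * (deriv \<phi> z * ?h z)) holomorphic_on right_half_plane"
        by (intro holomorphic_intros hold hol)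
      fix w assume "w \<in> right_half_plane"
      then have "(\<phi> has_field_derivative deriv \<phi> w) (at w)"
        by (rule holomorphic_derivI[OF hol open_right_half_plane])
      then have "(?h has_field_derivative ?h w * (- of_real \<tau> * deriv \<phi> w)) (at w)"
        by (auto intro!: derivative_eq_intros)
      then show "deriv ?h w = - of_real \<tau> * (deriv \<phi> w * ?h w)"
        by (simp add: DERIV_imp_deriv mult_ac)
    qed
    also have "\<dots> = - of_real \<tau> * (deriv ^^ m) (\<lambda>z. deriv \<phi> z * ?h z) ?x"
      by (rule higher_deriv_cmult[OF _ mem open_right_half_plane]) (intro holomorphic_intros hold hol)
    also have "(deriv ^^ m) (\<lambda>z. deriv \<phi> z * ?h z) ?x =
        (\<Sum>i = 0..m. of_nat (m choose i) * (deriv ^^ i) (deriv \<phi>) ?x * (deriv ^^ (m - i)) ?h ?x)"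
      by (rule higher_deriv_mult[OF hold holh open_right_half_plane mem])
    finally have d: "(deriv ^^ n) ?h ?x = - of_real \<tau> *
      (\<Sum>i = 0..m. of_nat (m choose i) * (deriv ^^ i) (deriv \<phi>) ?x * (deriv ^^ (m - i)) ?h ?x)" .
    \<comment> \<open>One sign is spent on \<open>- \<tau>\<close>, as \<open>n = Suc m\<close>. The
      remaining \<open>(- 1) ^ m\<close> is distributed over the two factors of each Leibniz term,
      which are then nonnegative by \<open>bernstein_deriv_sign\<close> and by induction.\<close>
    have "(- 1) ^ n * (deriv ^^ n) ?h ?x =
        of_real \<tau> * (\<Sum>i = 0..m. (- 1) ^ m * (of_nat (m choose i) * (deriv ^^ i) (deriv \<phi>) ?x * (deriv ^^ (m - i)) ?h ?x))"
      unfolding d sum_distrib_left[symmetric] by (simp add: Suc)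
    also have "(\<Sum>i = 0..m. (- 1) ^ m * (of_nat (m choose i) * (deriv ^^ i) (deriv \<phi>) ?x * (deriv ^^ (m - i)) ?h ?x)) =
        (\<Sum>i = 0..m. of_nat (m choose i) * ((- 1) ^ i * (deriv ^^ Suc i) \<phi> ?x) * ((- 1) ^ (m - i) * (deriv ^^ (m - i)) ?h ?x))"
    proof (rule sum.cong)
      fix i assume "i \<in> {0..m}"
      then have "(- 1 :: complex) ^ m = (- 1) ^ i * (- 1) ^ (m - i)" by (simp flip: power_add)
      then show "(- 1) ^ m * (of_nat (m choose i) * (deriv ^^ i) (deriv \<phi>) ?x * (deriv ^^ (m - i)) ?h ?x) =
          of_nat (m choose i) * ((- 1) ^ i * (deriv ^^ Suc i) \<phi> ?x) * ((- 1) ^ (m - i) * (deriv ^^ (m - i)) ?h ?x)"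
        by (simp add: funpow_swap1 mult_ac)
    qed simp
    also have "of_real \<tau> * \<dots> \<in> \<real>\<^sub>\<ge>\<^sub>0"
    proof (rule nonneg_Reals_mult_I[OF _ nonneg_Reals_sum])
      fix i assume i: "i \<in> {0..m}"
      have "(of_nat (m choose i) :: complex) \<in> \<real>\<^sub>\<ge>\<^sub>0" by (simp add: complex_nonneg_Reals_iff)
      moreover have "(- 1) ^ i * (deriv ^^ Suc i) \<phi> ?x \<in> \<real>\<^sub>\<ge>\<^sub>0"
        by (rule bernstein_deriv_sign[OF \<phi> x])
      moreover have "(- 1) ^ (m - i) * (deriv ^^ (m - i)) ?h ?x \<in> \<real>\<^sub>\<ge>\<^sub>0"
        using less[of "m - i"] Suc by auto
      ultimately show "of_nat (m choose i) * ((- 1) ^ i * (deriv ^^ Suc i) \<phi> ?x) *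
        ((- 1) ^ (m - i) * (deriv ^^ (m - i)) ?h ?x) \<in> \<real>\<^sub>\<ge>\<^sub>0"
        by (rule nonneg_Reals_mult_I[OF nonneg_Reals_mult_I])
    qed (use \<tau> in simp)
    finally show ?thesis .
  qed
qed

section \<open>Post-Widder approximation and its weak limit\<close>

text \<open>A converse of Abel's theorem, elementary for nonnegative coefficients: partial sums stay
  below \<open>g q\<close> as \<open>q\<close> tends to 1, and \<open>g q\<close> stays below the
  full sum. It shows that the Post-Widder measures have total mass one.\<close>

lemma power_series_sums_one:
  fixes a :: "nat \<Rightarrow> real"
  assumes nonneg: "\<And>n. 0 \<le> a n" and sums: "\<And>q. 0 < q \<Longrightarrow> q < 1 \<Longrightarrow> (\<lambda>n. a n * q ^ n) sums g q"
    and lim: "(g \<longlongrightarrow> 1) (at_left 1)"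
  shows "a sums 1"
proof -
  have ev: "eventually (\<lambda>q::real. 0 < q \<and> q < 1) (at_left 1)"
    by (auto simp: eventually_at dist_real_def intro!: exI[of _ 1])
  have le: "sum a {..<N} \<le> 1" for N
  proof (rule tendsto_le[OF _ lim])
    have "((\<lambda>q. \<Sum>n<N. a n * q ^ n) \<longlongrightarrow> (\<Sum>n<N. a n * 1 ^ n)) (at_left 1)" by (intro tendsto_intros)
    then show "((\<lambda>q. \<Sum>n<N. a n * q ^ n) \<longlongrightarrow> sum a {..<N}) (at_left 1)" by simp
    show "eventually (\<lambda>q. (\<Sum>n<N. a n * q ^ n) \<le> g q) (at_left 1)"
      using ev
    proof eventually_elim
      case (elim q)
      then show ?case
        using sum_le_suminf[OF sums_summable[OF sums[of q]], of "{..<N}"] nonneg sums_unique[OF sums[of q]] by simp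
    qed
  qed simp
  have sm: "summable a" by (rule summableI_nonneg_bounded[of _ 1]) (use nonneg le in auto)
  have "suminf a \<le> 1" by (rule suminf_le_const[OF sm le])
  moreover have "1 \<le> suminf a"
  proof (rule tendsto_upperbound[OF lim])
    show "eventually (\<lambda>q. g q \<le> suminf a) (at_left 1)"
      using ev
    proof eventually_elim
      case (elim q)
      have "a n * q ^ n \<le> a n" for n using nonneg[of n] elim power_le_one[of q n] by (intro mult_left_le) auto
      then show ?case using sums_le[OF _ sums[of q] summable_sums[OF sm]] elim by simp
    qed
  qed simp
  ultimately show ?thesis using summable_sums[OF sm] by simp
qed

text \<open>As a density against counting measure, the mass function \<open>a\<close> turns the
  expectation of \<open>F\<close> into a series.\<close>

lemma integral_embed_pmf:
  fixes F :: "nat \<Rightarrow> complex" and a :: "nat \<Rightarrow> real"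
  assumes nonneg: "\<And>n. 0 \<le> a n" and sums: "a sums 1" and bd: "\<And>n. norm (F n) \<le> B"
  shows "(\<lambda>n. of_real (a n) * F n) sums (\<integral>n. F n \<partial>measure_pmf (embed_pmf a))"
proof -
  have one: "(\<integral>\<^sup>+n. ennreal (a n) \<partial>count_space UNIV) = 1"
    using nonneg sums by (simp add: nn_integral_count_space_nat suminf_ennreal_eq sums_unique[OF sums, symmetric])
  have p: "pmf (embed_pmf a) = a" by (rule ext) (rule pmf_embed_pmf[OF nonneg one])
  have intF: "integrable (measure_pmf (embed_pmf a)) F"
    by (rule measure_pmf.integrable_const_bound[of _ B]) (use bd in auto)
  then have "integrable (count_space UNIV) (\<lambda>n. a n *\<^sub>R F n)"
    unfolding measure_pmf_eq_density p by (subst (asm) integrable_density) (use nonneg in auto)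
  from sums_integral_count_space_nat[OF this]
  have "(\<lambda>n. a n *\<^sub>R F n) sums (\<integral>n. a n *\<^sub>R F n \<partial>count_space UNIV)" .
  also have "(\<integral>n. a n *\<^sub>R F n \<partial>count_space UNIV) = (\<integral>n. F n \<partial>measure_pmf (embed_pmf a))"
    unfolding measure_pmf_eq_density p by (subst integral_density) (use nonneg in auto)
  finally show ?thesis by (simp add: scaleR_conv_of_real)
qed

text \<open>The Post--Widder measures: mass $(-k)^j h^{(j)}(k)/j!$ at $j/k$. Their Laplace transforms
  are Taylor series of \<open>h\<close> at \<open>k\<close>.\<close>

lemma post_widder_measure:
  fixes h :: "complex \<Rightarrow> complex"
  assumes hol: "h holomorphic_on right_half_plane"
    and sign: "\<And>n x. 0 < x \<Longrightarrow> (- 1) ^ n * (deriv ^^ n) h (of_real x) \<in> \<real>\<^sub>\<ge>\<^sub>0"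
    and lim: "((\<lambda>x. h (of_real x)) \<longlongrightarrow> 1) (at_right 0)" and k: "0 < k"
  obtains M where "real_distribution M" "measure M {..<0} = 0"
    "\<And>z. 0 < Re z \<Longrightarrow> (\<integral>s. exp (- z * of_real (max 0 s)) \<partial>M) = h (of_real k * (1 - exp (- z / of_real k)))"
proof -
  \<comment> \<open>Expanding \<open>h\<close> at \<open>k\<close> and evaluating at k (1 - q) gives
    increments (-k)^n q^n, so these are the coefficients of a power series in
    \<open>q\<close>.\<close>
  define c where "c n = (deriv ^^ n) h (of_real k) / fact n * (- of_real k) ^ n" for n
  define a where "a n = Re (c n)" for n
  have "c n \<in> \<real>\<^sub>\<ge>\<^sub>0" for n
  proof -
    have "c n = ((- 1) ^ n * (deriv ^^ n) h (of_real k)) * of_real (k ^ n / fact n)"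
      by (simp add: c_def power_minus[of "of_real k"])
    moreover have "of_real (k ^ n / fact n) \<in> \<real>\<^sub>\<ge>\<^sub>0" using k by (subst nonneg_Reals_of_real_iff) simp
    ultimately show ?thesis using sign[OF k, of n] by (metis nonneg_Reals_mult_I)
  qed
  then have a: "0 \<le> a n" "c n = of_real (a n)" for n
    by (auto simp: a_def complex_nonneg_Reals_iff complex_eq_iff)
  \<comment> \<open>The unit disc in \<open>q\<close> corresponds to the disc of radius
    \<open>k\<close> about \<open>k\<close>, which just fits into the right half-plane.\<close>
  have ser: "(\<lambda>n. of_real (a n) * q ^ n) sums h (of_real k * (1 - q))" if q: "norm q < 1" for q
  proof -
    have "ball (of_real k) k \<subseteq> right_half_plane"
    proof
      fix w :: complex assume "w \<in> ball (of_real k) k"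
      then have "cmod (of_real k - w) < k" by (simp add: dist_norm)
      then show "w \<in> right_half_plane" using complex_Re_le_cmod[of "of_real k - w"] by simp
    qed
    then have "h holomorphic_on ball (of_real k) k" using hol by (rule holomorphic_on_subset[rotated])
    moreover have "of_real k * (1 - q) \<in> ball (of_real k) k"
      using q k by (simp add: dist_norm algebra_simps norm_mult)
    ultimately have "(\<lambda>n. (deriv ^^ n) h (of_real k) / fact n * (of_real k * (1 - q) - of_real k) ^ n) sums h (of_real k * (1 - q))"
      by (rule holomorphic_power_series)
    moreover have "of_real k * (1 - q) - of_real k = (- of_real k) * q" by (simp add: algebra_simps)
    ultimately show ?thesis by (simp only: power_mult_distrib mult.assoc[symmetric] c_def[symmetric] a(2))
  qed
  have "a sums 1"
  proof (rule power_series_sums_one[OF a(1)])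
    fix q :: real assume q: "0 < q" "q < 1"
    have "(\<lambda>n. Re (of_real (a n) * of_real q ^ n)) sums Re (h (of_real k * (1 - of_real q)))"
      using ser[of "of_real q"] q by (intro sums_Re) simp
    moreover have "Re (of_real (a n) * of_real q ^ n) = a n * q ^ n" for n
      by (simp flip: of_real_power of_real_mult)
    moreover have "of_real k * (1 - of_real q) = complex_of_real (k * (1 - q))" by simp
    ultimately show "(\<lambda>n. a n * q ^ n) sums Re (h (complex_of_real (k * (1 - q))))" by (simp only:)
  next
    have "filterlim (\<lambda>q. k * (1 - q)) (at_right 0) (at_left 1)"
      unfolding filterlim_at
    proof
      have "((\<lambda>q. k * (1 - q)) \<longlongrightarrow> k * (1 - 1)) (at_left 1)" by (intro tendsto_intros)
      then show "((\<lambda>q. k * (1 - q)) \<longlongrightarrow> 0) (at_left 1)" by simp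
    qed (use k in \<open>auto simp: eventually_at intro!: exI[of _ 1]\<close>)
    from tendsto_Re[OF filterlim_compose[OF lim this]]
    show "((\<lambda>q. Re (h (complex_of_real (k * (1 - q))))) \<longlongrightarrow> 1) (at_left 1)" by simp
  qed
  note sm = integral_embed_pmf[OF a(1) this]
  let ?p = "measure_pmf (embed_pmf a)" and ?X = "\<lambda>j::nat. real j / k"
  show ?thesis
  proof (rule that)
    show "real_distribution (distr ?p borel ?X)" by (rule prob_space.real_distribution_distr[OF prob_space_measure_pmf]) simp
    have "?X -` {..<0} = {}" using k by (auto simp: divide_less_0_iff)
    then show "measure (distr ?p borel ?X) {..<0} = 0" by (simp add: measure_distr)
    fix z assume z: "0 < Re z"
    \<comment> \<open>Its j-th power is exp(-z j / k), the Laplace kernel at the atom j / k.\<close>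
    let ?q = "exp (- z / of_real k)"
    have q: "norm ?q < 1" using z k by (simp add: norm_exp_eq_Re Re_divide_of_real)
    have "(\<integral>s. exp (- z * of_real (max 0 s)) \<partial>distr ?p borel ?X) = (\<integral>j. exp (- z * of_real (max 0 (?X j))) \<partial>?p)"
      by (rule integral_distr) auto
    also have "(\<lambda>j. exp (- z * of_real (max 0 (?X j)))) = (\<lambda>j. ?q ^ j)"
      using k by (auto simp: fun_eq_iff max_def divide_less_0_iff exp_of_nat_mult[symmetric] mult.commute)
    also have "(\<integral>j. ?q ^ j \<partial>?p) = h (of_real k * (1 - ?q))"
      using sm[of "\<lambda>j. ?q ^ j" 1] ser[OF q] q by (simp add: sums_unique2 norm_power power_le_one)
    finally show "(\<integral>s. exp (- z * of_real (max 0 s)) \<partial>distr ?p borel ?X) = h (of_real k * (1 - ?q))" .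
  qed
qed

text \<open>The derivative of exp at zero. The transforms of the Post-Widder measures are
  \<open>h\<close> at these points, so continuity of \<open>h\<close> makes them converge to
  \<open>h z\<close>.\<close>

lemma tendsto_one_minus_exp:
  fixes z :: complex
  shows "(\<lambda>n. of_real (real (Suc n)) * (1 - exp (- z / of_real (real (Suc n))))) \<longlonglongrightarrow> z"
proof (cases "z = 0")
  case False
  define w where "w n = - z / of_real (real (Suc n))" for n
  have w0: "w n \<noteq> 0" for n using False by (simp add: w_def del: of_nat_Suc)
  have "(\<lambda>n. - z * of_real (1 / real (Suc n))) \<longlonglongrightarrow> - z * of_real 0"
    by (intro tendsto_intros LIMSEQ_Suc[OF lim_1_over_n])
  then have "w \<longlonglongrightarrow> 0" by (simp add: w_def[abs_def] del: of_nat_Suc)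
  then have lim: "filterlim w (at 0) sequentially" using w0 by (simp add: filterlim_at)
  have "((\<lambda>h. (exp (0 + h) - exp 0) / h) \<longlongrightarrow> exp (0::complex)) (at 0)"
    using DERIV_exp[of "0::complex"] unfolding DERIV_def .
  from tendsto_mult[OF tendsto_const[of z] filterlim_compose[OF this lim]]
  have "(\<lambda>n. z * ((exp (w n) - 1) / w n)) \<longlonglongrightarrow> z" by simp
  moreover have "z * ((exp (w n) - 1) / w n) = of_real (real (Suc n)) * (1 - exp (- z / of_real (real (Suc n))))" for n
  proof -
    have "z / w n = - of_real (real (Suc n))" using False by (simp add: w_def del: of_nat_Suc)
    then have "z * ((exp (w n) - 1) / w n) = - of_real (real (Suc n)) * (exp (w n) - 1)"
      by (metis times_divide_eq_left times_divide_eq_right mult.commute)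
    then show ?thesis by (simp add: w_def algebra_simps del: of_nat_Suc)
  qed
  ultimately show ?thesis by simp
qed simp

text \<open>This is Bernstein's theorem; the measure is a weak limit of Post--Widder measures, and the
  holomorphic extension of \<open>h\<close> replaces the usual remainder estimates.\<close>

theorem completely_monotone_laplace:
  fixes h :: "complex \<Rightarrow> complex"
  assumes hol: "h holomorphic_on right_half_plane"
    and sign: "\<And>n x. 0 < x \<Longrightarrow> (- 1) ^ n * (deriv ^^ n) h (of_real x) \<in> \<real>\<^sub>\<ge>\<^sub>0"
    and lim: "((\<lambda>x. h (of_real x)) \<longlongrightarrow> 1) (at_right 0)"
  obtains M where "real_distribution M" "AE s in M. 0 \<le> s"
    "\<And>z. 0 < Re z \<Longrightarrow> (\<integral>s. exp (- z * of_real (max 0 s)) \<partial>M) = h z"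
proof -
  have "\<exists>M. real_distribution M \<and> measure M {..<0} = 0 \<and>
    (\<forall>z. 0 < Re z \<longrightarrow> (\<integral>s. exp (- z * of_real (max 0 s)) \<partial>M) = h (of_real (real (Suc n)) * (1 - exp (- z / of_real (real (Suc n))))))" for n
    using post_widder_measure[OF hol sign lim, of "real (Suc n)"] by (metis of_nat_0_less_iff zero_less_Suc)
  then obtain \<mu> where rd: "\<And>n. real_distribution (\<mu> n)" and neg: "\<And>n. measure (\<mu> n) {..<0} = 0"
    and lap: "\<And>n z. 0 < Re z \<Longrightarrow> (\<integral>s. exp (- z * of_real (max 0 s)) \<partial>\<mu> n) = h (of_real (real (Suc n)) * (1 - exp (- z / of_real (real (Suc n)))))"
    by metis
  \<comment> \<open>Weak convergence tests against functions that are bounded and continuous on the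
    whole line. Replacing \<open>s\<close> by \<open>max 0 s\<close> achieves this and changes
    nothing where the measures have mass.\<close>
  have cont_exp: "isCont (\<lambda>s. exp (- z * of_real (max 0 s))) s" for z :: complex and s :: real
    by (intro continuous_intros)
  have bdd_exp: "norm (exp (- z * of_real (max 0 s))) \<le> 1" if "0 < Re z" for z s
    using that by (simp add: norm_exp_eq_Re)
  have "tight \<mu>"
    unfolding tight_def
  proof (intro conjI allI impI rd)
    fix e :: real assume e: "0 < e"
    \<comment> \<open>Beyond \<open>R\<close> the function 1 - exp(-s / R) is at least 1 - exp(-1),
      so the tail mass is controlled by the deviation of the transform from 1 near zero. The factor
      anticipates the final division.\<close>
    define e' where "e' = e * (1 - exp (- 1))"
    have e': "0 < e'" using e by (simp add: e'_def)
    have "eventually (\<lambda>x. dist (h (of_real x)) 1 < e') (at_right 0)"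
      using lim e' by (rule tendstoD)
    then obtain d where d: "0 < d" "\<And>x. 0 < x \<Longrightarrow> x < d \<Longrightarrow> dist (h (of_real x)) 1 < e'"
      by (auto simp: eventually_at_right_field)
    define R where "R = 2 / d"
    have R: "0 < R" using d by (simp add: R_def)
    have "measure (\<mu> n) {- 1<..R} > 1 - e" for n
    proof -
      interpret real_distribution "\<mu> n" by (rule rd)
      define x where "x = 1 / R"
      have x: "0 < x" "x < d" using R d by (simp_all add: x_def R_def)
      let ?k = "real (Suc n)"
      \<comment> \<open>The transform at \<open>x\<close> is \<open>h\<close> at \<open>y\<close>,
        and \<open>0 < y \<le> x < d\<close> holds for every \<open>n\<close>. This makes the tail
        bound uniform in \<open>n\<close>.\<close>
      define y where "y = ?k * (1 - exp (- x / ?k))"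
      have y: "0 < y" "y < d"
      proof -
        show "0 < y" using x by (simp add: y_def)
        have "1 - exp (- x / ?k) \<le> x / ?k" using exp_ge_add_one_self[of "- x / ?k"] by simp
        then have "y \<le> ?k * (x / ?k)" unfolding y_def by (intro mult_left_mono) auto
        then show "y < d" using x by simp
      qed
      have int: "integrable (\<mu> n) (\<lambda>s. exp (- x * max 0 s))"
        by (rule integrable_const_bound[of _ 1]) (use x in auto)
      have "(\<integral>s. exp (- of_real x * of_real (max 0 s)) \<partial>\<mu> n) = complex_of_real (\<integral>s. exp (- x * max 0 s) \<partial>\<mu> n)"
        unfolding integral_complex_of_real[symmetric]
        by (intro Bochner_Integration.integral_cong refl) (simp add: exp_of_real[symmetric])
      then have "h (of_real y) = complex_of_real (\<integral>s. exp (- x * max 0 s) \<partial>\<mu> n)"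
        using lap[of "of_real x" n] x
        by (simp add: y_def exp_of_real[symmetric] del: of_nat_Suc)
      then have "\<bar>(\<integral>s. exp (- x * max 0 s) \<partial>\<mu> n) - 1\<bar> < e'"
      proof -
        assume "h (of_real y) = complex_of_real (\<integral>s. exp (- x * max 0 s) \<partial>\<mu> n)"
        then have "h (of_real y) - 1 = complex_of_real ((\<integral>s. exp (- x * max 0 s) \<partial>\<mu> n) - 1)"
          by (simp only: of_real_diff of_real_1)
        then have "norm (h (of_real y) - 1) = \<bar>(\<integral>s. exp (- x * max 0 s) \<partial>\<mu> n) - 1\<bar>"
          by (simp only: norm_of_real)
        then show ?thesis using d(2)[OF y] by (simp only: dist_norm)
      qed
      then have L: "1 - (\<integral>s. exp (- x * max 0 s) \<partial>\<mu> n) < e'" by linarith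
      have "(1 - exp (- 1)) * prob {R<..} = (\<integral>s. (1 - exp (- 1)) * indicator {R<..} s \<partial>\<mu> n)"
        by simp
      also have "\<dots> \<le> (\<integral>s. 1 - exp (- x * max 0 s) \<partial>\<mu> n)"
      proof (rule integral_mono)
        show "integrable (\<mu> n) (\<lambda>s. (1 - exp (- 1)) * indicator {R<..} s :: real)" by (simp add: less_top[symmetric])
        show "integrable (\<mu> n) (\<lambda>s. 1 - exp (- x * max 0 s))" using int by simp
        fix s :: real
        show "(1 - exp (- 1)) * indicator {R<..} s \<le> 1 - exp (- x * max 0 s)"
        proof (cases "R < s")
          case True
          then have "1 \<le> x * max 0 s" using R by (simp add: x_def)
          then show ?thesis using True by simp
        qed (use x in simp)
      qed
      also have "\<dots> < e'" using L int prob_space by simp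
      finally have "prob {R<..} < e" using e unfolding e'_def by (simp add: mult.commute)
      moreover have "prob {..- 1} = 0"
      proof -
        have "prob {..- 1} \<le> prob {..<0}" by (intro finite_measure_mono) auto
        then show ?thesis using neg[of n] by (simp add: measure_le_0_iff)
      qed
      moreover have "1 \<le> prob {..- 1} + prob {- 1<..R} + prob {R<..}"
      proof -
        have "{..- 1} \<union> {- 1<..R} \<union> {R<..} = (UNIV :: real set)" using R by auto
        then have "1 = prob ({..- 1} \<union> {- 1<..R} \<union> {R<..})" using prob_space by simp
        also have "\<dots> \<le> prob ({..- 1} \<union> {- 1<..R}) + prob {R<..}" by (rule measure_Un_le) auto
        also have "prob ({..- 1} \<union> {- 1<..R}) \<le> prob {..- 1} + prob {- 1<..R}" by (rule measure_Un_le) auto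
        finally show ?thesis by simp
      qed
      ultimately show ?thesis by linarith
    qed
    moreover have "- 1 < R" using R by simp
    ultimately show "\<exists>a b. a < b \<and> (\<forall>n. 1 - e < measure (\<mu> n) {a<..b})" by blast
  qed
  then obtain r M where r: "strict_mono (r :: nat \<Rightarrow> nat)" and M: "real_distribution M"
    and wc: "weak_conv_m (\<mu> \<circ> id \<circ> r) M"
    using tight_imp_convergent_subsubsequence[of \<mu> id] by (auto simp: strict_mono_id)
  interpret M: real_distribution M by (rule M)
  have conv: "(\<lambda>n. \<integral>s. f s \<partial>\<mu> (r n)) \<longlonglongrightarrow> (\<integral>s. f s \<partial>M)"
    if "\<And>s. isCont f s" "\<And>s. norm (f s) \<le> B" for f :: "real \<Rightarrow> 'b::{banach,second_countable_topology}" and B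
    using weak_conv_imp_integral_bdd_continuous_conv[OF _ M wc that] rd by simp
  show ?thesis
  proof (rule that[OF M])
    fix z :: complex assume z: "0 < Re z"
    have "(\<lambda>n. \<integral>s. exp (- z * of_real (max 0 s)) \<partial>\<mu> (r n)) \<longlonglongrightarrow> (\<integral>s. exp (- z * of_real (max 0 s)) \<partial>M)"
      by (rule conv[OF cont_exp bdd_exp[OF z]])
    moreover have "(\<lambda>n. \<integral>s. exp (- z * of_real (max 0 s)) \<partial>\<mu> (r n)) \<longlonglongrightarrow> h z"
    proof -
      have "isCont h z"
        using holomorphic_on_imp_continuous_on[OF hol] z
        by (simp add: continuous_on_eq_continuous_at[OF open_right_half_plane])
      from isCont_tendsto_compose[OF this LIMSEQ_subseq_LIMSEQ[OF tendsto_one_minus_exp r]]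
      show ?thesis unfolding lap[OF z] by (simp add: o_def)
    qed
    ultimately show "(\<integral>s. exp (- z * of_real (max 0 s)) \<partial>M) = h z" by (rule LIMSEQ_unique)
  next
    \<comment> \<open>A bounded continuous function that is positive exactly on the negative axis.
      Its integrals vanish along the sequence, hence for the limit measure as well.\<close>
    define f where "f s = min 1 (max 0 (- s))" for s :: real
    have f: "isCont f s" "norm (f s) \<le> 1" for s
      by (auto simp: f_def[abs_def] intro!: continuous_intros)
    have zero: "(\<integral>s. f s \<partial>\<mu> n) = 0" for n
    proof -
      interpret real_distribution "\<mu> n" by (rule rd)
      have "AE s in \<mu> n. s \<notin> {..<0}"
        using neg[of n] by (intro AE_not_in) (simp add: null_setsI emeasure_eq_measure)
      then have "AE s in \<mu> n. f s = 0" by eventually_elim (simp add: f_def)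
      then show ?thesis by (simp add: integral_eq_zero_AE)
    qed
    have "(\<lambda>n. 0) \<longlonglongrightarrow> (\<integral>s. f s \<partial>M)" using conv[OF f] unfolding zero .
    then have "(\<integral>s. f s \<partial>M) = 0" by (simp add: LIMSEQ_const_iff)
    moreover have "integrable M f"
      by (rule M.integrable_const_bound[of _ 1]) (use f in \<open>auto simp: f_def[abs_def]\<close>)
    ultimately have "AE s in M. f s = 0"
      by (subst (asm) integral_nonneg_eq_0_iff_AE) (auto simp: f_def)
    then show "AE s in M. 0 \<le> s" by eventually_elim (auto simp: f_def min_def max_def split: if_splits)
  qed
qed

section \<open>The subordinator\<close>

text \<open>The condition under the description operator in \<open>subordinator\<close>, named so
  that existence and uniqueness can be proved for it.\<close>

definition is_subordinator :: "(complex \<Rightarrow> complex) \<Rightarrow> real \<Rightarrow> real measure \<Rightarrow> bool" where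
  "is_subordinator \<phi> t \<nu> \<longleftrightarrow> sets \<nu> = sets (restrict_space borel {0..}) \<and> emeasure \<nu> (space \<nu>) \<le> 1 \<and>
     (\<forall>z. Re z > 0 \<longrightarrow> (\<integral>s. exp (- z * of_real s) \<partial>\<nu>) = exp (- of_real t * \<phi> z))"

lemma bernstein_tendsto_zero:
  assumes \<phi>: "bernstein_function \<phi>" and \<phi>0: "\<phi> 0 = 0"
  shows "((\<lambda>x. \<phi> (complex_of_real x)) \<longlongrightarrow> 0) (at_right 0)"
proof -
  have "continuous_on {z. 0 \<le> Re z} \<phi>" using \<phi> by (simp add: bernstein_function_def)
  then have "(\<phi> \<longlongrightarrow> \<phi> 0) (at 0 within {z. 0 \<le> Re z})" by (auto simp: continuous_on_def)
  moreover have "filterlim complex_of_real (at 0 within {z. 0 \<le> Re z}) (at_right 0)"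
    by (auto simp: filterlim_at eventually_at intro!: tendsto_eq_intros exI[of _ 1])
  ultimately show ?thesis unfolding \<phi>0 by (rule filterlim_compose)
qed

lemma exp_bernstein_tendsto:
  assumes "bernstein_function \<phi>" "\<phi> 0 = 0"
  shows "((\<lambda>x. exp (- of_real t * \<phi> (of_real x))) \<longlongrightarrow> 1) (at_right 0)"
  using tendsto_exp[OF tendsto_mult[OF tendsto_const[of "- of_real t"] bernstein_tendsto_zero[OF assms]]]
  by simp

lemma subordinator_exists:
  assumes \<phi>: "bernstein_function \<phi>" and \<phi>0: "\<phi> 0 = 0" and t: "0 \<le> t"
  obtains \<nu> where "is_subordinator \<phi> t \<nu>"
proof -
  let ?h = "\<lambda>z. exp (- of_real t * \<phi> z)"
  have hol: "?h holomorphic_on right_half_plane"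
    using \<phi> by (intro holomorphic_intros) (simp add: bernstein_function_def)
  have sign: "(- 1) ^ n * (deriv ^^ n) ?h (of_real x) \<in> \<real>\<^sub>\<ge>\<^sub>0" if "0 < x" for n x
    by (rule exp_bernstein_deriv_sign[OF \<phi> t that])
  obtain M where "real_distribution M" and ae: "AE s in M. 0 \<le> s"
    and lap: "\<And>z. 0 < Re z \<Longrightarrow> (\<integral>s. exp (- z * of_real (max 0 s)) \<partial>M) = ?h z"
    by (rule completely_monotone_laplace[OF hol sign exp_bernstein_tendsto[OF \<phi> \<phi>0]], assumption, rule that)
  then interpret M: real_distribution M by simp
  \<comment> \<open>\<open>subordinator\<close> prescribes the Borel sets of \<open>{0..}\<close>.
    Since \<open>s = max 0 s\<close> almost everywhere, the restriction leaves the transform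
    unchanged.\<close>
  have "is_subordinator \<phi> t (restrict_space M {0..})"
    unfolding is_subordinator_def
  proof (intro conjI allI impI)
    show "sets (restrict_space M {0..}) = sets (restrict_space borel {0..})"
      by (simp add: sets_restrict_space)
    show "emeasure (restrict_space M {0..}) (space (restrict_space M {0..})) \<le> 1"
      by (simp add: space_restrict_space emeasure_restrict_space M.emeasure_le_1)
    fix z :: complex assume z: "0 < Re z"
    have "(\<integral>s. exp (- z * of_real s) \<partial>restrict_space M {0..}) = (\<integral>s. indicator {0..} s *\<^sub>R exp (- z * of_real s) \<partial>M)"
      by (rule integral_restrict_space) simp
    also have "\<dots> = (\<integral>s. exp (- z * of_real (max 0 s)) \<partial>M)"
    proof (rule integral_cong_AE)
      show "AE s in M. indicator {0..} s *\<^sub>R exp (- z * of_real s) = exp (- z * of_real (max 0 s))"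
        using ae by eventually_elim simp
    qed simp_all
    finally show "(\<integral>s. exp (- z * of_real s) \<partial>restrict_space M {0..}) = exp (- of_real t * \<phi> z)"
      using lap[OF z] by simp
  qed
  then show ?thesis by (rule that)
qed

lemma is_subordinator_space: "is_subordinator \<phi> t \<nu> \<Longrightarrow> space \<nu> = {0..}"
  using sets_eq_imp_space_eq[of \<nu> "restrict_space borel {0..}"]
  by (simp add: is_subordinator_def space_restrict_space)

lemma is_subordinator_measurable:
  assumes "is_subordinator \<phi> t \<nu>"
  shows "(\<lambda>s. s) \<in> borel_measurable \<nu>"
proof -
  have "(\<lambda>s. s) \<in> borel_measurable (restrict_space borel {0..})"
    by (rule measurable_restrict_space1) simp
  then show ?thesis using assms measurable_cong_sets by (metis is_subordinator_def)
qed

lemma is_subordinator_finite: "is_subordinator \<phi> t \<nu> \<Longrightarrow> finite_measure \<nu>"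
  by (rule finite_measureI) (auto simp: is_subordinator_def top_unique)

text \<open>The imaginary axis is approached from inside the half-plane, where the transform is
  prescribed. The sequence depends on \<open>\<phi>\<close> and \<open>t\<close> alone, so any two
  candidates have the same characteristic function.\<close>

lemma is_subordinator_fourier:
  assumes \<nu>: "is_subordinator \<phi> t \<nu>"
  shows "(\<lambda>n. exp (- of_real t * \<phi> (of_real (1 / real (Suc n)) - \<i> * of_real \<xi>))) \<longlonglongrightarrow> (\<integral>s. iexp (\<xi> * s) \<partial>\<nu>)"
proof -
  interpret finite_measure \<nu> by (rule is_subordinator_finite[OF \<nu>])
  note [measurable] = is_subordinator_measurable[OF \<nu>]
  define z where "z n = of_real (1 / real (Suc n)) - \<i> * complex_of_real \<xi>" for n
  have "z \<longlonglongrightarrow> of_real 0 - \<i> * of_real \<xi>"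
    unfolding z_def by (intro tendsto_intros LIMSEQ_Suc[OF lim_1_over_n])
  then have z: "z \<longlonglongrightarrow> - \<i> * of_real \<xi>" by simp
  have "(\<lambda>n. \<integral>s. exp (- z n * of_real s) \<partial>\<nu>) \<longlonglongrightarrow> (\<integral>s. iexp (\<xi> * s) \<partial>\<nu>)"
  proof (rule integral_dominated_convergence[where w = "\<lambda>_. 1"])
    show "AE s in \<nu>. (\<lambda>n. exp (- z n * of_real s)) \<longlonglongrightarrow> iexp (\<xi> * s)"
    proof (rule AE_I2)
      fix s
      have "(\<lambda>n. exp (- z n * of_real s)) \<longlonglongrightarrow> exp (- (- \<i> * of_real \<xi>) * of_real s)" by (intro tendsto_intros z)
      then show "(\<lambda>n. exp (- z n * of_real s)) \<longlonglongrightarrow> iexp (\<xi> * s)" by (simp add: mult.assoc)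
    qed
    show "AE s in \<nu>. norm (exp (- z n * of_real s)) \<le> 1" for n
      by (rule AE_I2) (use is_subordinator_space[OF \<nu>] in \<open>simp add: z_def norm_exp_eq_Re\<close>)
  qed simp_all
  moreover have "(\<integral>s. exp (- z n * of_real s) \<partial>\<nu>) = exp (- of_real t * \<phi> (z n))" for n
  proof -
    have "0 < Re (z n)" by (simp add: z_def)
    then show ?thesis using \<nu> by (simp add: is_subordinator_def)
  qed
  ultimately show ?thesis by (simp add: z_def[abs_def])
qed

text \<open>At frequency zero the Fourier limit is the total mass, and \<phi> 0 = 0 makes it 1,
  where the definition only asks for at most 1.\<close>

lemma is_subordinator_prob:
  assumes \<phi>: "bernstein_function \<phi>" and \<phi>0: "\<phi> 0 = 0" and \<nu>: "is_subordinator \<phi> t \<nu>"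
  shows "emeasure \<nu> (space \<nu>) = 1"
proof -
  interpret finite_measure \<nu> by (rule is_subordinator_finite[OF \<nu>])
  have "filterlim (\<lambda>n. 1 / real (Suc n)) (at_right 0) sequentially"
    using LIMSEQ_Suc[OF lim_1_over_n] by (simp add: filterlim_at)
  from filterlim_compose[OF exp_bernstein_tendsto[OF \<phi> \<phi>0] this]
  have "(\<lambda>n. exp (- of_real t * \<phi> (of_real (1 / real (Suc n)) - \<i> * of_real 0))) \<longlonglongrightarrow> 1" by simp
  from LIMSEQ_unique[OF this is_subordinator_fourier[OF \<nu>]]
  have "complex_of_real (measure \<nu> (space \<nu>)) = 1" by (simp add: of_real_def)
  then have "measure \<nu> (space \<nu>) = 1" by (simp only: of_real_eq_1_iff)
  then show ?thesis by (simp add: emeasure_eq_measure)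
qed

text \<open>Levy's uniqueness theorem for the image measures on the whole line; on Borel subsets of
  \<open>{0..}\<close> these agree with the original measures.\<close>

lemma is_subordinator_unique:
  assumes \<phi>: "bernstein_function \<phi>" and \<phi>0: "\<phi> 0 = 0"
    and \<nu>: "is_subordinator \<phi> t \<nu>" and \<nu>': "is_subordinator \<phi> t \<nu>'"
  shows "\<nu> = \<nu>'"
proof -
  have rd: "real_distribution (distr \<mu> borel (\<lambda>s. s))" if "is_subordinator \<phi> t \<mu>" for \<mu>
    by (intro prob_space.real_distribution_distr prob_spaceI is_subordinator_prob[OF \<phi> \<phi>0 that]
        is_subordinator_measurable[OF that])
  have ch: "char (distr \<mu> borel (\<lambda>s. s)) \<xi> = (\<integral>s. iexp (\<xi> * s) \<partial>\<mu>)" if "is_subordinator \<phi> t \<mu>" for \<mu> \<xi>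
    unfolding char_def by (rule integral_distr[OF is_subordinator_measurable[OF that]]) simp
  have "char (distr \<nu> borel (\<lambda>s. s)) = char (distr \<nu>' borel (\<lambda>s. s))"
    by (rule ext) (simp only: ch[OF \<nu>] ch[OF \<nu>']
        LIMSEQ_unique[OF is_subordinator_fourier[OF \<nu>] is_subordinator_fourier[OF \<nu>']])
  then have eq: "distr \<nu> borel (\<lambda>s. s) = distr \<nu>' borel (\<lambda>s. s)"
    by (rule Levy_uniqueness[OF rd[OF \<nu>] rd[OF \<nu>']])
  have em: "emeasure \<mu> X = emeasure (distr \<mu> borel (\<lambda>s. s)) X"
    if \<mu>: "is_subordinator \<phi> t \<mu>" and X: "X \<in> sets (restrict_space borel {0..})" for \<mu> X
  proof -
    have X': "X \<in> sets borel" "X \<subseteq> {0..}" using X by (auto simp: sets_restrict_space)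
    then have "(\<lambda>s. s) -` X \<inter> space \<mu> = X" using is_subordinator_space[OF \<mu>] by auto
    then show ?thesis using emeasure_distr[OF is_subordinator_measurable[OF \<mu>] X'(1)] by simp
  qed
  show ?thesis
  proof (rule measure_eqI)
    show "sets \<nu> = sets \<nu>'" using \<nu> \<nu>' by (simp add: is_subordinator_def)
    fix X assume "X \<in> sets \<nu>"
    then have "X \<in> sets (restrict_space borel {0..})" using \<nu> by (simp add: is_subordinator_def)
    then show "emeasure \<nu> X = emeasure \<nu>' X" using em[OF \<nu>] em[OF \<nu>'] eq by metis
  qed
qed

lemma is_subordinator_subordinator:
  assumes "bernstein_function \<phi>" "\<phi> 0 = 0" "0 \<le> t"
  shows "is_subordinator \<phi> t (subordinator \<phi> t)"
proof -
  have "\<exists>!\<nu>. is_subordinator \<phi> t \<nu>"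
    using subordinator_exists[OF assms] is_subordinator_unique[OF assms(1,2)] by metis
  from theI'[OF this] show ?thesis by (simp add: is_subordinator_def[abs_def] subordinator_def)
qed

section \<open>Moments of the subordinator\<close>

text \<open>The expansion 1 - \<tau> x + (\<tau>^2 - \<tau> L) x^2 / 2 of the Laplace transform at
  zero. Only one-sided limits of the derivatives are available there, hence l'Hopital's rule, twice
  for the quadratic term.\<close>

lemma exp_bernstein_second_order:
  fixes f :: "real \<Rightarrow> real"
  assumes f0: "(f \<longlongrightarrow> 0) (at_right 0)" and f1: "(f' \<longlongrightarrow> 1) (at_right 0)" and f2: "(f'' \<longlongrightarrow> L) (at_right 0)"
    and d1: "\<And>x. 0 < x \<Longrightarrow> (f has_real_derivative f' x) (at x)"
    and d2: "\<And>x. 0 < x \<Longrightarrow> (f' has_real_derivative f'' x) (at x)"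
  shows "((\<lambda>x. (1 - exp (- \<tau> * f x)) / x) \<longlongrightarrow> \<tau>) (at_right 0)"
    "((\<lambda>x. (exp (- \<tau> * f x) - 1 + \<tau> * x) / x\<^sup>2) \<longlongrightarrow> (\<tau>\<^sup>2 - \<tau> * L) / 2) (at_right 0)"
proof -
  have pos: "eventually (\<lambda>x::real. 0 < x) (at_right 0)" by (auto simp: eventually_at intro!: exI[of _ 1])
  have id: "((\<lambda>x::real. x) \<longlongrightarrow> 0) (at_right 0)" by (rule tendsto_ident_at)
  have e: "((\<lambda>x. exp (- \<tau> * f x)) \<longlongrightarrow> 1) (at_right 0)"
    using tendsto_exp[OF tendsto_mult[OF tendsto_const[of "- \<tau>"] f0]] by simp
  have de: "((\<lambda>x. exp (- \<tau> * f x)) has_real_derivative - \<tau> * f' x * exp (- \<tau> * f x)) (at x)" if "0 < x" for x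
    using d1[OF that] by (auto intro!: derivative_eq_intros)
  show "((\<lambda>x. (1 - exp (- \<tau> * f x)) / x) \<longlongrightarrow> \<tau>) (at_right 0)"
  proof (rule lhopital_right_0[where g' = "\<lambda>_. 1" and f' = "\<lambda>x. \<tau> * f' x * exp (- \<tau> * f x)"])
    show "((\<lambda>x. 1 - exp (- \<tau> * f x)) \<longlongrightarrow> 0) (at_right 0)"
      using tendsto_diff[OF tendsto_const[of 1] e] by simp
    show "eventually (\<lambda>x. ((\<lambda>x. 1 - exp (- \<tau> * f x)) has_real_derivative \<tau> * f' x * exp (- \<tau> * f x)) (at x)) (at_right 0)"
      using pos
    proof eventually_elim
      case (elim x)
      show ?case using DERIV_diff[OF DERIV_const[of 1] de[OF elim]] by simp
    qed
    show "((\<lambda>x. \<tau> * f' x * exp (- \<tau> * f x) / 1) \<longlongrightarrow> \<tau>) (at_right 0)"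
      using tendsto_mult[OF tendsto_mult[OF tendsto_const[of \<tau>] f1] e] by simp
  qed (use pos id in \<open>auto elim: eventually_mono\<close>)
  show "((\<lambda>x. (exp (- \<tau> * f x) - 1 + \<tau> * x) / x\<^sup>2) \<longlongrightarrow> (\<tau>\<^sup>2 - \<tau> * L) / 2) (at_right 0)"
  proof (rule lhopital_right_0[where g' = "\<lambda>x. 2 * x" and f' = "\<lambda>x. \<tau> - \<tau> * f' x * exp (- \<tau> * f x)"])
    show "((\<lambda>x. exp (- \<tau> * f x) - 1 + \<tau> * x) \<longlongrightarrow> 0) (at_right 0)"
      using tendsto_add[OF tendsto_diff[OF e tendsto_const[of 1]] tendsto_mult[OF tendsto_const[of \<tau>] id]] by simp
    show "((\<lambda>x::real. x\<^sup>2) \<longlongrightarrow> 0) (at_right 0)" using tendsto_power[OF id, of 2] by simp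
    show "eventually (\<lambda>x. ((\<lambda>x. exp (- \<tau> * f x) - 1 + \<tau> * x) has_real_derivative \<tau> - \<tau> * f' x * exp (- \<tau> * f x)) (at x)) (at_right 0)"
      using pos
    proof eventually_elim
      case (elim x)
      show ?case using d1[OF elim] by (auto intro!: derivative_eq_intros)
    qed
    show "eventually (\<lambda>x::real. ((\<lambda>x. x\<^sup>2) has_real_derivative 2 * x) (at x)) (at_right 0)"
      by (intro always_eventually allI) (auto intro!: derivative_eq_intros)
    show "((\<lambda>x. (\<tau> - \<tau> * f' x * exp (- \<tau> * f x)) / (2 * x)) \<longlongrightarrow> (\<tau>\<^sup>2 - \<tau> * L) / 2) (at_right 0)"
    proof (rule lhopital_right_0[where g' = "\<lambda>x. 2" and
          f' = "\<lambda>x. - (\<tau> * f'' x * exp (- \<tau> * f x) + \<tau> * f' x * (- \<tau> * f' x * exp (- \<tau> * f x)))"])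
      show "((\<lambda>x. \<tau> - \<tau> * f' x * exp (- \<tau> * f x)) \<longlongrightarrow> 0) (at_right 0)"
        using tendsto_diff[OF tendsto_const[of \<tau>] tendsto_mult[OF tendsto_mult[OF tendsto_const[of \<tau>] f1] e]] by simp
      show "((\<lambda>x::real. 2 * x) \<longlongrightarrow> 0) (at_right 0)" using tendsto_mult[OF tendsto_const[of 2] id] by simp
      show "eventually (\<lambda>x. ((\<lambda>x. \<tau> - \<tau> * f' x * exp (- \<tau> * f x)) has_real_derivative
          - (\<tau> * f'' x * exp (- \<tau> * f x) + \<tau> * f' x * (- \<tau> * f' x * exp (- \<tau> * f x)))) (at x)) (at_right 0)"
        using pos
      proof eventually_elim
        case (elim x)
        show ?case
          using DERIV_diff[OF DERIV_const[of \<tau>] DERIV_mult[OF DERIV_cmult[OF d2[OF elim], of \<tau>] de[OF elim]]]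
          by (rule DERIV_cong) (simp add: algebra_simps)
      qed
      have "((\<lambda>x. - (\<tau> * f'' x * exp (- \<tau> * f x) + \<tau> * f' x * (- \<tau> * f' x * exp (- \<tau> * f x))) / 2) \<longlongrightarrow>
          - (\<tau> * L * 1 + \<tau> * 1 * (- \<tau> * 1 * 1)) / 2) (at_right 0)"
        by (intro tendsto_intros e f1 f2) simp
      then show "((\<lambda>x. - (\<tau> * f'' x * exp (- \<tau> * f x) + \<tau> * f' x * (- \<tau> * f' x * exp (- \<tau> * f x))) / 2) \<longlongrightarrow>
          (\<tau>\<^sup>2 - \<tau> * L) / 2) (at_right 0)"
        by (simp add: power2_eq_square)
    qed (auto intro!: always_eventually derivative_eq_intros eventually_mono[OF pos])
  qed (auto intro: eventually_mono[OF pos])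
qed

text \<open>The second moment is controlled by Fatou's lemma, which also yields the integrability
  needed to compute the mean exactly by dominated convergence.\<close>

lemma laplace_moments:
  fixes \<nu> :: "real measure"
  assumes prob: "prob_space \<nu>" and meas: "(\<lambda>s. s) \<in> borel_measurable \<nu>" and nonneg: "\<And>s. s \<in> space \<nu> \<Longrightarrow> 0 \<le> s"
    and first: "((\<lambda>x. (1 - (\<integral>s. exp (- x * s) \<partial>\<nu>)) / x) \<longlongrightarrow> \<tau>) (at_right 0)"
    and second: "((\<lambda>x. ((\<integral>s. exp (- x * s) \<partial>\<nu>) - 1 + \<tau> * x) / x\<^sup>2) \<longlongrightarrow> W / 2) (at_right 0)"
  shows "has_bochner_integral \<nu> (\<lambda>s. s) \<tau>" "integrable \<nu> (\<lambda>s. (s - \<tau>)\<^sup>2)" "(\<integral>s. (s - \<tau>)\<^sup>2 \<partial>\<nu>) \<le> W - \<tau>\<^sup>2"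
proof -
  interpret prob_space \<nu> by (rule prob)
  note [measurable] = meas
  define x where "x n = 1 / real (Suc n)" for n
  have x: "0 < x n" for n by (simp add: x_def)
  have "x \<longlonglongrightarrow> 0" unfolding x_def by (rule LIMSEQ_Suc[OF lim_1_over_n])
  moreover have "x n \<noteq> 0" for n using x[of n] by simp
  ultimately have lx: "filterlim x (at_right 0) sequentially" using x by (simp add: filterlim_at)
  have iexp: "integrable \<nu> (\<lambda>s. exp (- y * s))" if "0 < y" for y
    by (rule integrable_const_bound[of _ 1]) (use that nonneg in auto)
  have le: "1 - exp (- y * s) \<le> y * s" for y s :: real
    using exp_ge_add_one_self[of "- y * s"] by simp
  have one: "((\<lambda>y. (1 - exp (- y * s)) / y) \<longlongrightarrow> s) (at_right 0)"
    and two: "((\<lambda>y. (exp (- y * s) - 1 + y * s) / y\<^sup>2) \<longlongrightarrow> s\<^sup>2 / 2) (at_right 0)" for s :: real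
  proof -
    have "((\<lambda>y. y) \<longlongrightarrow> 0) (at_right (0::real))" by (rule tendsto_ident_at)
    \<comment> \<open>The Laplace kernel itself is the case where \<open>f\<close> is the identity,
      with L = 0 and \<open>s\<close> in the role of \<tau>.\<close>
    note * = exp_bernstein_second_order[OF this tendsto_const[of 1] tendsto_const[of 0], of s]
    show "((\<lambda>y. (1 - exp (- y * s)) / y) \<longlongrightarrow> s) (at_right 0)"
      using *(1) by (simp add: mult.commute)
    show "((\<lambda>y. (exp (- y * s) - 1 + y * s) / y\<^sup>2) \<longlongrightarrow> s\<^sup>2 / 2) (at_right 0)"
      using *(2) by (simp add: mult.commute)
  qed
  have fatou: "(\<integral>\<^sup>+s. ennreal (v s) \<partial>\<nu>) \<le> ennreal c"
    if lim: "\<And>s. s \<in> space \<nu> \<Longrightarrow> (\<lambda>n. u n s) \<longlonglongrightarrow> v s" and int: "\<And>n. integrable \<nu> (u n)"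
      and pos: "\<And>n s. s \<in> space \<nu> \<Longrightarrow> 0 \<le> u n s" and c: "(\<lambda>n. \<integral>s. u n s \<partial>\<nu>) \<longlonglongrightarrow> c"
    for u :: "nat \<Rightarrow> real \<Rightarrow> real" and v c
  proof -
    have [measurable]: "u n \<in> borel_measurable \<nu>" for n using int by (rule borel_measurable_integrable)
    have "(\<integral>\<^sup>+s. ennreal (v s) \<partial>\<nu>) = (\<integral>\<^sup>+s. liminf (\<lambda>n. ennreal (u n s)) \<partial>\<nu>)"
    proof (rule nn_integral_cong)
      fix s assume "s \<in> space \<nu>"
      then have "(\<lambda>n. ennreal (u n s)) \<longlonglongrightarrow> ennreal (v s)" by (intro tendsto_ennrealI lim)
      then show "ennreal (v s) = liminf (\<lambda>n. ennreal (u n s))" by (simp add: lim_imp_Liminf)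
    qed
    also have "\<dots> \<le> liminf (\<lambda>n. \<integral>\<^sup>+s. ennreal (u n s) \<partial>\<nu>)" by (rule nn_integral_liminf) measurable
    also have "(\<lambda>n. \<integral>\<^sup>+s. ennreal (u n s) \<partial>\<nu>) = (\<lambda>n. ennreal (\<integral>s. u n s \<partial>\<nu>))"
      by (rule ext, rule nn_integral_eq_integral[OF int]) (use pos in auto)
    also have "liminf \<dots> = ennreal c" using tendsto_ennrealI[OF c] by (simp add: lim_imp_Liminf)
    finally show ?thesis .
  qed
  have L1: "(\<integral>s. (1 - exp (- x n * s)) / x n \<partial>\<nu>) = (1 - (\<integral>s. exp (- x n * s) \<partial>\<nu>)) / x n" for n
    using iexp[OF x, of n] prob_space by simp
  have I1: "integrable \<nu> (\<lambda>s. (1 - exp (- x n * s)) / x n)" for n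
    using iexp[OF x, of n] by simp
  have lim1: "(\<lambda>n. \<integral>s. (1 - exp (- x n * s)) / x n \<partial>\<nu>) \<longlonglongrightarrow> \<tau>"
    unfolding L1 by (rule filterlim_compose[OF first lx])
  have "(\<integral>\<^sup>+s. ennreal s \<partial>\<nu>) \<le> ennreal \<tau>"
    by (rule fatou[OF filterlim_compose[OF one lx] I1 _ lim1]) (use x nonneg in \<open>auto simp: less_imp_le\<close>)
  also have "ennreal \<tau> < \<infinity>" by simp
  finally have ints: "integrable \<nu> (\<lambda>s. s)"
    using nonneg by (intro integrableI_nonneg) (auto intro!: AE_I2)
  have "(\<lambda>n. \<integral>s. (1 - exp (- x n * s)) / x n \<partial>\<nu>) \<longlonglongrightarrow> (\<integral>s. s \<partial>\<nu>)"
  proof (rule integral_dominated_convergence[where w = "\<lambda>s. s"])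
    show "AE s in \<nu>. (\<lambda>n. (1 - exp (- x n * s)) / x n) \<longlonglongrightarrow> s"
      by (intro AE_I2 filterlim_compose[OF one lx])
    show "AE s in \<nu>. norm ((1 - exp (- x n * s)) / x n) \<le> s" for n
    proof (rule AE_I2)
      fix s assume "s \<in> space \<nu>"
      then have "0 \<le> 1 - exp (- x n * s)" using nonneg x[of n] by simp
      then show "norm ((1 - exp (- x n * s)) / x n) \<le> s"
        using le[of "x n" s] x[of n] by (simp add: divide_le_eq mult.commute)
    qed
    show "(\<lambda>s. (1 - exp (- x n * s)) / x n) \<in> borel_measurable \<nu>" for n
      by (rule borel_measurable_integrable[OF I1])
  qed (rule meas ints)+
  then have mean: "(\<integral>s. s \<partial>\<nu>) = \<tau>" using lim1 by (rule LIMSEQ_unique)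
  show hb: "has_bochner_integral \<nu> (\<lambda>s. s) \<tau>" using ints mean by (simp add: has_bochner_integral_iff)
  have L2: "(\<integral>s. (exp (- x n * s) - 1 + x n * s) / (x n)\<^sup>2 \<partial>\<nu>) = ((\<integral>s. exp (- x n * s) \<partial>\<nu>) - 1 + \<tau> * x n) / (x n)\<^sup>2" for n
    using iexp[OF x, of n] ints mean prob_space by (simp add: mult.commute)
  have I2: "integrable \<nu> (\<lambda>s. (exp (- x n * s) - 1 + x n * s) / (x n)\<^sup>2)" for n
    using iexp[OF x, of n] ints by simp
  have lim2: "(\<lambda>n. \<integral>s. (exp (- x n * s) - 1 + x n * s) / (x n)\<^sup>2 \<partial>\<nu>) \<longlonglongrightarrow> W / 2"
    unfolding L2 by (rule filterlim_compose[OF second lx])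
  have pos2: "0 \<le> (exp (- y * s) - 1 + y * s) / y\<^sup>2" for y s :: real
    using le[of y s] by (intro divide_nonneg_nonneg) auto
  have W: "0 \<le> W / 2"
  proof (rule LIMSEQ_le_const[OF lim2], intro exI[of _ 0] allI impI)
    show "0 \<le> (\<integral>s. (exp (- x n * s) - 1 + x n * s) / (x n)\<^sup>2 \<partial>\<nu>)" for n
      by (intro integral_nonneg_AE AE_I2 pos2)
  qed
  have sq: "(\<integral>\<^sup>+s. ennreal (s\<^sup>2 / 2) \<partial>\<nu>) \<le> ennreal (W / 2)"
    by (rule fatou[OF filterlim_compose[OF two lx] I2 pos2 lim2])
  also have "ennreal (W / 2) < \<infinity>" by simp
  finally have "integrable \<nu> (\<lambda>s. s\<^sup>2 / 2)" by (intro integrableI_nonneg) auto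
  then have "integrable \<nu> (\<lambda>s. 2 * (s\<^sup>2 / 2))" by (rule integrable_mult_right)
  then have int2: "integrable \<nu> (\<lambda>s. s\<^sup>2)" by simp
  have "ennreal (\<integral>s. s\<^sup>2 / 2 \<partial>\<nu>) \<le> ennreal (W / 2)"
    using sq nn_integral_eq_integral[of \<nu> "\<lambda>s. s\<^sup>2 / 2"] int2 by simp
  then have "(\<integral>s. s\<^sup>2 \<partial>\<nu>) \<le> W" using W by (simp add: ennreal_le_iff)
  moreover have eq: "(s - \<tau>)\<^sup>2 = s\<^sup>2 - 2 * \<tau> * s + \<tau>\<^sup>2" for s by (simp add: power2_diff mult.commute)
  ultimately show "integrable \<nu> (\<lambda>s. (s - \<tau>)\<^sup>2)" "(\<integral>s. (s - \<tau>)\<^sup>2 \<partial>\<nu>) \<le> W - \<tau>\<^sup>2"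
    using int2 ints mean prob_space unfolding eq by (simp_all add: power2_eq_square)
qed

text \<open>With L the limit of the second derivative at zero, the second moment is at most \<tau>^2
  - \<tau> L, so the variance is at most -\<tau> L. Its linear growth in \<tau> is the source of the
  rate 1 / n. Taking the absolute value of L makes the constant visibly nonnegative.\<close>

lemma subordinator_moments:
  assumes "\<phi> \<in> Bernstein_Phi"
  obtains V where "0 \<le> V"
    "\<And>\<tau>. 0 < \<tau> \<Longrightarrow> has_bochner_integral (subordinator \<phi> \<tau>) (\<lambda>s. s) \<tau>"
    "\<And>\<tau>. 0 < \<tau> \<Longrightarrow> integrable (subordinator \<phi> \<tau>) (\<lambda>s. (s - \<tau>)\<^sup>2)"
    "\<And>\<tau>. 0 < \<tau> \<Longrightarrow> (\<integral>s. (s - \<tau>)\<^sup>2 \<partial>subordinator \<phi> \<tau>) \<le> V * \<tau>"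
proof -
  let ?f = "pos_restriction \<phi>"
  obtain L where \<phi>: "bernstein_function \<phi>" and \<phi>0: "\<phi> 0 = 0" and f1: "(deriv ?f \<longlongrightarrow> 1) (at_right 0)"
    and f2: "((deriv ^^ 2) ?f \<longlongrightarrow> L) (at_right 0)"
    using assms by (auto simp: Bernstein_Phi_def)
  have sm: "(deriv ^^ n) ?f differentiable (at x)" if "0 < x" for n x
    using \<phi> that by (auto simp: bernstein_function_def bernstein_on_pos_def smooth_on_pos_def)
  have d1: "(?f has_real_derivative deriv ?f x) (at x)" if "0 < x" for x
    using sm[OF that, of 0] DERIV_deriv_iff_real_differentiable by auto
  have d2: "(deriv ?f has_real_derivative (deriv ^^ 2) ?f x) (at x)" if "0 < x" for x
    using sm[OF that, of 1] DERIV_deriv_iff_real_differentiable by (auto simp: numeral_2_eq_2)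
  have f0: "(?f \<longlongrightarrow> 0) (at_right 0)"
    using tendsto_Re[OF bernstein_tendsto_zero[OF \<phi> \<phi>0]] by (simp add: pos_restriction_def[abs_def])
  have main: "has_bochner_integral \<nu> (\<lambda>s. s) \<tau> \<and> integrable \<nu> (\<lambda>s. (s - \<tau>)\<^sup>2) \<and> (\<integral>s. (s - \<tau>)\<^sup>2 \<partial>\<nu>) \<le> - \<tau> * L"
    if \<tau>: "0 < \<tau>" and \<nu>_def: "\<nu> = subordinator \<phi> \<tau>" for \<nu> \<tau>
  proof -
    have \<nu>: "is_subordinator \<phi> \<tau> \<nu>"
      unfolding \<nu>_def by (rule is_subordinator_subordinator[OF \<phi> \<phi>0]) (use \<tau> in simp)
    have lap: "(\<integral>s. exp (- x * s) \<partial>\<nu>) = exp (- \<tau> * ?f x)" if x: "0 < x" for x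
    proof -
      have "complex_of_real (\<integral>s. exp (- x * s) \<partial>\<nu>) = (\<integral>s. exp (- of_real x * of_real s) \<partial>\<nu>)"
        unfolding integral_complex_of_real[symmetric]
        by (intro Bochner_Integration.integral_cong refl) (simp add: exp_of_real[symmetric])
      also have "\<dots> = exp (- of_real \<tau> * \<phi> (of_real x))"
        using \<nu> x by (simp add: is_subordinator_def)
      also have "\<phi> (of_real x) = of_real (?f x)"
        using deriv_pos_restriction(2)[OF \<phi> x, of 0] by (simp add: pos_restriction_def complex_eq_iff)
      also have "exp (- of_real \<tau> * of_real (?f x)) = complex_of_real (exp (- \<tau> * ?f x))"
        by (simp add: exp_of_real[symmetric])
      finally show ?thesis by (simp only: of_real_eq_iff)
    qed
    note lim = exp_bernstein_second_order[OF f0 f1 f2 d1 d2, of \<tau>]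
    have ev: "eventually (\<lambda>x. exp (- \<tau> * ?f x) = (\<integral>s. exp (- x * s) \<partial>\<nu>)) (at_right 0)"
      using lap by (auto simp: eventually_at intro!: exI[of _ 1])
    have first: "((\<lambda>x. (1 - (\<integral>s. exp (- x * s) \<partial>\<nu>)) / x) \<longlongrightarrow> \<tau>) (at_right 0)"
      by (rule Lim_transform_eventually[OF lim(1)]) (use ev in \<open>auto elim!: eventually_mono\<close>)
    have second: "((\<lambda>x. ((\<integral>s. exp (- x * s) \<partial>\<nu>) - 1 + \<tau> * x) / x\<^sup>2) \<longlongrightarrow> (\<tau>\<^sup>2 - \<tau> * L) / 2) (at_right 0)"
      by (rule Lim_transform_eventually[OF lim(2)]) (use ev in \<open>auto elim!: eventually_mono\<close>)
    have "prob_space \<nu>" by (rule prob_spaceI) (rule is_subordinator_prob[OF \<phi> \<phi>0 \<nu>])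
    from laplace_moments[OF this is_subordinator_measurable[OF \<nu>] _ first second]
    show ?thesis using is_subordinator_space[OF \<nu>] by auto
  qed
  show ?thesis
  proof (rule that[of "\<bar>L\<bar>"])
    fix \<tau> :: real assume \<tau>: "0 < \<tau>"
    note m = main[OF \<tau> refl]
    show "has_bochner_integral (subordinator \<phi> \<tau>) (\<lambda>s. s) \<tau>" using m by blast
    show "integrable (subordinator \<phi> \<tau>) (\<lambda>s. (s - \<tau>)\<^sup>2)" using m by blast
    have "- \<tau> * L \<le> \<bar>L\<bar> * \<tau>" using mult_right_mono[OF abs_ge_minus_self[of L], of \<tau>] \<tau> by (simp add: mult.commute)
    then show "(\<integral>s. (s - \<tau>)\<^sup>2 \<partial>subordinator \<phi> \<tau>) \<le> \<bar>L\<bar> * \<tau>" using m by linarith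
  qed simp
qed

theorem theorem6p16:
  fixes \<phi> :: "complex \<Rightarrow> complex"
    and T :: "real \<Rightarrow> 'a::complex_banach \<Rightarrow>\<^sub>L 'a"
    and A :: "('a \<times> 'a) set"
  assumes "\<phi> \<in> Bernstein_Phi"
    and "bounded_analytic_semigroup T"
    and "A = neg_generator T"
  shows "\<exists>C>0. \<forall>\<alpha>\<in>{0..1}. \<forall>x y. (x, y) \<in> frac_power A \<alpha> \<longrightarrow>
    (\<forall>n::nat. \<forall>t::real. n \<ge> 1 \<longrightarrow> t > 0 \<longrightarrow>
       norm (exp_bernstein \<phi> (real n * t) (scale_op (1 / real n) A) x - T t x)
         \<le> C / (real n * t powr (1 - \<alpha>)) * norm y \<and>
       norm (exp_bernstein \<phi> (real n) (scale_op (t / real n) A) x - T t x)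
         \<le> C * t powr \<alpha> / real n * norm y)"
proof -
  obtain G M where sg: "analytic_semigroup T G M"
    using bounded_analytic_semigroup_imp_analytic_semigroup[OF assms(2)] by blast
  interpret analytic_semigroup T G M by (rule sg)
  obtain K where K: "K > 0"
    and K1: "\<And>\<alpha> x y t. \<alpha> \<in> {0..1} \<Longrightarrow> (x, y) \<in> frac_power A \<alpha> \<Longrightarrow> 0 < t \<Longrightarrow>
      norm (G t x) \<le> K * t powr (\<alpha> - 1) * norm y"
    and K2: "\<And>\<alpha> x y t. \<alpha> \<in> {0..1} \<Longrightarrow> (x, y) \<in> frac_power A \<alpha> \<Longrightarrow> 0 < t \<Longrightarrow>
      norm (x - T t x) \<le> K * t powr \<alpha> * norm y"
    using frac_power_estimates unfolding assms(3) by blast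
  obtain V where V: "0 \<le> V"
    and mean: "\<And>\<tau>. 0 < \<tau> \<Longrightarrow> has_bochner_integral (subordinator \<phi> \<tau>) (\<lambda>s. s) \<tau>"
    and int2: "\<And>\<tau>. 0 < \<tau> \<Longrightarrow> integrable (subordinator \<phi> \<tau>) (\<lambda>s. (s - \<tau>)\<^sup>2)"
    and var: "\<And>\<tau>. 0 < \<tau> \<Longrightarrow> (\<integral>s. (s - \<tau>)\<^sup>2 \<partial>subordinator \<phi> \<tau>) \<le> V * \<tau>"
    using subordinator_moments[OF assms(1)] by blast
  have \<phi>: "bernstein_function \<phi>" "\<phi> 0 = 0" using assms(1) by (auto simp: Bernstein_Phi_def)
  \<comment> \<open>\<open>V + 1\<close> rather than \<open>V\<close> keeps the constant positive
    when the variance bound is zero.\<close>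
  define C where "C = 16 * M * K * (V + 1)"
  have C: "C > 0" using K V M by (simp add: C_def)
  \<comment> \<open>Both inequalities at once: \<open>c = 1 / n\<close>, \<open>\<tau> = n t\<close>
    for the first and \<open>c = t / n\<close>, \<open>\<tau> = n\<close> for the second. In each
    case c \<tau> = t.\<close>
  have est: "norm (exp_bernstein \<phi> \<tau> (scale_op c A) x - T (c * \<tau>) x) \<le> C * (c * \<tau>) powr \<alpha> / \<tau> * norm y"
    if \<alpha>: "\<alpha> \<in> {0..1}" and xy: "(x, y) \<in> frac_power A \<alpha>" and c: "0 < c" and \<tau>: "0 < \<tau>" for \<alpha> x y c \<tau>
  proof -
    let ?t = "c * \<tau>"
    have t: "0 < ?t" using c \<tau> by simp
    have \<nu>: "is_subordinator \<phi> \<tau> (subordinator \<phi> \<tau>)"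
      by (rule is_subordinator_subordinator[OF \<phi>]) (use \<tau> in simp)
    have "norm (exp_bernstein \<phi> \<tau> (scale_op c A) x - T ?t x)
        \<le> 16 * M * (K * norm y) * ?t powr (\<alpha> - 2) * (c\<^sup>2 * (V * \<tau>))"
      unfolding exp_bernstein_def assms(3)
    proof (rule subordination_estimate[OF _ is_subordinator_prob[OF \<phi> \<nu>] mean[OF \<tau>] int2[OF \<tau>] var[OF \<tau>] c \<tau> refl])
      show "sets (subordinator \<phi> \<tau>) = sets (restrict_space borel {0..})"
        using \<nu> by (simp add: is_subordinator_def)
      show "norm (G r x) \<le> K * norm y * r powr (\<alpha> - 1)" if "0 < r" for r
        using K1[OF \<alpha> xy that] by (simp add: mult_ac)
      show "norm (x - T r x) \<le> K * norm y * r powr \<alpha>" if "0 < r" for r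
        using K2[OF \<alpha> xy that] by (simp add: mult_ac)
    qed (use \<alpha> K in auto)
    \<comment> \<open>With ?t = c \<tau>, the factor c^2 \<tau> is ?t^2 / \<tau>; the square raises
      the exponent \<alpha> - 2 to \<alpha>.\<close>
    also have "\<dots> = (16 * M * K * V) * (?t powr \<alpha> / \<tau> * norm y)"
    proof -
      have "?t powr \<alpha> = ?t\<^sup>2 * ?t powr (\<alpha> - 2)"
        using t powr_add[of ?t 2 "\<alpha> - 2"] by simp
      then show ?thesis using \<tau> by (simp add: power2_eq_square)
    qed
    also have "\<dots> \<le> C * (?t powr \<alpha> / \<tau> * norm y)"
      using M K V \<tau> by (intro mult_right_mono) (auto simp: C_def)
    finally show ?thesis by (simp add: mult.assoc)
  qed
  show ?thesis
  proof (intro exI[of _ C] conjI C ballI allI impI)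
    fix \<alpha> x y and n :: nat and t :: real
    assume \<alpha>: "\<alpha> \<in> {0..1}" and xy: "(x, y) \<in> frac_power A \<alpha>" and n: "1 \<le> n" and t: "0 < t"
    have "C * t powr \<alpha> / (real n * t) = C / (real n * t powr (1 - \<alpha>))"
      using t n by (simp add: powr_diff)
    then show "norm (exp_bernstein \<phi> (real n * t) (scale_op (1 / real n) A) x - T t x)
        \<le> C / (real n * t powr (1 - \<alpha>)) * norm y"
      using est[OF \<alpha> xy, of "1 / real n" "real n * t"] n t by simp
    show "norm (exp_bernstein \<phi> (real n) (scale_op (t / real n) A) x - T t x)
        \<le> C * t powr \<alpha> / real n * norm y"
      using est[OF \<alpha> xy, of "t / real n" "real n"] n t by simp
  qed
qed

end
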